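(* Let $\alpha>-2$ and $2\le N<10+4\alpha$, and let $F,Q,F^0$ be as in the context. Then there is no weak stable solution of $$-Qu=(F^0(x))^\alpha e^u\quad\text{in }\mathbb{R}^N.$$
   Context: Standing assumptions on $F$: $F:\mathbb{R}^N\to[0,\infty)$ is convex, $F\in C^2(\mathbb{R}^N\setminus\{0\})$, $F(t\xi)=|t|F(\xi)$ for $t\in\mathbb{R}$, $F(\xi)>0$ for $\xi\neq0$; $a|\xi|\le F(\xi)\le b|\xi|$ for constants $0<a\le b$; and $\mu^2|V|^2\le\sum_{i,j}F_{\xi_i\xi_j}(\xi)V_iV_j\le\Lambda|V|^2$ for all unit $\xi$ and all $V\perp\xi$. $Qu:=\sum_i\partial_{x_i}(F(\nabla u)F_{\xi_i}(\nabla u))$. $F^0(x):=\sup_{\xi\in K}\langle x,\xi\rangle$ where $K=\{\xi: F(\xi)<1\}$. A weak solution in an open set $\Omega$ is $u\in H^1_{loc}(\Omega)$ with $(F^0)^\alpha e^u\in L^1_{loc}(\Omega)$ and $\int_\Omega F(\nabla u)F_\xi(\nabla u)\cdot\nabla\phi\,dx=\int_\Omega(F^0(x))^\alpha e^u\phi\,dx$ for all $\phi\in C_c^\infty(\Omega)$; it is stable if $\int_\Omega\big[F_{\xi_i}(\nabla u)F_{\xi_j}(\nabla u)\phi_{x_i}\phi_{x_j}+F(\nabla u)F_{\xi_i\xi_j}(\nabla u)\phi_{x_i}\phi_{x_j}-(F^0(x))^\alpha e^u\phi^2\big]dx\ge0$ for all $\phi\in C_c^\infty(\Omega)$. *)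

theory Defs
  imports "HOL-Analysis.Analysis"
begin

fun pder :: "('a::euclidean_space \<Rightarrow> real) \<Rightarrow> 'a list \<Rightarrow> 'a \<Rightarrow> real" where
  "pder f [] = f"
| "pder f (b # bs) = (\<lambda>x. frechet_derivative (pder f bs) (at x) b)"

definition smooth_fun :: "('a::euclidean_space \<Rightarrow> real) \<Rightarrow> bool" where
  "smooth_fun f \<longleftrightarrow> (\<forall>bs. set bs \<subseteq> Basis \<longrightarrow> (\<forall>x. pder f bs differentiable (at x)))"

definition test_fun :: "('a::euclidean_space \<Rightarrow> real) \<Rightarrow> bool" where
  "test_fun \<phi> \<longleftrightarrow> smooth_fun \<phi> \<and> compact (closure {x. \<phi> x \<noteq> 0})"

definition grad :: "('a::euclidean_space \<Rightarrow> real) \<Rightarrow> 'a \<Rightarrow> 'a" where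
  "grad f x = (\<Sum>b\<in>Basis. frechet_derivative f (at x) b *\<^sub>R b)"

definition Fgrad :: "('a::euclidean_space \<Rightarrow> real) \<Rightarrow> 'a \<Rightarrow> 'a" where
  "Fgrad F \<xi> = (if \<xi> = 0 then 0 else grad F \<xi>)"

definition Fhess :: "('a::euclidean_space \<Rightarrow> real) \<Rightarrow> 'a \<Rightarrow> 'a \<Rightarrow> 'a \<Rightarrow> real" where
  "Fhess F \<xi> i j = (if \<xi> = 0 then 0 else frechet_derivative (\<lambda>\<eta>. Fgrad F \<eta> \<bullet> j) (at \<xi>) i)"

definition Fdual :: "('a::euclidean_space \<Rightarrow> real) \<Rightarrow> 'a \<Rightarrow> real" where
  "Fdual F x = Sup ((\<lambda>\<xi>. x \<bullet> \<xi>) ` {\<xi>. F \<xi> < 1})"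

definition admissible_F :: "('a::euclidean_space \<Rightarrow> real) \<Rightarrow> bool" where
  "admissible_F F \<longleftrightarrow>
     convex_on UNIV F \<and> (\<forall>\<xi>. F \<xi> \<ge> 0) \<and>
     (\<forall>\<xi>. \<xi> \<noteq> 0 \<longrightarrow> F differentiable (at \<xi>)) \<and>
     (\<forall>\<xi> j. \<xi> \<noteq> 0 \<longrightarrow> j \<in> Basis \<longrightarrow> (\<lambda>\<eta>. Fgrad F \<eta> \<bullet> j) differentiable (at \<xi>)) \<and>
     (\<forall>i\<in>Basis. \<forall>j\<in>Basis. continuous_on (UNIV - {0}) (\<lambda>\<xi>. Fhess F \<xi> i j)) \<and>
     (\<forall>t \<xi>. F (t *\<^sub>R \<xi>) = \<bar>t\<bar> * F \<xi>) \<and>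
     (\<forall>\<xi>. \<xi> \<noteq> 0 \<longrightarrow> F \<xi> > 0) \<and>
     (\<exists>a b. 0 < a \<and> a \<le> b \<and> (\<forall>\<xi>. a * norm \<xi> \<le> F \<xi> \<and> F \<xi> \<le> b * norm \<xi>)) \<and>
     (\<exists>\<mu> \<Lambda>. 0 < \<mu> \<and> (\<forall>\<xi> V. norm \<xi> = 1 \<longrightarrow> V \<bullet> \<xi> = 0 \<longrightarrow>
         \<mu>\<^sup>2 * (norm V)\<^sup>2 \<le> (\<Sum>i\<in>Basis. \<Sum>j\<in>Basis. Fhess F \<xi> i j * (V \<bullet> i) * (V \<bullet> j)) \<and>
         (\<Sum>i\<in>Basis. \<Sum>j\<in>Basis. Fhess F \<xi> i j * (V \<bullet> i) * (V \<bullet> j)) \<le> \<Lambda> * (norm V)\<^sup>2))"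

definition loc_integrable :: "('a::euclidean_space \<Rightarrow> real) \<Rightarrow> bool" where
  "loc_integrable f \<longleftrightarrow> (\<forall>K. compact K \<longrightarrow> set_integrable lborel K f)"

definition loc_L2 :: "('a::euclidean_space \<Rightarrow> 'b::euclidean_space) \<Rightarrow> bool" where
  "loc_L2 f \<longleftrightarrow> f \<in> borel_measurable lborel \<and> loc_integrable (\<lambda>x. (norm (f x))\<^sup>2)"

definition weak_grad :: "('a::euclidean_space \<Rightarrow> real) \<Rightarrow> ('a \<Rightarrow> 'a) \<Rightarrow> bool" where
  "weak_grad u g \<longleftrightarrow> (\<forall>\<phi>. test_fun \<phi> \<longrightarrow> (\<forall>b\<in>Basis.
      (\<integral>x. u x * (grad \<phi> x \<bullet> b) \<partial>lborel) = - (\<integral>x. (g x \<bullet> b) * \<phi> x \<partial>lborel)))"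

definition H1loc_grad :: "('a::euclidean_space \<Rightarrow> real) \<Rightarrow> ('a \<Rightarrow> 'a) \<Rightarrow> bool" where
  "H1loc_grad u g \<longleftrightarrow> loc_L2 u \<and> loc_L2 g \<and> weak_grad u g"

definition weak_solution :: "('a::euclidean_space \<Rightarrow> real) \<Rightarrow> real \<Rightarrow> ('a \<Rightarrow> real) \<Rightarrow> ('a \<Rightarrow> 'a) \<Rightarrow> bool" where
  "weak_solution F \<alpha> u Du \<longleftrightarrow> H1loc_grad u Du \<and>
     loc_integrable (\<lambda>x. Fdual F x powr \<alpha> * exp (u x)) \<and>
     (\<forall>\<phi>. test_fun \<phi> \<longrightarrow>
        (\<integral>x. F (Du x) * (Fgrad F (Du x) \<bullet> grad \<phi> x) \<partial>lborel) =
        (\<integral>x. Fdual F x powr \<alpha> * exp (u x) * \<phi> x \<partial>lborel))"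

definition stable :: "('a::euclidean_space \<Rightarrow> real) \<Rightarrow> real \<Rightarrow> ('a \<Rightarrow> real) \<Rightarrow> ('a \<Rightarrow> 'a) \<Rightarrow> bool" where
  "stable F \<alpha> u Du \<longleftrightarrow>
     (\<forall>\<phi>. test_fun \<phi> \<longrightarrow>
        (\<integral>x. (\<Sum>i\<in>Basis. \<Sum>j\<in>Basis.
               (Fgrad F (Du x) \<bullet> i) * (Fgrad F (Du x) \<bullet> j) * (grad \<phi> x \<bullet> i) * (grad \<phi> x \<bullet> j)
             + F (Du x) * Fhess F (Du x) i j * (grad \<phi> x \<bullet> i) * (grad \<phi> x \<bullet> j))
           - Fdual F x powr \<alpha> * exp (u x) * (\<phi> x)\<^sup>2 \<partial>lborel) \<ge> 0)"

end

theory Submission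
  imports Defs
begin

text \<open>
  Put \<open>\<beta>(s) = ln (1 + exp (t s))\<close> with \<open>0 < t < 2\<close>. It lies below \<open>exp (t s)\<close> but grows only
  linearly, so that \<open>\<beta>(u)\<close> is controlled by \<open>u \<in> H\<^sup>1\<close>; and \<open>\<gamma> = \<integral> \<beta>'\<^sup>2\<close> satisfies both
  \<open>\<gamma> \<le> (t/2) \<beta>\<^sup>2\<close> and \<open>\<gamma> \<le> \<beta> \<beta>'\<close>. Test the stability inequality with \<open>\<beta>(u) \<eta>\<close> and subtract
  \<open>\<kappa> > 1\<close> times the equation tested with \<open>\<gamma>(u) \<eta>\<^sup>2\<close>. By homogeneity of \<open>F\<close> the gradient terms
  combine to \<open>- (\<kappa> - 1) \<beta>'\<^sup>2 F(Du)\<^sup>2 \<eta>\<^sup>2\<close>, which absorbs the mixed terms, and what remains is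
  \<open>\<integral> (F\<^sup>0)\<^sup>\<alpha> e\<^sup>u \<beta>(u)\<^sup>2 \<eta>\<^sup>2 \<le> C \<integral> \<beta>(u)\<^sup>2 |\<nabla>\<eta>|\<^sup>2\<close>. These functions are not admissible for a merely
  \<open>H\<^sup>1\<close> solution, but they become so when the inner \<open>u\<close> is replaced by a mollification of it;
  since \<open>\<beta>\<^sup>2 - \<kappa> \<gamma> \<ge> 0\<close>, a single application of Fatou's lemma removes the mollification. For a
  cutoff \<open>\<eta>\<close> at scale \<open>R\<close> the right-hand side is partly absorbed because \<open>\<beta>(u) \<le> exp (t u)\<close>,
  which leaves \<open>R\<^sup>p\<close> with \<open>p = N - 2 - 2 t (2 + \<alpha>)\<close>. For \<open>N < 10 + 4 \<alpha>\<close> this exponent is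
  negative once \<open>t\<close> is close to \<open>2\<close>, and \<open>R \<rightarrow> \<infinity>\<close> gives a contradiction.
\<close>

section \<open>Smooth functions\<close>

lemma pder_append: "pder f (bs @ cs) = pder (pder f cs) bs"
  by (induction bs) auto

lemma smooth_fun_iff:
  "smooth_fun f \<longleftrightarrow> (\<forall>x. f differentiable (at x)) \<and> (\<forall>b\<in>Basis. smooth_fun (pder f [b]))"
proof (intro iffI conjI allI ballI)
  assume f: "smooth_fun f"
  show "f differentiable (at x)" for x
    using f unfolding smooth_fun_def by (metis empty_set empty_subsetI pder.simps(1))
  show "smooth_fun (pder f [b])" if "b \<in> Basis" for b
    using f that unfolding smooth_fun_def pder_append[symmetric] by auto
next
  assume f: "(\<forall>x. f differentiable (at x)) \<and> (\<forall>b\<in>Basis. smooth_fun (pder f [b]))"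
  show "smooth_fun f"
    unfolding smooth_fun_def
  proof (intro allI impI)
    fix bs :: "'a list" and x
    assume "set bs \<subseteq> Basis"
    then show "pder f bs differentiable (at x)"
      using f by (cases bs rule: rev_cases) (auto simp: smooth_fun_def pder_append)
  qed
qed

lemma smooth_fun_coinduct:
  assumes "f \<in> S" "\<And>g x. g \<in> S \<Longrightarrow> g differentiable (at x)"
    and "\<And>g b. g \<in> S \<Longrightarrow> b \<in> Basis \<Longrightarrow> pder g [b] \<in> S"
  shows "smooth_fun f"
proof -
  have "pder f bs \<in> S" if "set bs \<subseteq> Basis" for bs
    using that
  proof (induction bs)
    case (Cons b bs)
    then show ?case using assms(3)[of "pder f bs" b] by simp
  qed (use assms in simp)
  then show ?thesis
    unfolding smooth_fun_def using assms(2) by blast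
qed

lemma smooth_fun_differentiable: "smooth_fun f \<Longrightarrow> f differentiable (at x)"
  using smooth_fun_iff by blast

lemma smooth_fun_continuous: "smooth_fun f \<Longrightarrow> continuous_on S f"
  by (meson continuous_at_imp_continuous_on
      differentiable_imp_continuous_within smooth_fun_differentiable)

lemma smooth_fun_measurable: "smooth_fun f \<Longrightarrow> f \<in> borel_measurable borel"
  by (rule borel_measurable_continuous_onI[OF smooth_fun_continuous])

lemma pder_singleton_eqI:
  assumes "\<And>x. (f has_derivative D x) (at x)"
  shows "pder f [b] = (\<lambda>x. D x b)"
  using frechet_derivative_at[OF assms] by (metis pder.simps)

lemma has_derivative_pder:
  assumes "f differentiable (at x)"
  shows "(f has_derivative (\<lambda>b. pder f [b] x)) (at x)"
  using assms by (simp add: frechet_derivative_works)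

lemma pder_add:
  assumes "\<And>x. f differentiable (at x)" "\<And>x. g differentiable (at x)"
  shows "pder (\<lambda>x. f x + g x) [b] = (\<lambda>x. pder f [b] x + pder g [b] x)"
  by (rule pder_singleton_eqI) (intro has_derivative_add has_derivative_pder assms)

lemma pder_mult:
  assumes "\<And>x. f differentiable (at x)" "\<And>x. g differentiable (at x)"
  shows "pder (\<lambda>x. f x * g x) [b] = (\<lambda>x. f x * pder g [b] x + pder f [b] x * g x)"
  by (rule pder_singleton_eqI) (intro has_derivative_mult has_derivative_pder assms)

lemma pder_real:
  assumes "\<And>x. (f has_real_derivative f' x) (at x)"
  shows "pder f [1] = f'"
  using pder_singleton_eqI[OF assms[unfolded has_field_derivative_def], of 1] by simp

lemma has_derivative_real_compose_pder:
  fixes h :: "real \<Rightarrow> real"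
  assumes "h differentiable (at (f x))" "f differentiable (at x)"
  shows "((\<lambda>x. h (f x)) has_derivative (\<lambda>b. pder f [b] x * pder h [1] (f x))) (at x)"
proof -
  have "pder h [r] (f x) = r * pder h [1] (f x)" for r
    using linear_cmul[OF has_derivative_linear[OF has_derivative_pder[OF assms(1)]], of r 1] by simp
  then show ?thesis
    by (intro has_derivative_eq_rhs[OF has_derivative_compose[OF has_derivative_pder[OF assms(2)]
          has_derivative_pder[OF assms(1)]]] ext)
qed

inductive_set smooth_closure :: "('a::euclidean_space \<Rightarrow> real) set" where
  base: "smooth_fun f \<Longrightarrow> f \<in> smooth_closure"
| add: "f \<in> smooth_closure \<Longrightarrow> g \<in> smooth_closure \<Longrightarrow> (\<lambda>x. f x + g x) \<in> smooth_closure"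
| mult: "f \<in> smooth_closure \<Longrightarrow> g \<in> smooth_closure \<Longrightarrow> (\<lambda>x. f x * g x) \<in> smooth_closure"
| comp: "smooth_fun h \<Longrightarrow> f \<in> smooth_closure \<Longrightarrow> (\<lambda>x. h (f x)) \<in> smooth_closure"

lemma smooth_closure_pder:
  assumes "f \<in> smooth_closure"
  shows "(\<forall>x. f differentiable (at x)) \<and> (\<forall>b\<in>Basis. pder f [b] \<in> smooth_closure)"
  using assms
proof induction
  case (base f)
  then show ?case
    using smooth_fun_iff smooth_closure.base by blast
next
  case (add f g)
  then have "(\<lambda>x. pder f [b] x + pder g [b] x) \<in> smooth_closure" if "b \<in> Basis" for b
    using that by (intro smooth_closure.add) auto
  then show ?case
    using add by (simp add: pder_add del: pder.simps)
next
  case (mult f g)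
  then have "(\<lambda>x. f x * pder g [b] x + pder f [b] x * g x) \<in> smooth_closure" if "b \<in> Basis" for b
    using that by (intro smooth_closure.add smooth_closure.mult) auto
  then show ?case
    using mult by (simp add: pder_mult del: pder.simps)
next
  case (comp h f)
  then have "h differentiable (at s)" for s
    using smooth_fun_differentiable by blast
  then have D: "((\<lambda>x. h (f x)) has_derivative (\<lambda>b. pder f [b] x * pder h [1] (f x))) (at x)" for x
    using comp by (intro has_derivative_real_compose_pder) auto
  have "smooth_fun (pder h [1])"
    using comp smooth_fun_iff[of h] by auto
  with comp have "(\<lambda>x. pder f [b] x * pder h [1] (f x)) \<in> smooth_closure" if "b \<in> Basis" for b
    using smooth_closure.comp[of "pder h [1]" f] that by (intro smooth_closure.mult) auto
  with D show ?case
    unfolding pder_singleton_eqI[OF D] differentiable_def by blast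
qed

lemma smooth_closure_imp_smooth_fun: "f \<in> smooth_closure \<Longrightarrow> smooth_fun f"
  using smooth_fun_coinduct[of f smooth_closure] smooth_closure_pder by blast

lemma smooth_fun_add: "smooth_fun f \<Longrightarrow> smooth_fun g \<Longrightarrow> smooth_fun (\<lambda>x. f x + g x)"
  by (rule smooth_closure_imp_smooth_fun[OF smooth_closure.add]; rule smooth_closure.base)

lemma smooth_fun_mult: "smooth_fun f \<Longrightarrow> smooth_fun g \<Longrightarrow> smooth_fun (\<lambda>x. f x * g x)"
  by (rule smooth_closure_imp_smooth_fun[OF smooth_closure.mult]; rule smooth_closure.base)

lemma smooth_fun_compose: "smooth_fun h \<Longrightarrow> smooth_fun f \<Longrightarrow> smooth_fun (\<lambda>x. h (f x))"
  using smooth_closure_imp_smooth_fun[OF smooth_closure.comp[of h f]] smooth_closure.base[of f]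
  by simp

lemma smooth_fun_const: "smooth_fun (\<lambda>x. c)"
  by (rule smooth_fun_coinduct[where S="range (\<lambda>c x. c)"]) auto

lemma smooth_fun_cmult: "smooth_fun f \<Longrightarrow> smooth_fun (\<lambda>x. c * f x)"
  by (rule smooth_fun_mult[OF smooth_fun_const])

lemma smooth_fun_diff: "smooth_fun f \<Longrightarrow> smooth_fun g \<Longrightarrow> smooth_fun (\<lambda>x. f x - g x)"
  using smooth_fun_add[OF _ smooth_fun_cmult[of g "-1"], of f] by simp

lemma smooth_fun_power: "smooth_fun f \<Longrightarrow> smooth_fun (\<lambda>x. f x ^ n)"
  by (induction n) (auto intro: smooth_fun_const smooth_fun_mult)

lemma smooth_fun_inner: "smooth_fun (\<lambda>x. x \<bullet> v)"
proof -
  have D: "((\<lambda>x. x \<bullet> v) has_derivative (\<lambda>w. w \<bullet> v)) (at x)" for x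
    by (auto intro!: derivative_eq_intros)
  then show ?thesis
    unfolding smooth_fun_iff[of "\<lambda>x. x \<bullet> v"] pder_singleton_eqI[OF D]
    by (auto simp: differentiable_def intro: smooth_fun_const)
qed

lemma smooth_fun_id: "smooth_fun (\<lambda>x::real. x)"
  using smooth_fun_inner[of "1::real"] by simp

lemma smooth_fun_inner_self: "smooth_fun (\<lambda>x. x \<bullet> x)"
proof -
  have D: "((\<lambda>x. x \<bullet> x) has_derivative (\<lambda>w. 2 * (x \<bullet> w))) (at x)" for x
    by (auto intro!: derivative_eq_intros simp: inner_commute)
  then show ?thesis
    unfolding smooth_fun_iff[of "\<lambda>x. x \<bullet> x"] pder_singleton_eqI[OF D]
    by (auto simp: differentiable_def intro: smooth_fun_cmult smooth_fun_inner)
qed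

lemma smooth_fun_reflect:
  fixes f :: "'a::euclidean_space \<Rightarrow> real"
  assumes "smooth_fun f"
  shows "smooth_fun (\<lambda>y. f (x - y))"
proof (rule smooth_fun_coinduct[where S="{\<lambda>y. c * g (x - y) | c g. smooth_fun g}"])
  show "(\<lambda>y. f (x - y)) \<in> {\<lambda>y. c * g (x - y) | c g. smooth_fun g}"
    using assms by (auto intro!: exI[of _ 1])
  fix h assume "h \<in> {\<lambda>y. c * g (x - y) | c g. smooth_fun g}"
  then obtain c g where h: "h = (\<lambda>y. c * g (x - y))" and g: "smooth_fun g" by blast
  have D: "(h has_derivative (\<lambda>b. - c * pder g [b] (x - y))) (at y)" for y
  proof -
    have "((\<lambda>y. x - y) has_derivative uminus) (at y)"
      by (auto intro!: derivative_eq_intros)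
    from has_derivative_compose[OF this has_derivative_pder[OF smooth_fun_differentiable[OF g]]]
    have "((\<lambda>y. c * g (x - y)) has_derivative (\<lambda>b. c * pder g [- b] (x - y))) (at y)"
      by (rule has_derivative_mult_right)
    moreover have "pder g [- b] (x - y) = - pder g [b] (x - y)" for b
      using linear_neg[OF
        has_derivative_linear[OF has_derivative_pder[OF smooth_fun_differentiable[OF g]]]] .
    ultimately show ?thesis unfolding h by simp
  qed
  then show "h differentiable (at y)" for y
    unfolding differentiable_def by blast
  show "pder h [b] \<in> {\<lambda>y. c * g (x - y) | c g. smooth_fun g}" if "b \<in> Basis" for b
    using that g smooth_fun_iff[of g] unfolding pder_singleton_eqI[OF D] by blast
qed

lemma smooth_fun_realI:
  assumes "\<And>x. (f has_real_derivative f' x) (at x)" "smooth_fun f'"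
  shows "smooth_fun f"
  using assms pder_real[of f f']
  by (subst smooth_fun_iff) (auto simp: real_differentiable_def)

lemma smooth_fun_real_coinduct:
  assumes "f \<in> S" "\<And>g. g \<in> S \<Longrightarrow> \<exists>g'\<in>S. \<forall>x. (g has_real_derivative g' x) (at x)"
  shows "smooth_fun f"
  using assms(1)
proof (rule smooth_fun_coinduct)
  fix g :: "real \<Rightarrow> real" assume "g \<in> S"
  then obtain g' where g': "g' \<in> S" "\<And>x. (g has_real_derivative g' x) (at x)"
    using assms(2) by blast
  show "g differentiable (at x)" for x
    using g'(2)[of x] real_differentiable_def by blast
  show "pder g [b] \<in> S" if "b \<in> Basis" for b
    using g'(1) pder_real[OF g'(2)] that by simp
qed

section \<open>Gradients\<close>

lemma has_derivative_grad:
  assumes "f differentiable (at x)"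
  shows "(f has_derivative (\<lambda>h. grad f x \<bullet> h)) (at x)"
proof -
  let ?D = "frechet_derivative f (at x)"
  have "?D h = grad f x \<bullet> h" for h
  proof -
    have "?D h = ?D (\<Sum>b\<in>Basis. (h \<bullet> b) *\<^sub>R b)"
      by (simp add: euclidean_representation)
    also have "\<dots> = (\<Sum>b\<in>Basis. (h \<bullet> b) * ?D b)"
      using linear_frechet_derivative[OF assms] by (simp add: linear_sum linear_cmul)
    also have "\<dots> = grad f x \<bullet> h"
      unfolding grad_def by (simp add: inner_sum_left inner_commute[of h] mult.commute)
    finally show ?thesis .
  qed
  then have "?D = (\<lambda>h. grad f x \<bullet> h)" by auto
  then show ?thesis
    using assms frechet_derivative_works by metis
qed

lemma grad_eqI:
  assumes "(f has_derivative (\<lambda>h. v \<bullet> h)) (at x)"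
  shows "grad f x = v"
  unfolding grad_def frechet_derivative_at[OF assms, symmetric] by (rule euclidean_representation)

lemma grad_inner_Basis: "b \<in> Basis \<Longrightarrow> grad f x \<bullet> b = pder f [b] x"
  by (simp add: grad_def inner_sum_left inner_Basis if_distrib cong: if_cong)

lemma continuous_on_grad: "smooth_fun f \<Longrightarrow> continuous_on S (grad f)"
  using smooth_fun_iff[of f] smooth_fun_continuous[where f="pder f [_]"] unfolding grad_def
  by (intro continuous_on_sum continuous_on_scaleR continuous_on_const) simp

lemma grad_measurable: "smooth_fun f \<Longrightarrow> grad f \<in> borel_measurable borel"
  by (rule borel_measurable_continuous_onI[OF continuous_on_grad])

lemma grad_compose:
  assumes "(f has_real_derivative f') (at (v x))" "v differentiable (at x)"
  shows "grad (\<lambda>x. f (v x)) x = f' *\<^sub>R grad v x"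
  using has_derivative_compose[OF has_derivative_grad[OF assms(2)], of f "\<lambda>k. f' * k"] assms(1)
  by (intro grad_eqI) (simp add: has_field_derivative_def)

lemma grad_mult:
  assumes "f differentiable (at x)" "g differentiable (at x)"
  shows "grad (\<lambda>x. f x * g x) x = g x *\<^sub>R grad f x + f x *\<^sub>R grad g x"
  using has_derivative_mult[OF assms[THEN has_derivative_grad]]
  by (intro grad_eqI) (simp add: inner_add_left algebra_simps)

lemma grad_power:
  assumes "f differentiable (at x)"
  shows "grad (\<lambda>x. f x ^ n) x = (real n * f x ^ (n - 1)) *\<^sub>R grad f x"
  by (rule grad_compose[where f="\<lambda>s. s ^ n", OF _ assms]) (auto intro!: derivative_eq_intros)

lemma grad_reflect:
  assumes "f differentiable (at (x - y))"
  shows "grad (\<lambda>y. f (x - y)) y = - grad f (x - y)"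
proof (rule grad_eqI)
  have "((\<lambda>y. x - y) has_derivative uminus) (at y)"
    by (auto intro!: derivative_eq_intros)
  from has_derivative_compose[OF this has_derivative_grad[OF assms]]
  show "((\<lambda>y. f (x - y)) has_derivative (\<lambda>h. - grad f (x - y) \<bullet> h)) (at y)"
    by simp
qed

lemma grad_eq_0_on_open:
  assumes "open S" "x \<in> S" "\<And>y. y \<in> S \<Longrightarrow> f y = c"
  shows "grad f x = 0"
proof (rule grad_eqI)
  have "((\<lambda>x. c) has_derivative (\<lambda>h. 0 \<bullet> h)) (at x)" by simp
  then show "(f has_derivative (\<lambda>h. 0 \<bullet> h)) (at x)"
    by (rule has_derivative_transform_within_open[OF _ assms(1,2)]) (simp add: assms(3))
qed

section \<open>Test functions\<close>

lemma continuous_bounded_support_imp_bounded_range: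
  fixes f :: "'a::heine_borel \<Rightarrow> 'b::real_normed_vector"
  assumes "continuous_on UNIV f" "bounded {x. f x \<noteq> 0}"
  shows "bounded (range f)"
proof (rule bounded_subset)
  show "bounded (insert 0 (f ` closure {x. f x \<noteq> 0}))"
    using assms by (intro bounded_insert[THEN iffD2] compact_imp_bounded compact_continuous_image)
      (auto intro: continuous_on_subset)
  show "range f \<subseteq> insert 0 (f ` closure {x. f x \<noteq> 0})"
    using closure_subset[of "{x. f x \<noteq> 0}"] by auto
qed

lemma continuous_bounded_support_imp_uniformly_continuous:
  fixes f :: "'a::euclidean_space \<Rightarrow> 'b::real_normed_vector"
  assumes "continuous_on UNIV f" "bounded {x. f x \<noteq> 0}"
  shows "uniformly_continuous_on UNIV f"
  unfolding uniformly_continuous_on_def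
proof (intro allI impI)
  fix e :: real assume "e > 0"
  obtain R where R: "\<And>x. f x \<noteq> 0 \<Longrightarrow> norm x \<le> R"
    using assms(2) unfolding bounded_iff by blast
  have "uniformly_continuous_on (cball 0 (R + 1)) f"
    using assms(1) by (intro compact_uniformly_continuous) (auto intro: continuous_on_subset)
  then obtain d where d: "d > 0"
    "\<And>x y. x \<in> cball 0 (R + 1) \<Longrightarrow> y \<in> cball 0 (R + 1) \<Longrightarrow> dist y x < d \<Longrightarrow> dist (f y) (f x) < e"
    unfolding uniformly_continuous_on_def using \<open>e > 0\<close> by metis
  show "\<exists>d>0. \<forall>x\<in>UNIV. \<forall>y\<in>UNIV. dist y x < d \<longrightarrow> dist (f y) (f x) < e"
  proof (intro exI[of _ "min d 1"] conjI ballI impI)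
    fix x y :: 'a assume xy: "dist y x < min d 1"
    show "dist (f y) (f x) < e"
    proof (cases "f x = 0 \<and> f y = 0")
      case False
      then have "norm x \<le> R \<or> norm y \<le> R" using R by blast
      then have "x \<in> cball 0 (R + 1)" "y \<in> cball 0 (R + 1)"
        using xy norm_triangle_ineq2[of x y] norm_triangle_ineq3[of x y]
        by (auto simp: dist_norm norm_minus_commute)
      then show ?thesis using d xy by auto
    qed (use \<open>e > 0\<close> in simp)
  qed (use d in simp)
qed

lemma test_fun_iff: "test_fun f \<longleftrightarrow> smooth_fun f \<and> bounded {x. f x \<noteq> 0}"
  by (simp add: test_fun_def)

lemma test_funD:
  assumes "test_fun f"
  shows "smooth_fun f" "bounded {x. f x \<noteq> 0}"
  using assms by (auto simp: test_fun_iff)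

lemma test_fun_mult: "smooth_fun f \<Longrightarrow> test_fun g \<Longrightarrow> test_fun (\<lambda>x. f x * g x)"
  unfolding test_fun_iff by (auto intro: smooth_fun_mult bounded_subset)

lemma test_fun_cmult: "test_fun f \<Longrightarrow> test_fun (\<lambda>x. c * f x)"
  by (rule test_fun_mult[OF smooth_fun_const])

lemma test_fun_power:
  assumes "test_fun f" "n > 0"
  shows "test_fun (\<lambda>x. f x ^ n)"
  using assms unfolding test_fun_iff by (auto intro: smooth_fun_power)

lemma bounded_support_reflect:
  fixes f :: "'a::real_normed_vector \<Rightarrow> 'b::zero"
  assumes "bounded {y. f y \<noteq> 0}"
  shows "bounded {y. f (x - y) \<noteq> 0}"
proof -
  obtain R where "\<And>z. f z \<noteq> 0 \<Longrightarrow> norm z \<le> R"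
    using assms unfolding bounded_iff by blast
  then have "norm y \<le> norm x + R" if "f (x - y) \<noteq> 0" for y
    using that norm_triangle_ineq4[of x "x - y"] by fastforce
  then show ?thesis
    by (intro boundedI[of _ "norm x + R"]) simp
qed

lemma test_fun_reflect: "test_fun f \<Longrightarrow> test_fun (\<lambda>y. f (x - y))"
  using smooth_fun_reflect bounded_support_reflect unfolding test_fun_iff by blast

lemma test_fun_bounded_range: "test_fun f \<Longrightarrow> bounded (range f)"
  by (intro continuous_bounded_support_imp_bounded_range smooth_fun_continuous test_funD)

lemma bounded_support_grad:
  assumes "test_fun f"
  shows "bounded {x. grad f x \<noteq> 0}"
proof (rule bounded_subset)
  show "bounded (closure {x. f x \<noteq> 0})"
    using test_funD(2)[OF assms] by (rule bounded_closure)
  show "{x. grad f x \<noteq> 0} \<subseteq> closure {x. f x \<noteq> 0}"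
  proof (rule subsetI, rule ccontr)
    fix x assume x: "x \<in> {x. grad f x \<noteq> 0}" "x \<notin> closure {x. f x \<noteq> 0}"
    have "f y = 0" if "y \<in> - closure {x. f x \<noteq> 0}" for y
      using subsetD[OF closure_subset, of y "{x. f x \<noteq> 0}"] that by fast
    then have "grad f x = 0"
      by (rule grad_eq_0_on_open[OF open_Compl[OF closed_closure] Compl_iff[THEN iffD2, OF x(2)]])
    with x(1) show False by simp
  qed
qed

lemma bounded_range_grad: "test_fun f \<Longrightarrow> bounded (range (grad f))"
  by (intro continuous_bounded_support_imp_bounded_range
      continuous_on_grad test_funD bounded_support_grad)

lemma test_fun_pder:
  assumes "test_fun f" "b \<in> Basis"
  shows "test_fun (pder f [b])"
  unfolding test_fun_iff
proof
  show "smooth_fun (pder f [b])"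
    using assms smooth_fun_iff[of f] test_funD(1) by blast
  have "{x. pder f [b] x \<noteq> 0} \<subseteq> {x. grad f x \<noteq> 0}"
    unfolding grad_inner_Basis[OF assms(2), symmetric] by auto
  then show "bounded {x. pder f [b] x \<noteq> 0}"
    using bounded_support_grad[OF assms(1)] bounded_subset by blast
qed

lemma test_fun_uniform_linearization:
  assumes "test_fun f" "e > 0"
  obtains d where "d > 0" "\<And>w h. norm h < d \<Longrightarrow> \<bar>f (w + h) - f w - grad f w \<bullet> h\<bar> \<le> norm h * e"
proof -
  have "uniformly_continuous_on UNIV (grad f)"
    by (intro continuous_bounded_support_imp_uniformly_continuous continuous_on_grad
        bounded_support_grad test_funD(1) assms(1))
  then obtain d where d: "d > 0" "\<And>x y. dist x y < d \<Longrightarrow> dist (grad f x) (grad f y) < e"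
    using assms(2) unfolding uniformly_continuous_on_def by (metis UNIV_I)
  show ?thesis
  proof
    show "d > 0" by (rule d)
    fix w h :: 'a assume h: "norm h < d"
    have "norm (f (w + h) - f w - grad f w \<bullet> (w + h - w)) \<le> norm (w + h - w) * e"
    proof (rule differentiable_bound_linearization[where S="ball w d" and f'="\<lambda>x h. grad f x \<bullet> h"])
      show "w + t *\<^sub>R (w + h - w) \<in> ball w d" if "t \<in> {0..1}" for t
        using that h mult_left_le_one_le[of "norm h" "\<bar>t\<bar>"]
        by (auto simp: dist_norm intro: order_le_less_trans)
      show "(f has_derivative (\<lambda>h. grad f x \<bullet> h)) (at x within ball w d)" for x
        using assms(1)
        by (rule has_derivative_at_withinI[OF
            has_derivative_grad[OF smooth_fun_differentiable[OF test_funD(1)]]])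
      show "onorm ((\<lambda>h. grad f x \<bullet> h) - (\<lambda>h. grad f w \<bullet> h)) \<le> e" if "x \<in> ball w d" for x
      proof (rule onorm_bound)
        fix v
        have "norm (grad f x - grad f w) \<le> e"
          using d(2)[of x w] that by (simp add: dist_commute dist_norm norm_minus_commute)
        then have "norm ((grad f x - grad f w) \<bullet> v) \<le> e * norm v"
          by (metis Cauchy_Schwarz_ineq2 mult_right_mono norm_ge_zero order_trans real_norm_def)
        then show "norm (((\<lambda>h. grad f x \<bullet> h) - (\<lambda>h. grad f w \<bullet> h)) v) \<le> e * norm v"
          by (simp add: inner_diff_left)
      qed (use assms in simp)
    qed (use d in simp)
    then show "\<bar>f (w + h) - f w - grad f w \<bullet> h\<bar> \<le> norm h * e"
      by simp
  qed
qed

lemma test_fun_bounds: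
  assumes "test_fun f"
  obtains R E where "\<And>x. x \<notin> cball 0 R \<Longrightarrow> f x = 0 \<and> grad f x = 0"
    "\<And>x. \<bar>f x\<bar> \<le> E" "\<And>x. norm (grad f x) \<le> E"
proof -
  have "bounded ({x. f x \<noteq> 0} \<union> {x. grad f x \<noteq> 0})"
    "bounded (range f \<union> {})" "bounded (range (grad f))"
    using assms
    by (simp_all add: test_funD(2) bounded_support_grad test_fun_bounded_range bounded_range_grad)
  then obtain R A B where "\<forall>x\<in>{x. f x \<noteq> 0} \<union> {x. grad f x \<noteq> 0}. norm x \<le> R"
    and A: "\<And>x. norm (f x) \<le> A" and B: "\<And>x. norm (grad f x) \<le> B"
    unfolding bounded_iff by auto
  then have "f x = 0 \<and> grad f x = 0" if "x \<notin> cball 0 R" for x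
    using that by auto
  moreover have "\<bar>f x\<bar> \<le> max A B" "norm (grad f x) \<le> max A B" for x
    using A[of x] B[of x] by auto
  ultimately show ?thesis using that by blast
qed

section \<open>A smooth cutoff\<close>

definition flat :: "real poly \<Rightarrow> real \<Rightarrow> real" where
  "flat p s = (if s > 0 then poly p (1 / s) * exp (- 1 / s) else 0)"

lemma poly_mult_exp_neg_tendsto_0: "((\<lambda>y. poly p y * exp (- y)) \<longlongrightarrow> (0::real)) at_top"
proof -
  have "((\<lambda>y. \<Sum>i\<le>degree p. coeff p i * (y ^ i / exp y)) \<longlongrightarrow> (\<Sum>i\<le>degree p. coeff p i * 0)) at_top"
    by (intro tendsto_sum tendsto_mult tendsto_const tendsto_power_div_exp_0)
  then show ?thesis
    by (simp add: poly_altdef sum_distrib_right exp_minus divide_inverse mult.assoc)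
qed

lemma has_real_derivative_flat_0: "(flat p has_real_derivative 0) (at 0)"
proof -
  have "((\<lambda>y. poly (monom 1 1 * p) y * exp (- y)) \<longlongrightarrow> 0) at_top"
    by (rule poly_mult_exp_neg_tendsto_0)
  then have "((\<lambda>h. poly (monom 1 1 * p) (inverse h) * exp (- inverse h)) \<longlongrightarrow> 0) (at_right 0)"
    by (rule filterlim_compose[OF _ filterlim_inverse_at_top_right])
  then have right: "((\<lambda>h. (flat p (0 + h) - flat p 0) / h) \<longlongrightarrow> 0) (at_right 0)"
    by (rule tendsto_cong[THEN iffD1, rotated])
      (auto simp: eventually_at_filter flat_def poly_monom field_simps)
  have left: "((\<lambda>h. (flat p (0 + h) - flat p 0) / h) \<longlongrightarrow> 0) (at_left 0)"
    by (rule tendsto_cong[THEN iffD1, rotated, OF tendsto_const])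
      (auto simp: eventually_at_filter flat_def)
  show ?thesis
    unfolding DERIV_def using filterlim_split_at[OF left right] by simp
qed

lemma has_real_derivative_flat:
  "(flat p has_real_derivative flat (monom 1 2 * (p - pderiv p)) s) (at s)"
proof (cases s "0::real" rule: linorder_cases)
  case less
  have "((\<lambda>s. 0) has_real_derivative flat (monom 1 2 * (p - pderiv p)) s) (at s)"
    using less by (auto simp: flat_def)
  then show ?thesis
    by (rule has_field_derivative_transform_within_open[where S="{..<0}"])
      (use less in \<open>auto simp: flat_def\<close>)
next
  case equal
  then show ?thesis
    using has_real_derivative_flat_0[of p] by (simp add: flat_def)
next
  case greater
  have "((\<lambda>s. poly p (1 / s) * exp (- 1 / s)) has_real_derivative
      flat (monom 1 2 * (p - pderiv p)) s) (at s)"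
    using greater by (auto intro!: derivative_eq_intros
        simp: flat_def poly_monom field_simps power2_eq_square)
  then show ?thesis
    by (rule has_field_derivative_transform_within_open[where S="{0<..}"])
      (use greater in \<open>auto simp: flat_def\<close>)
qed

lemma smooth_fun_flat: "smooth_fun (flat p)"
  using smooth_fun_real_coinduct[of "flat p" "range flat"] has_real_derivative_flat by blast

lemma has_real_derivative_flat_1: "(flat 1 has_real_derivative flat (monom 1 2) s) (at s)"
  using has_real_derivative_flat[of 1 s] by simp

lemma flat_1_nonneg: "0 \<le> flat 1 s"
  by (simp add: flat_def)

lemma abs_flat_monom_2_le: "\<bar>flat (monom 1 2) s\<bar> \<le> 2"
proof (cases "s > 0")
  case True
  have "(1 / s)\<^sup>2 / 2 \<le> exp (1 / s)"
    using exp_lower_Taylor_quadratic[of "1 / s"] True by (smt (verit) divide_pos_pos)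
  then have "(1 / s)\<^sup>2 * exp (- 1 / s) \<le> 2 * exp (1 / s) * exp (- 1 / s)"
    by (intro mult_right_mono) auto
  also have "\<dots> = 2" by (simp add: mult.assoc exp_add[symmetric])
  finally show ?thesis using True by (simp add: flat_def poly_monom abs_mult)
qed (simp add: flat_def)

definition plateau :: "real \<Rightarrow> real" where
  "plateau s = exp 1 * flat 1 (1 - 2 * flat 1 (s - 1))"

lemma plateau_nonneg: "0 \<le> plateau s"
  by (simp add: plateau_def flat_1_nonneg)

lemma plateau_le_1: "plateau s \<le> 1"
proof (cases "1 - 2 * flat 1 (s - 1) > 0")
  case True
  then have "1 \<le> 1 / (1 - 2 * flat 1 (s - 1))"
    using flat_1_nonneg[of "s - 1"] by (simp add: le_divide_eq)
  then have "plateau s \<le> exp 1 * exp (- 1)"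
    unfolding plateau_def flat_def[of 1 "1 - _"] using True by simp
  then show ?thesis by (simp add: exp_minus)
qed (simp add: plateau_def flat_def)

lemma plateau_eq_1: "s \<le> 1 \<Longrightarrow> plateau s = 1"
  by (simp add: plateau_def flat_def exp_minus)

lemma plateau_eq_0:
  assumes "4 \<le> s"
  shows "plateau s = 0"
proof -
  have "1 / 2 \<le> 1 - 1 / (s - 1)"
    using assms by (simp add: field_simps)
  also have "\<dots> \<le> flat 1 (s - 1)"
    using assms exp_ge_add_one_self[of "- (1 / (s - 1))"] by (simp add: flat_def)
  finally show ?thesis
    by (simp add: plateau_def flat_def[of 1 "1 - _"])
qed

lemma smooth_fun_plateau: "smooth_fun plateau"
  unfolding plateau_def[abs_def]
  by (intro smooth_fun_cmult smooth_fun_diff smooth_fun_const smooth_fun_id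
      smooth_fun_compose[OF smooth_fun_flat])

lemma plateau_derivative:
  obtains d where "(plateau has_real_derivative d) (at s)" "\<bar>d\<bar> \<le> 8 * exp 1"
proof
  let ?d = "exp 1 * (flat (monom 1 2) (1 - 2 * flat 1 (s - 1)) * - (2 * flat (monom 1 2) (s - 1)))"
  have inner:
    "((\<lambda>s. 1 - 2 * flat 1 (s - 1)) has_real_derivative - (2 * flat (monom 1 2) (s - 1))) (at s)"
    by (auto intro!: derivative_eq_intros DERIV_chain2[OF has_real_derivative_flat_1])
  show "(plateau has_real_derivative ?d) (at s)"
    unfolding plateau_def[abs_def]
    by (intro DERIV_cmult DERIV_chain2[OF has_real_derivative_flat_1] inner)
  have "\<bar>?d\<bar>
      = exp 1 * (\<bar>flat (monom 1 2) (1 - 2 * flat 1 (s - 1))\<bar> * (2 * \<bar>flat (monom 1 2) (s - 1)\<bar>))"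
    by (simp add: abs_mult)
  also have "\<dots> \<le> exp 1 * (2 * (2 * 2))"
    by (intro mult_left_mono mult_mono abs_flat_monom_2_le) auto
  finally show "\<bar>?d\<bar> \<le> 8 * exp 1" by simp
qed

definition cutoff :: "real \<Rightarrow> 'a::euclidean_space \<Rightarrow> real" where
  "cutoff R x = plateau (x \<bullet> x / R\<^sup>2)"

lemma cutoff_nonneg: "0 \<le> cutoff R x" and cutoff_le_1: "cutoff R x \<le> 1"
  by (simp_all add: cutoff_def plateau_nonneg plateau_le_1)

lemma cutoff_eq_1:
  assumes "norm x \<le> R"
  shows "cutoff R x = 1"
proof -
  have "x \<bullet> x \<le> R\<^sup>2"
    using assms by (simp add: power_mono dot_square_norm)
  then show ?thesis
    unfolding cutoff_def by (intro plateau_eq_1 divide_le_eq_1[THEN iffD2]) auto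
qed

lemma cutoff_eq_0:
  assumes "R > 0" "2 * R \<le> norm x"
  shows "cutoff R x = 0"
proof -
  have "4 * R\<^sup>2 \<le> x \<bullet> x"
    using power_mono[OF assms(2), of 2] assms(1) by (simp add: dot_square_norm power_mult_distrib)
  then show ?thesis
    unfolding cutoff_def using assms(1) by (intro plateau_eq_0) (simp add: le_divide_eq)
qed

lemma test_fun_cutoff:
  assumes "R > 0"
  shows "test_fun (cutoff R)"
  unfolding test_fun_iff
proof
  have "smooth_fun (\<lambda>x. plateau (1 / R\<^sup>2 * (x \<bullet> x)))"
    by (intro smooth_fun_compose[OF smooth_fun_plateau] smooth_fun_cmult smooth_fun_inner_self)
  then show "smooth_fun (cutoff R)"
    by (simp add: cutoff_def[abs_def])
  show "bounded {x. cutoff R x \<noteq> 0}"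
    using cutoff_eq_0[OF assms] by (intro boundedI[of _ "2 * R"]) (force simp: not_le)
qed

lemma grad_cutoff_eq_0:
  fixes x :: "'a::euclidean_space"
  assumes "R > 0" "norm x < R \<or> 2 * R < norm x"
  shows "grad (cutoff R) x = 0"
  using assms(2)
proof
  assume "norm x < R"
  then show ?thesis
    by (intro grad_eq_0_on_open[of "ball 0 R"]) (auto intro: cutoff_eq_1)
next
  assume "2 * R < norm x"
  then show ?thesis
    by (intro grad_eq_0_on_open[of "- cball 0 (2 * R)"]) (auto intro: cutoff_eq_0 assms(1))
qed

lemma norm_grad_cutoff_le:
  fixes x :: "'a::euclidean_space"
  assumes "R > 0"
  shows "norm (grad (cutoff R) x) \<le> 32 * exp 1 / R"
proof (cases "2 * R < norm x")
  case True
  then show ?thesis using grad_cutoff_eq_0[OF assms, of x] assms by simp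
next
  case False
  let ?q = "\<lambda>x::'a. x \<bullet> x / R\<^sup>2"
  have D: "(?q has_derivative (\<lambda>h. ((2 / R\<^sup>2) *\<^sub>R x) \<bullet> h)) (at x)"
    using assms by (auto intro!: derivative_eq_intros simp: inner_commute power2_eq_square)
  obtain d where d: "(plateau has_real_derivative d) (at (?q x))" "\<bar>d\<bar> \<le> 8 * exp 1"
    by (rule plateau_derivative)
  have "?q differentiable (at x)"
    using D unfolding differentiable_def by blast
  then have "grad (cutoff R) x = d *\<^sub>R ((2 / R\<^sup>2) *\<^sub>R x)"
    unfolding cutoff_def[abs_def]
    by (simp add: grad_compose[where f=plateau and v="?q" and x=x, OF d(1)] grad_eqI[OF D])
  then have "norm (grad (cutoff R) x) = \<bar>d\<bar> * (2 / R\<^sup>2 * norm x)"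
    by (simp add: abs_mult)
  also have "\<dots> \<le> (8 * exp 1) * (2 / R\<^sup>2 * (2 * R))"
    using False d(2) assms by (intro mult_mono) auto
  also have "\<dots> = 32 * exp 1 / R"
    using assms by (simp add: power2_eq_square)
  finally show ?thesis .
qed

section \<open>The truncated exponential\<close>

definition softexp :: "real \<Rightarrow> real \<Rightarrow> real" where
  "softexp t s = ln (1 + exp (t * s))"

definition softexp_slope :: "real \<Rightarrow> real \<Rightarrow> real" where
  "softexp_slope t s = t * (1 - inverse (1 + exp (t * s)))"

definition softexp_energy :: "real \<Rightarrow> real \<Rightarrow> real" where
  "softexp_energy t s = t * softexp t s - softexp_slope t s"

lemma one_plus_exp_pos: "0 < 1 + exp (x::real)"
  using exp_gt_zero[of x] by linarith

lemma has_real_derivative_softexp: "(softexp t has_real_derivative softexp_slope t s) (at s)"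
  unfolding softexp_def[abs_def] softexp_slope_def using one_plus_exp_pos[of "t * s"]
  by (auto intro!: derivative_eq_intros simp: field_simps)

lemma has_real_derivative_softexp_slope:
  "(softexp_slope t has_real_derivative softexp_slope t s * (t - softexp_slope t s)) (at s)"
  unfolding softexp_slope_def[abs_def] using one_plus_exp_pos[of "t * s"]
  by (auto intro!: derivative_eq_intros simp: field_simps power2_eq_square)

lemma has_real_derivative_softexp_energy:
  "(softexp_energy t has_real_derivative (softexp_slope t s)\<^sup>2) (at s)"
proof -
  have "((\<lambda>s. t * softexp t s - softexp_slope t s) has_real_derivative
      t * softexp_slope t s - softexp_slope t s * (t - softexp_slope t s)) (at s)"
    by (intro DERIV_diff DERIV_cmult has_real_derivative_softexp has_real_derivative_softexp_slope)
  then show ?thesis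
    unfolding softexp_energy_def[abs_def] by (simp add: power2_eq_square algebra_simps)
qed

lemma smooth_fun_softexp_slope: "smooth_fun (softexp_slope t)"
proof (rule smooth_fun_real_coinduct[where S="range (\<lambda>p s. poly p (softexp_slope t s))"])
  show "softexp_slope t \<in> range (\<lambda>p s. poly p (softexp_slope t s))"
    by (rule image_eqI[of _ _ "[:0, 1:]"]) auto
  fix g :: "real \<Rightarrow> real" assume "g \<in> range (\<lambda>p s. poly p (softexp_slope t s))"
  then obtain p where p: "g = (\<lambda>s. poly p (softexp_slope t s))" by auto
  have "(g has_real_derivative poly (pderiv p * [:0, t, -1:]) (softexp_slope t s)) (at s)" for s
    unfolding p using DERIV_chain2[OF poly_DERIV has_real_derivative_softexp_slope, of p t s]
    by (simp add: algebra_simps)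
  then show "\<exists>g'\<in>range (\<lambda>p s. poly p (softexp_slope t s)). \<forall>s. (g has_real_derivative g' s) (at s)"
    by (intro bexI[of _ "\<lambda>s. poly (pderiv p * [:0, t, -1:]) (softexp_slope t s)"] allI rangeI)
qed

lemma smooth_fun_softexp: "smooth_fun (softexp t)"
  using smooth_fun_realI[OF has_real_derivative_softexp smooth_fun_softexp_slope] .

lemma smooth_fun_softexp_energy: "smooth_fun (softexp_energy t)"
  using smooth_fun_realI[OF has_real_derivative_softexp_energy
    smooth_fun_power[OF smooth_fun_softexp_slope]] .

lemma softexp_measurable [measurable]: "softexp t \<in> borel_measurable borel"
  and softexp_slope_measurable [measurable]: "softexp_slope t \<in> borel_measurable borel"
  and softexp_energy_measurable [measurable]: "softexp_energy t \<in> borel_measurable borel"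
  by (intro smooth_fun_measurable smooth_fun_softexp
      smooth_fun_softexp_slope smooth_fun_softexp_energy)+

lemma softexp_tendsto: "(s \<longlongrightarrow> a) A \<Longrightarrow> ((\<lambda>n. softexp t (s n)) \<longlongrightarrow> softexp t a) A"
  by (rule isCont_tendsto_compose[OF DERIV_isCont[OF has_real_derivative_softexp]])

lemma softexp_slope_tendsto: "(s \<longlongrightarrow> a) A \<Longrightarrow> ((\<lambda>n. softexp_slope t (s n)) \<longlongrightarrow> softexp_slope t a) A"
  by (rule isCont_tendsto_compose[OF DERIV_isCont[OF has_real_derivative_softexp_slope]])

lemma softexp_energy_tendsto: "(s \<longlongrightarrow> a) A \<Longrightarrow> ((\<lambda>n. softexp_energy t (s n)) \<longlongrightarrow> softexp_energy t a) A"
  by (rule isCont_tendsto_compose[OF DERIV_isCont[OF has_real_derivative_softexp_energy]])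

lemma softexp_pos: "0 < softexp t s"
  unfolding softexp_def using ln_gt_zero[of "1 + exp (t * s)"] by simp

lemma softexp_le_exp: "softexp t s \<le> exp (t * s)"
  unfolding softexp_def using exp_gt_zero ln_add_one_self_le_self by (simp add: less_imp_le)

lemma softexp_le_linear: "softexp t s \<le> 1 + \<bar>t * s\<bar>"
proof -
  have "1 + exp (t * s) \<le> 2 * exp \<bar>t * s\<bar>"
    using exp_le_cancel_iff[THEN iffD2, OF abs_ge_self, of "t * s"] one_le_exp_iff[of "\<bar>t * s\<bar>"]
    by linarith
  also have "\<dots> \<le> exp 1 * exp \<bar>t * s\<bar>"
    using exp_ge_add_one_self[of 1] by simp
  finally have "1 + exp (t * s) \<le> exp (1 + \<bar>t * s\<bar>)" by (simp add: exp_add)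
  then show ?thesis
    unfolding softexp_def using one_plus_exp_pos[of "t * s"]
      ln_le_cancel_iff[of "1 + exp (t * s)" "exp (1 + \<bar>t * s\<bar>)"] by simp
qed

lemma softexp_slope_bounds:
  assumes "t > 0"
  shows "0 < softexp_slope t s" "softexp_slope t s < t"
  using assms one_plus_exp_pos[of "t * s"] by (auto simp: softexp_slope_def field_simps)

lemma softexp_slope_eq: "softexp_slope t s = t * (1 - exp (- softexp t s))"
  using one_plus_exp_pos[of "t * s"] by (simp add: softexp_slope_def softexp_def exp_minus)

lemma exp_neg_le_quadratic:
  fixes x :: real
  assumes "0 \<le> x"
  shows "exp (- x) \<le> 1 - x + x\<^sup>2 / 2"
proof -
  have "(\<lambda>x. 1 - x + x\<^sup>2 / 2 - exp (- x)) 0 \<le> (\<lambda>x. 1 - x + x\<^sup>2 / 2 - exp (- x)) x"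
  proof (rule DERIV_nonneg_imp_nondecreasing[OF assms])
    fix y :: real
    have "((\<lambda>x. 1 - x + x\<^sup>2 / 2 - exp (- x)) has_real_derivative (- 1 + y + exp (- y))) (at y)"
      by (auto intro!: derivative_eq_intros)
    moreover have "- 1 + y + exp (- y) \<ge> 0"
      using exp_ge_add_one_self[of "- y"] by linarith
    ultimately show "\<exists>D. ((\<lambda>x. 1 - x + x\<^sup>2 / 2 - exp (- x)) has_real_derivative D) (at y) \<and> 0 \<le> D"
      by blast
  qed
  then show ?thesis by simp
qed

lemma softexp_energy_bounds:
  assumes "t > 0"
  shows softexp_energy_nonneg: "0 \<le> softexp_energy t s"
    and softexp_energy_le_square: "softexp_energy t s \<le> t / 2 * (softexp t s)\<^sup>2"
    and softexp_energy_le_slope: "softexp_energy t s \<le> softexp t s * softexp_slope t s"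
    and softexp_energy_le: "softexp_energy t s \<le> t * softexp t s"
proof -
  let ?y = "softexp t s"
  have energy_eq: "softexp_energy t s = t * (?y - 1 + exp (- ?y))"
    unfolding softexp_energy_def softexp_slope_eq by (simp add: algebra_simps)
  have "0 \<le> ?y - 1 + exp (- ?y)"
    using exp_ge_add_one_self[of "- ?y"] by simp
  then show "0 \<le> softexp_energy t s"
    unfolding energy_eq using assms by simp
  have "?y - 1 + exp (- ?y) \<le> ?y\<^sup>2 / 2"
    using exp_neg_le_quadratic[of ?y] softexp_pos[of t s] by simp
  from mult_left_mono[OF this less_imp_le[OF assms]]
  show "softexp_energy t s \<le> t / 2 * ?y\<^sup>2"
    unfolding energy_eq by simp
  have "(1 + ?y) * exp (- ?y) \<le> exp ?y * exp (- ?y)"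
    by (intro mult_right_mono exp_ge_add_one_self) auto
  then have "?y - 1 + exp (- ?y) \<le> ?y * (1 - exp (- ?y))"
    by (simp add: exp_minus algebra_simps)
  from mult_left_mono[OF this less_imp_le[OF assms]]
  show "softexp_energy t s \<le> ?y * softexp_slope t s"
    unfolding energy_eq softexp_slope_eq by (simp add: mult_ac)
  show "softexp_energy t s \<le> t * ?y"
    unfolding softexp_energy_def using softexp_slope_bounds(1)[OF assms, of s] by simp
qed

lemma softexp_square_minus_energy_ge:
  assumes "t > 0" "\<kappa> \<ge> 0"
  shows "(1 - \<kappa> * t / 2) * (softexp t s)\<^sup>2 \<le> (softexp t s)\<^sup>2 - \<kappa> * softexp_energy t s"
  using mult_left_mono[OF softexp_energy_le_square[OF assms(1), of s] assms(2)]
  by (simp add: algebra_simps)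

section \<open>Locally integrable functions\<close>

definition locally_integrable ::
  "('a::euclidean_space \<Rightarrow> 'b::{banach, second_countable_topology}) \<Rightarrow> bool" where
  "locally_integrable f \<longleftrightarrow> (\<forall>K. compact K \<longrightarrow> set_integrable lborel K f)"

lemma loc_integrable_iff: "loc_integrable f \<longleftrightarrow> locally_integrable f"
  by (simp add: loc_integrable_def locally_integrable_def)

lemma locally_integrableD: "locally_integrable f \<Longrightarrow> compact K \<Longrightarrow> set_integrable lborel K f"
  by (simp add: locally_integrable_def)

lemma locally_integrable_measurable:
  assumes "locally_integrable f"
  shows "f \<in> borel_measurable borel"
proof (rule borel_measurable_LIMSEQ_metric)
  show "(\<lambda>x. indicator (cball 0 (real n)) x *\<^sub>R f x) \<in> borel_measurable borel" for n
    using locally_integrableD[OF assms compact_cball, of 0 "real n"] unfolding set_integrable_def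
    by (auto dest: borel_measurable_integrable)
next
  fix x :: 'a
  have "\<forall>\<^sub>F n in sequentially. indicator (cball 0 (real n)) x *\<^sub>R f x = f x"
    using eventually_ge_at_top[of "nat \<lceil>norm x\<rceil>"]
    by eventually_elim (auto simp: nat_le_iff ceiling_le_iff)
  then show "(\<lambda>n. indicator (cball 0 (real n)) x *\<^sub>R f x) \<longlonglongrightarrow> f x"
    by (rule tendsto_eventually)
qed

lemma integrable_imp_locally_integrable: "integrable lborel f \<Longrightarrow> locally_integrable f"
  unfolding locally_integrable_def set_integrable_def
  by (auto intro!: integrable_mult_indicator simp: borel_compact)

lemma locally_integrable_const: "locally_integrable (\<lambda>x. c)"
  unfolding locally_integrable_def set_integrable_def
  by (intro allI impI integrable_scaleR_left integrable_real_indicator)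
    (use emeasure_compact_finite in \<open>auto simp: borel_compact\<close>)

lemma locally_integrable_add:
  "locally_integrable f \<Longrightarrow> locally_integrable g \<Longrightarrow> locally_integrable (\<lambda>x. f x + g x)"
  by (auto simp: locally_integrable_def intro: set_integral_add)

lemma locally_integrable_cmult: "locally_integrable f \<Longrightarrow> locally_integrable (\<lambda>x. c * f x :: real)"
  by (auto simp: locally_integrable_def)

lemma locally_integrable_bound:
  fixes f :: "'a::euclidean_space \<Rightarrow> 'b::{banach, second_countable_topology}"
    and g :: "'a \<Rightarrow> 'c::{banach, second_countable_topology}"
  assumes "locally_integrable f" "g \<in> borel_measurable borel" "\<And>x. norm (g x) \<le> norm (f x)"
  shows "locally_integrable g"
  unfolding locally_integrable_def
proof (intro allI impI)
  fix K :: "'a set" assume K: "compact K"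
  then have "K \<in> sets lborel"
    using borel_compact by simp
  then have "set_borel_measurable lborel K g"
    unfolding set_borel_measurable_def
    using assms(2) by (intro borel_measurable_scaleR borel_measurable_indicator) simp_all
  with locally_integrableD[OF assms(1) K] show "set_integrable lborel K g"
    by (rule set_integrable_bound) (simp add: assms(3))
qed

lemma locally_integrable_if_norm_square:
  fixes f :: "'a::euclidean_space \<Rightarrow> 'b::{banach, second_countable_topology}"
  assumes "f \<in> borel_measurable borel" "locally_integrable (\<lambda>x. (norm (f x))\<^sup>2)"
  shows "locally_integrable f"
proof (rule locally_integrable_bound[OF
  locally_integrable_add[OF locally_integrable_const assms(2)] assms(1)])
  fix x
  have "norm (f x) \<le> 1 + (norm (f x))\<^sup>2"
    using sum_squares_bound[of "norm (f x)" 1] norm_ge_zero[of "f x"]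
    unfolding mult_1_right power_one by linarith
  then show "norm (f x) \<le> norm (1 + (norm (f x))\<^sup>2)" by simp
qed

lemma locally_integrable_Pair:
  assumes "locally_integrable f" "locally_integrable g"
  shows "locally_integrable (\<lambda>x. (f x, g x))"
proof (rule locally_integrable_bound)
  show "locally_integrable (\<lambda>x. norm (f x) + norm (g x))"
    by (intro locally_integrable_add locally_integrable_bound[OF assms(1)]
        locally_integrable_bound[OF assms(2)])
      (use assms[THEN locally_integrable_measurable] in auto)
  show "(\<lambda>x. (f x, g x)) \<in> borel_measurable borel"
    using assms[THEN locally_integrable_measurable] by (rule borel_measurable_Pair)
  show "norm (f x, g x) \<le> norm (norm (f x) + norm (g x))" for x
    by (rule order_trans[OF norm_Pair_le]) simp
qed

lemma integrable_bounded_support: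
  assumes "locally_integrable f" "bounded {x. f x \<noteq> 0}"
  shows "integrable lborel f"
proof -
  have "set_integrable lborel (closure {x. f x \<noteq> 0}) f"
    using assms by (intro locally_integrableD) auto
  moreover have "(\<lambda>x. indicator (closure {x. f x \<noteq> 0}) x *\<^sub>R f x) = f"
    using closure_subset[of "{x. f x \<noteq> 0}"] by (auto simp: indicator_def fun_eq_iff)
  ultimately show ?thesis
    by (simp add: set_integrable_def)
qed

lemma locally_integrable_scaleR:
  assumes "k \<in> borel_measurable borel" "bounded (range k)" "locally_integrable f"
  shows "locally_integrable (\<lambda>x. k x *\<^sub>R f x)"
proof -
  obtain B where B: "\<And>x. norm (k x) \<le> B"
    using assms(2) unfolding bounded_iff by auto
  note f = locally_integrable_measurable[OF assms(3)]
  show ?thesis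
  proof (rule locally_integrable_bound)
    show "locally_integrable (\<lambda>x. B * norm (f x))"
      using f by (intro locally_integrable_cmult locally_integrable_bound[OF assms(3)]) auto
    show "(\<lambda>x. k x *\<^sub>R f x) \<in> borel_measurable borel"
      using assms(1) f by (rule borel_measurable_scaleR)
    show "norm (k x *\<^sub>R f x) \<le> norm (B * norm (f x))" for x
      using mult_right_mono[OF order_trans[OF B[of x] abs_ge_self], of "norm (f x)"]
      by (simp add: abs_mult)
  qed
qed

lemma integrable_continuous_scaleR:
  assumes "continuous_on UNIV k" "bounded {x. k x \<noteq> 0}" "locally_integrable f"
  shows "integrable lborel (\<lambda>x. k x *\<^sub>R f x)"
proof (rule integrable_bounded_support)
  show "locally_integrable (\<lambda>x. k x *\<^sub>R f x)"
    by (intro locally_integrable_scaleR continuous_bounded_support_imp_bounded_range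
        borel_measurable_continuous_onI assms)
  show "bounded {x. k x *\<^sub>R f x \<noteq> 0}"
    by (rule bounded_subset[OF assms(2)]) auto
qed

lemma integrable_inner_continuous:
  fixes f k :: "'a::euclidean_space \<Rightarrow> 'b::euclidean_space"
  assumes "continuous_on UNIV k" "bounded {x. k x \<noteq> 0}" "locally_integrable f"
  shows "integrable lborel (\<lambda>x. f x \<bullet> k x)"
proof (rule Bochner_Integration.integrable_bound)
  show "integrable lborel (\<lambda>x. norm (k x) *\<^sub>R f x)"
    using assms by (intro integrable_continuous_scaleR continuous_on_norm) simp_all
  show "(\<lambda>x. f x \<bullet> k x) \<in> borel_measurable lborel"
    using locally_integrable_measurable[OF assms(3)] borel_measurable_continuous_onI[OF assms(1)]
    by simp
  show "AE x in lborel. norm (f x \<bullet> k x) \<le> norm (norm (k x) *\<^sub>R f x)"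
    by (intro AE_I2) (simp add: Cauchy_Schwarz_ineq2 mult.commute[of "norm (k _)"])
qed

lemma integrable_test_fun_scaleR:
  "test_fun \<phi> \<Longrightarrow> locally_integrable f \<Longrightarrow> integrable lborel (\<lambda>x. \<phi> x *\<^sub>R f x)"
  by (intro integrable_continuous_scaleR smooth_fun_continuous test_funD)

lemma integrable_test_fun: "test_fun \<phi> \<Longrightarrow> integrable lborel \<phi>"
  using integrable_test_fun_scaleR[OF _ locally_integrable_const[of "1::real"]] by simp

section \<open>Continuity of translations in \<open>L\<^sup>1\<close>\<close>

lemma measure_preserving_integral:
  fixes f :: "'a::euclidean_space \<Rightarrow> 'b::{banach, second_countable_topology}"
  assumes "distr lborel borel T = lborel" "T \<in> borel_measurable borel" "integrable lborel f"
  shows "integrable lborel (\<lambda>x. f (T x))" "(\<integral>x. f (T x) \<partial>lborel) = (\<integral>x. f x \<partial>lborel)"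
proof -
  have T: "T \<in> measurable lborel borel"
    using assms(2) by simp
  have f: "f \<in> borel_measurable borel"
    using borel_measurable_integrable[OF assms(3)] by simp
  show "integrable lborel (\<lambda>x. f (T x))"
    using integrable_distr_eq[OF T f] assms(3) unfolding assms(1) by (rule iffD1)
  show "(\<integral>x. f (T x) \<partial>lborel) = (\<integral>x. f x \<partial>lborel)"
    using integral_distr[OF T f] unfolding assms(1) by (rule sym)
qed

lemma lborel_integral_translate:
  fixes f :: "'a::euclidean_space \<Rightarrow> 'b::{banach, second_countable_topology}"
  assumes "integrable lborel f"
  shows "integrable lborel (\<lambda>x. f (x - c))" "(\<integral>x. f (x - c) \<partial>lborel) = (\<integral>x. f x \<partial>lborel)"
  using measure_preserving_integral[OF lborel_distr_plus[of "- c"] _ assms] by simp_all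

lemma lborel_integral_reflect:
  fixes f :: "'a::euclidean_space \<Rightarrow> 'b::{banach, second_countable_topology}"
  assumes "integrable lborel f"
  shows "integrable lborel (\<lambda>x. f (c - x))" "(\<integral>x. f (c - x) \<partial>lborel) = (\<integral>x. f x \<partial>lborel)"
proof -
  have "distr lborel borel ((-) c) = lborel"
    by (subst (2) lborel_affine[of "-1" c]) (auto simp: density_1)
  from measure_preserving_integral[OF this _ assms]
  show "integrable lborel (\<lambda>x. f (c - x))" "(\<integral>x. f (c - x) \<partial>lborel) = (\<integral>x. f x \<partial>lborel)"
    by simp_all
qed

definition L1_modulus ::
  "('a::euclidean_space \<Rightarrow> 'b::{banach, second_countable_topology}) \<Rightarrow> 'a \<Rightarrow> real" where
  "L1_modulus V z = (\<integral>x. norm (V (x - z) - V x) \<partial>lborel)"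

lemma L1_modulus_0 [simp]: "L1_modulus V 0 = 0"
  by (simp add: L1_modulus_def)

lemma L1_modulus_nonneg: "0 \<le> L1_modulus V z"
  by (simp add: L1_modulus_def)

lemma integrable_L1_modulus:
  fixes V :: "'a::euclidean_space \<Rightarrow> 'b::{banach, second_countable_topology}"
  shows "integrable lborel V \<Longrightarrow> integrable lborel (\<lambda>x. norm (V (x - z) - V x))"
  by (intro integrable_norm Bochner_Integration.integrable_diff lborel_integral_translate(1))

lemma L1_modulus_add_le:
  assumes "integrable lborel V" "integrable lborel W"
  shows "L1_modulus (\<lambda>x. V x + W x) z \<le> L1_modulus V z + L1_modulus W z"
proof -
  have "L1_modulus (\<lambda>x. V x + W x) z
      \<le> (\<integral>x. norm (V (x - z) - V x) + norm (W (x - z) - W x) \<partial>lborel)"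
    unfolding L1_modulus_def
    using assms assms[THEN integrable_L1_modulus] integrable_L1_modulus[of "\<lambda>x. V x + W x" z]
    by (intro integral_mono) (simp_all add: norm_diff_triangle_ineq)
  also have "\<dots> = L1_modulus V z + L1_modulus W z"
    unfolding L1_modulus_def using assms[THEN integrable_L1_modulus] by simp
  finally show ?thesis .
qed

lemma L1_modulus_le_norm:
  assumes "integrable lborel V"
  shows "L1_modulus V z \<le> 2 * (\<integral>x. norm (V x) \<partial>lborel)"
proof -
  note shifted = lborel_integral_translate[OF integrable_norm[OF assms], of z]
  have "L1_modulus V z \<le> (\<integral>x. norm (V (x - z)) + norm (V x) \<partial>lborel)"
    unfolding L1_modulus_def using assms shifted(1)
    by (intro integral_mono integrable_L1_modulus) (simp_all add: norm_triangle_ineq4)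
  also have "\<dots> = 2 * (\<integral>x. norm (V x) \<partial>lborel)"
    using assms shifted by simp
  finally show ?thesis .
qed

lemma isCont_L1_modulus_approx:
  assumes V: "integrable lborel V"
    and approx: "\<And>e. e > 0 \<Longrightarrow> \<exists>W. integrable lborel W
      \<and> isCont (L1_modulus W) 0 \<and> (\<integral>x. norm (V x - W x) \<partial>lborel) < e"
  shows "isCont (L1_modulus V) 0"
  unfolding continuous_at_eps_delta
proof (intro allI impI)
  fix e :: real assume "e > 0"
  then obtain W where W: "integrable lborel W" "isCont (L1_modulus W) 0"
    "(\<integral>x. norm (V x - W x) \<partial>lborel) < e / 4" using approx[of "e / 4"] by auto
  obtain d where d: "d > 0" "\<And>z. dist z 0 < d \<Longrightarrow> L1_modulus W z < e / 2"
    using W(2)[unfolded continuous_at_eps_delta, rule_format, of "e / 2"]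
      \<open>e > 0\<close> L1_modulus_nonneg[of W]
    by (auto simp: dist_real_def)
  have "L1_modulus V z < e" if "dist z 0 < d" for z
    using L1_modulus_add_le[of "\<lambda>x. V x - W x" W z] L1_modulus_le_norm[of "\<lambda>x. V x - W x" z]
      V W(1,3) d(2)[OF that] by simp
  then show "\<exists>d>0. \<forall>z. dist z 0 < d \<longrightarrow> dist (L1_modulus V z) (L1_modulus V 0) < e"
    using d(1) L1_modulus_nonneg[of V] by (auto simp: dist_real_def)
qed

lemma L1_modulus_indicator:
  assumes "A \<in> sets borel" "emeasure lborel A < \<infinity>"
  shows "L1_modulus (indicator A :: _ \<Rightarrow> real) z
    = 2 * (\<integral>x. indicator A x * (1 - indicator A (x - z)) \<partial>lborel)"
proof -
  let ?f = "indicator A :: 'a \<Rightarrow> real"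
  have f: "integrable lborel ?f"
    using assms by simp
  note shifted = lborel_integral_translate[OF f, of z]
  have prod: "integrable lborel (\<lambda>x. ?f x * (1 - ?f (x - z)))"
    using assms(1) by (intro Bochner_Integration.integrable_bound[OF f]) (auto simp: indicator_def)
  have "L1_modulus ?f z = (\<integral>x. (?f (x - z) - ?f x) + 2 * (?f x * (1 - ?f (x - z))) \<partial>lborel)"
    unfolding L1_modulus_def by (rule Bochner_Integration.integral_cong) (auto simp: indicator_def)
  also have "\<dots> = (\<integral>x. ?f (x - z) - ?f x \<partial>lborel) + (\<integral>x. 2 * (?f x * (1 - ?f (x - z))) \<partial>lborel)"
    by (intro Bochner_Integration.integral_add
        Bochner_Integration.integrable_diff integrable_mult_right shifted f prod)
  also have "(\<integral>x. ?f (x - z) - ?f x \<partial>lborel) = 0"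
    using Bochner_Integration.integral_diff[OF shifted(1) f] shifted(2) by simp
  finally show ?thesis by simp
qed

lemma isCont_L1_modulus_indicator_open:
  fixes U :: "'a::euclidean_space set"
  assumes "open U" "emeasure lborel U < \<infinity>"
  shows "isCont (L1_modulus (indicator U :: 'a \<Rightarrow> real)) 0"
  unfolding continuous_at_sequentially
proof (intro allI impI)
  fix z :: "nat \<Rightarrow> 'a" assume z: "z \<longlonglongrightarrow> 0"
  let ?u = "indicator U :: 'a \<Rightarrow> real"
  have U [measurable]: "U \<in> sets borel" using assms(1) by simp
  have "(\<lambda>n. \<integral>x. ?u x * (1 - ?u (x - z n)) \<partial>lborel) \<longlonglongrightarrow> (\<integral>x. 0 \<partial>(lborel :: 'a measure))"
  proof (rule integral_dominated_convergence[where w="?u"])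
    show "integrable lborel ?u" using assms by simp
    show "AE x in lborel. (\<lambda>n. ?u x * (1 - ?u (x - z n))) \<longlonglongrightarrow> 0"
    proof (rule AE_I2)
      fix x
      show "(\<lambda>n. ?u x * (1 - ?u (x - z n))) \<longlonglongrightarrow> 0"
      proof (cases "x \<in> U")
        case True
        have "(\<lambda>n. x - z n) \<longlonglongrightarrow> x"
          using tendsto_diff[OF tendsto_const z, of x] by simp
        then have "\<forall>\<^sub>F n in sequentially. x - z n \<in> U"
          using assms(1) True by (rule topological_tendstoD)
        then show ?thesis
          by (rule tendsto_eventually[OF eventually_mono]) simp
      qed simp
    qed
  qed (auto simp: indicator_def)
  then have "(\<lambda>n. 2 * (\<integral>x. ?u x * (1 - ?u (x - z n)) \<partial>lborel)) \<longlonglongrightarrow> 0"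
    by (intro tendsto_mult_right_zero) simp
  then show "(L1_modulus ?u \<circ> z) \<longlonglongrightarrow> L1_modulus ?u 0"
    unfolding o_def L1_modulus_0 unfolding L1_modulus_indicator[OF U assms(2)] .
qed

lemma isCont_L1_modulus_indicator:
  fixes A :: "'a::euclidean_space set"
  assumes A: "A \<in> sets borel" "emeasure lborel A < \<infinity>"
  shows "isCont (L1_modulus (indicator A :: 'a \<Rightarrow> real)) 0"
proof (rule isCont_L1_modulus_approx)
  show "integrable lborel (indicator A :: 'a \<Rightarrow> real)" using A by simp
  fix e :: real assume e: "e > 0"
  obtain U where U: "open U" "A \<subseteq> U" "emeasure lborel (U - A) < ennreal e"
    using outer_regular_lborel[OF A(1) e] by blast
  have diff_borel: "U - A \<in> sets borel" using A U by auto
  have "emeasure lborel U \<le> emeasure lborel A + emeasure lborel (U - A)"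
    using emeasure_subadditive[of A lborel "U - A"] A diff_borel U(2) by (simp add: Un_absorb1)
  also have "\<dots> < \<infinity>"
    using A(2) U(3) by (auto simp: less_top[symmetric] ennreal_add_eq_top)
  finally have U_finite: "emeasure lborel U < \<infinity>" .
  have "(\<integral>x. norm (indicator A x - indicator U x :: real) \<partial>lborel)
      = (\<integral>x. indicator (U - A) x \<partial>lborel)"
    using U(2) by (intro Bochner_Integration.integral_cong) (auto simp: indicator_def)
  also have "\<dots> = measure lborel (U - A)" using diff_borel by simp
  also have "\<dots> < e"
    unfolding measure_def using U(3) order_less_le_trans[OF U(3) top_greatest] by simp
  finally show "\<exists>W. integrable lborel W \<and> isCont (L1_modulus W) 0
      \<and> (\<integral>x. norm (indicator A x - W x :: real) \<partial>lborel) < e"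
    using isCont_L1_modulus_indicator_open[OF U(1) U_finite] U(1) U_finite
    by (intro exI[of _ "indicator U"]) auto
qed

lemma integral_norm_diff_tendsto_0:
  fixes f :: "'a \<Rightarrow> 'b::{banach, second_countable_topology}"
  assumes "integrable M f" "\<And>i. s i \<in> borel_measurable M"
    and lim: "\<And>x. x \<in> space M \<Longrightarrow> (\<lambda>i. s i x) \<longlonglongrightarrow> f x"
    and norm_le: "\<And>i x. x \<in> space M \<Longrightarrow> norm (s i x) \<le> c * norm (f x)"
  shows "(\<lambda>i. \<integral>x. norm (f x - s i x) \<partial>M) \<longlonglongrightarrow> 0"
proof -
  have "(\<lambda>i. \<integral>x. norm (f x - s i x) \<partial>M) \<longlonglongrightarrow> (\<integral>x. 0 \<partial>M)"
  proof (rule integral_dominated_convergence[where w="\<lambda>x. (1 + c) * norm (f x)"])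
    have "(\<lambda>i. norm (f x - s i x)) \<longlonglongrightarrow> 0" if "x \<in> space M" for x
      using tendsto_norm[OF tendsto_diff[OF tendsto_const[of "f x"] lim[OF that]]] by simp
    then show "AE x in M. (\<lambda>i. norm (f x - s i x)) \<longlonglongrightarrow> 0"
      by (intro AE_I2)
    have "norm (f x - s i x) \<le> (1 + c) * norm (f x)" if "x \<in> space M" for i x
      using norm_le[OF that, of i] norm_triangle_ineq4[of "f x" "s i x"]
      by (simp add: distrib_right)
    then show "AE x in M. norm (norm (f x - s i x)) \<le> (1 + c) * norm (f x)" for i
      by (intro AE_I2) simp
  qed (use assms(1,2) in \<open>auto dest: borel_measurable_integrable\<close>)
  then show ?thesis by simp
qed

lemma isCont_L1_modulus:
  fixes V :: "'a::euclidean_space \<Rightarrow> 'b::{banach, second_countable_topology}"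
  assumes "integrable lborel V"
  shows "isCont (L1_modulus V) 0"
  using assms
proof (induction rule: integrable_induct)
  case (base A c)
  have "norm (indicator A (x - z) *\<^sub>R c - indicator A x *\<^sub>R c)
      = norm (indicator A (x - z) - indicator A x :: real) * norm c" for x z :: 'a
    by (metis norm_scaleR real_norm_def scaleR_left_diff_distrib)
  then have "L1_modulus (\<lambda>x. indicator A x *\<^sub>R c)
      = (\<lambda>z. L1_modulus (indicator A :: 'a \<Rightarrow> real) z * norm c)"
    by (simp add: L1_modulus_def fun_eq_iff)
  then show ?case
    using isCont_L1_modulus_indicator[of A] base by simp
next
  case (add f g)
  have "(L1_modulus (\<lambda>x. f x + g x) \<longlongrightarrow> 0) (at 0)"
  proof (rule tendsto_sandwich[OF _ _ tendsto_const])
    show "((\<lambda>z. L1_modulus f z + L1_modulus g z) \<longlongrightarrow> 0) (at 0)"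
      using add(3,4) by (auto simp: isCont_def intro: tendsto_add_zero)
  qed (intro always_eventually allI L1_modulus_nonneg L1_modulus_add_le add(1,2))+
  then show ?case
    by (simp add: isCont_def)
next
  case (lim f s)
  show ?case
  proof (rule isCont_L1_modulus_approx[OF lim(4)])
    fix e :: real assume "e > 0"
    have "(\<lambda>i. \<integral>x. norm (f x - s i x) \<partial>lborel) \<longlonglongrightarrow> 0"
      using lim
      by (intro integral_norm_diff_tendsto_0[where c=2]) (auto dest: borel_measurable_integrable)
    then have "\<forall>\<^sub>F i in sequentially. (\<integral>x. norm (f x - s i x) \<partial>lborel) < e"
      using \<open>e > 0\<close> order_tendstoD(2) by fastforce
    then obtain i where "(\<integral>x. norm (f x - s i x) \<partial>lborel) < e"
      using eventually_happens'[OF sequentially_bot] by blast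
    then show "\<exists>W. integrable lborel W \<and> isCont (L1_modulus W) 0
        \<and> (\<integral>x. norm (f x - W x) \<partial>lborel) < e"
      using lim by blast
  qed
qed

section \<open>Convolution and mollification\<close>

definition conv ::
  "('a::euclidean_space \<Rightarrow> real) \<Rightarrow> ('a \<Rightarrow> 'b::{banach, second_countable_topology}) \<Rightarrow> 'a \<Rightarrow> 'b" where
  "conv \<rho> U x = (\<integral>y. \<rho> (x - y) *\<^sub>R U y \<partial>lborel)"

lemma integrable_conv:
  assumes "continuous_on UNIV k" "bounded {x. k x \<noteq> 0}" "locally_integrable U"
  shows "integrable lborel (\<lambda>y. k (x - y) *\<^sub>R U y)"
proof (intro integrable_continuous_scaleR bounded_support_reflect assms(2,3))
  show "continuous_on UNIV (\<lambda>y. k (x - y))"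
    by (rule continuous_on_compose2[OF assms(1)]) (auto intro!: continuous_intros)
qed

lemma integrable_conv_test_fun:
  "test_fun \<rho> \<Longrightarrow> locally_integrable U \<Longrightarrow> integrable lborel (\<lambda>y. \<rho> (x - y) *\<^sub>R U y)"
  by (intro integrable_conv smooth_fun_continuous test_funD)

lemma conv_diff_kernel:
  assumes "continuous_on UNIV k" "bounded {x. k x \<noteq> 0}"
    "continuous_on UNIV l" "bounded {x. l x \<noteq> 0}"
    and "locally_integrable U"
  shows "conv (\<lambda>w. k w - l w) U x = conv k U x - conv l U x"
  unfolding conv_def scaleR_diff_left
  by (intro Bochner_Integration.integral_diff integrable_conv assms)

lemma norm_conv_le:
  assumes k: "continuous_on UNIV k" "\<And>w. r < norm w \<Longrightarrow> k w = 0" "\<And>w. \<bar>k w\<bar> \<le> M"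
    and U: "locally_integrable U"
  shows "norm (conv k U x) \<le> M * (\<integral>y. norm (indicator (cball x r) y *\<^sub>R U y) \<partial>lborel)"
  unfolding conv_def integral_mult_right_zero[symmetric]
proof (rule Bochner_Integration.integral_norm_bound_integral)
  have "bounded {w. k w \<noteq> 0}"
    using k(2) by (intro boundedI[of _ r]) (force simp: not_less)
  then show "integrable lborel (\<lambda>y. k (x - y) *\<^sub>R U y)"
    using k(1) U by (intro integrable_conv)
  show "integrable lborel (\<lambda>y. M * norm (indicator (cball x r) y *\<^sub>R U y))"
    using locally_integrableD[OF U compact_cball] unfolding set_integrable_def
    by (intro integrable_mult_right integrable_norm)
  show "norm (k (x - y) *\<^sub>R U y) \<le> M * norm (indicator (cball x r) y *\<^sub>R U y)" for y
    using k(2)[of "x - y"] mult_right_mono[OF k(3)[of "x - y"], of "norm (U y)"]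
    by (auto simp: indicator_def dist_norm)
qed

lemma bounded_linear_conv_grad:
  assumes "test_fun \<rho>" "locally_integrable U"
  shows "bounded_linear (\<lambda>h. conv (\<lambda>w. grad \<rho> w \<bullet> h) U x)"
proof -
  have "integrable lborel (\<lambda>y. (grad \<rho> (x - y) \<bullet> h) *\<^sub>R U y)" for h
  proof (rule integrable_conv[OF _ _ assms(2), of "\<lambda>w. grad \<rho> w \<bullet> h"])
    show "continuous_on UNIV (\<lambda>w. grad \<rho> w \<bullet> h)"
      using continuous_on_grad[OF test_funD(1)[OF assms(1)]] by (intro continuous_intros)
    show "bounded {w. grad \<rho> w \<bullet> h \<noteq> 0}"
      by (rule bounded_subset[OF bounded_support_grad[OF assms(1)]]) auto
  qed
  then show ?thesis
    unfolding linear_conv_bounded_linear[symmetric] conv_def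
    by (intro linearI)
        (simp_all add: inner_add_right scaleR_add_left scaleR_scaleR[symmetric] del: scaleR_scaleR)
qed

lemma norm_conv_remainder_le:
  assumes \<rho>: "test_fun \<rho>" and U: "locally_integrable U"
    and r: "\<And>w. r < norm w \<Longrightarrow> \<rho> w = 0 \<and> grad \<rho> w = 0" and h: "norm h \<le> 1"
    and M: "\<And>w. \<bar>\<rho> (w + h) - \<rho> w - grad \<rho> w \<bullet> h\<bar> \<le> M"
  shows "norm (conv \<rho> U (x + h) - conv \<rho> U x - conv (\<lambda>w. grad \<rho> w \<bullet> h) U x)
    \<le> M * (\<integral>y. norm (indicator (cball x (r + 1)) y *\<^sub>R U y) \<partial>lborel)"
proof -
  have cont: "continuous_on UNIV \<rho>" "continuous_on UNIV (\<lambda>w. grad \<rho> w \<bullet> h)"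
    using smooth_fun_continuous continuous_on_grad test_funD(1)[OF \<rho>]
    by (auto intro!: continuous_intros)
  have translated: "continuous_on UNIV (\<lambda>w. \<rho> (w + h))"
    by (rule continuous_on_compose2[OF cont(1)]) (auto intro!: continuous_intros)
  have vanish: "\<rho> (w + h) = 0" "\<rho> w = 0" "grad \<rho> w \<bullet> h = 0" if "r + 1 < norm w" for w
    using that h r[of w] r[of "w + h"] norm_triangle_ineq2[of w "- h"] by auto
  then have supports: "bounded {w. \<rho> (w + h) \<noteq> 0}"
    "bounded {w. \<rho> w \<noteq> 0}" "bounded {w. grad \<rho> w \<bullet> h \<noteq> 0}"
    "bounded {w. \<rho> (w + h) - \<rho> w \<noteq> 0}"
    by (intro boundedI[of _ "r + 1"]; force simp: not_less[symmetric])+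
  have "conv \<rho> U (x + h) = conv (\<lambda>w. \<rho> (w + h)) U x"
    by (simp add: conv_def algebra_simps)
  then have "conv \<rho> U (x + h) - conv \<rho> U x - conv (\<lambda>w. grad \<rho> w \<bullet> h) U x
      = conv (\<lambda>w. \<rho> (w + h) - \<rho> w - grad \<rho> w \<bullet> h) U x"
    using translated cont supports U by (simp add: conv_diff_kernel continuous_on_diff)
  moreover have "norm (conv (\<lambda>w. \<rho> (w + h) - \<rho> w - grad \<rho> w \<bullet> h) U x)
      \<le> M * (\<integral>y. norm (indicator (cball x (r + 1)) y *\<^sub>R U y) \<partial>lborel)"
    using translated cont by (intro norm_conv_le M U continuous_on_diff) (simp_all add: vanish)
  ultimately show ?thesis by simp
qed

lemma has_derivative_conv:
  assumes \<rho>: "test_fun \<rho>" and U: "locally_integrable U"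
  shows "(conv \<rho> U has_derivative (\<lambda>h. conv (\<lambda>w. grad \<rho> w \<bullet> h) U x)) (at x)"
  unfolding has_derivative_at_alt
proof (intro conjI allI impI bounded_linear_conv_grad \<rho> U)
  fix e :: real assume "e > 0"
  obtain r where "\<And>w. w \<notin> cball 0 r \<Longrightarrow> \<rho> w = 0 \<and> grad \<rho> w = 0"
    using test_fun_bounds[OF \<rho>] by metis
  then have r: "\<rho> w = 0 \<and> grad \<rho> w = 0" if "r < norm w" for w
    using that by simp
  define I where "I = (\<integral>y. norm (indicator (cball x (r + 1)) y *\<^sub>R U y) \<partial>lborel)"
  have "I \<ge> 0" by (simp add: I_def)
  then obtain d where d: "d > 0"
    "\<And>w h. norm h < d \<Longrightarrow> \<bar>\<rho> (w + h) - \<rho> w - grad \<rho> w \<bullet> h\<bar> \<le> norm h * (e / (I + 1))"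
    using test_fun_uniform_linearization[OF \<rho>, of "e / (I + 1)"] \<open>e > 0\<close> by auto
  have "norm (conv \<rho> U z - conv \<rho> U x - conv (\<lambda>w. grad \<rho> w \<bullet> (z - x)) U x) \<le> e * norm (z - x)"
    if z: "norm (z - x) < min d 1" for z
  proof -
    have "norm (conv \<rho> U (x + (z - x)) - conv \<rho> U x - conv (\<lambda>w. grad \<rho> w \<bullet> (z - x)) U x)
        \<le> norm (z - x) * (e / (I + 1)) * I"
      unfolding I_def
      by (rule norm_conv_remainder_le[OF \<rho> U r _ d(2)[unfolded I_def]]) (use z in auto)
    also have "\<dots> = norm (z - x) * (e * (I / (I + 1)))"
      by simp
    also have "\<dots> \<le> norm (z - x) * (e * 1)"
      using \<open>e > 0\<close> \<open>I \<ge> 0\<close> by (intro mult_left_mono) auto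
    finally show ?thesis by (simp add: mult.commute)
  qed
  then show "\<exists>d>0. \<forall>z. norm (z - x) < d \<longrightarrow>
      norm (conv \<rho> U z - conv \<rho> U x - conv (\<lambda>w. grad \<rho> w \<bullet> (z - x)) U x) \<le> e * norm (z - x)"
    using d(1) by (intro exI[of _ "min d 1"]) simp
qed

lemma pder_conv:
  assumes "test_fun \<rho>" "locally_integrable u" "b \<in> Basis"
  shows "pder (conv \<rho> u) [b] = conv (pder \<rho> [b]) u"
  unfolding pder_singleton_eqI[OF has_derivative_conv[OF assms(1,2)]]
    grad_inner_Basis[OF assms(3)] ..

lemma smooth_fun_conv:
  assumes "test_fun \<rho>" "locally_integrable u"
  shows "smooth_fun (conv \<rho> u)"
proof (rule smooth_fun_coinduct[where S="{conv \<rho> u | \<rho>. test_fun \<rho>}"])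
  show "conv \<rho> u \<in> {conv \<rho> u | \<rho>. test_fun \<rho>}" using assms(1) by blast
  fix g assume "g \<in> {conv \<rho> u | \<rho>. test_fun \<rho>}"
  then obtain \<rho> where \<rho>: "test_fun \<rho>" "g = conv \<rho> u" by blast
  show "g differentiable (at x)" for x
    using has_derivative_conv[OF \<rho>(1) assms(2)] unfolding \<rho>(2) differentiable_def by blast
  show "pder g [b] \<in> {conv \<rho> u | \<rho>. test_fun \<rho>}" if "b \<in> Basis" for b
    using pder_conv[OF \<rho>(1) assms(2) that] test_fun_pder[OF \<rho>(1) that] \<rho>(2) by blast
qed

lemma grad_conv:
  assumes \<rho>: "test_fun \<rho>" and u: "locally_integrable u" and g: "locally_integrable g"
    and weak: "weak_grad u g"
  shows "grad (conv \<rho> u) x = conv \<rho> g x"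
proof (rule euclidean_eqI)
  fix b :: 'a assume b: "b \<in> Basis"
  have reflected: "grad (\<lambda>y. \<rho> (x - y)) y = - grad \<rho> (x - y)" for y
    by (rule grad_reflect[OF smooth_fun_differentiable[OF test_funD(1)[OF \<rho>]]])
  have "grad (conv \<rho> u) x \<bullet> b = conv (pder \<rho> [b]) u x"
    unfolding grad_inner_Basis[OF b] pder_conv[OF \<rho> u b] ..
  also have "\<dots> = - (\<integral>y. u y * (grad (\<lambda>y. \<rho> (x - y)) y \<bullet> b) \<partial>lborel)"
    unfolding reflected conv_def by (simp del: pder.simps add: grad_inner_Basis[OF b] mult.commute)
  also have "\<dots> = (\<integral>y. (g y \<bullet> b) * \<rho> (x - y) \<partial>lborel)"
    using weak test_fun_reflect[OF \<rho>, of x] b unfolding weak_grad_def by simp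
  also have "\<dots> = conv \<rho> g x \<bullet> b"
    unfolding conv_def integral_inner_left[OF integrable_conv_test_fun[OF \<rho> g], symmetric]
    by (simp add: mult.commute)
  finally show "grad (conv \<rho> u) x \<bullet> b = conv \<rho> g x \<bullet> b" .
qed

lemma conv_bounded_linear:
  assumes "bounded_linear T" "test_fun \<rho>" "locally_integrable U"
  shows "conv \<rho> (\<lambda>x. T (U x)) x = T (conv \<rho> U x)"
  unfolding conv_def
    integral_bounded_linear[OF assms(1) integrable_conv_test_fun[OF assms(2,3)], symmetric]
  by (simp add: linear_cmul[OF bounded_linear.linear[OF assms(1)]])

lemma conv_Pair:
  assumes "test_fun \<rho>" "locally_integrable U" "locally_integrable V"
  shows "conv \<rho> (\<lambda>x. (U x, V x)) x = (conv \<rho> U x, conv \<rho> V x)"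
  using
    conv_bounded_linear[OF bounded_linear_fst assms(1) locally_integrable_Pair[OF assms(2,3)], of x]
    conv_bounded_linear[OF bounded_linear_snd assms(1) locally_integrable_Pair[OF assms(2,3)], of x]
  by (simp add: prod_eq_iff)

lemma conv_measurable:
  assumes "test_fun \<rho>" "locally_integrable U"
  shows "conv \<rho> U \<in> borel_measurable borel"
proof -
  note [measurable] = smooth_fun_measurable[OF test_funD(1)[OF assms(1)]]
    locally_integrable_measurable[OF assms(2)]
  show ?thesis
    unfolding conv_def[abs_def] by (rule lborel.borel_measurable_lebesgue_integral) measurable
qed

definition mollifier :: "real \<Rightarrow> ('a::euclidean_space \<Rightarrow> real) \<Rightarrow> bool" where
  "mollifier \<epsilon> \<rho> \<longleftrightarrow> test_fun \<rho> \<and> (\<forall>x. 0 \<le> \<rho> x) \<and> (\<forall>x. \<epsilon> \<le> norm x \<longrightarrow> \<rho> x = 0)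
     \<and> (\<integral>x. \<rho> x \<partial>lborel) = 1"

lemma mollifierD:
  assumes "mollifier \<epsilon> \<rho>"
  shows "test_fun \<rho>" "0 \<le> \<rho> x" "\<epsilon> \<le> norm x \<Longrightarrow> \<rho> x = 0" "(\<integral>x. \<rho> x \<partial>lborel) = 1"
  using assms by (auto simp: mollifier_def)

lemma exists_mollifier:
  assumes "\<epsilon> > 0"
  shows "\<exists>\<rho> :: 'a::euclidean_space \<Rightarrow> real. mollifier \<epsilon> \<rho>"
proof -
  let ?c = "cutoff (\<epsilon> / 2) :: 'a \<Rightarrow> real"
  define I where "I = (\<integral>x. ?c x \<partial>lborel)"
  have c: "test_fun ?c" using assms by (intro test_fun_cutoff) simp
  have "0 < measure lborel (cball (0::'a) (\<epsilon> / 2))"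
    using assms by simp
  also have "\<dots> = (\<integral>x. indicator (cball (0::'a) (\<epsilon> / 2)) x \<partial>lborel)"
    by simp
  also have "\<dots> \<le> I"
    unfolding I_def
  proof (rule integral_mono)
    show "integrable lborel (indicator (cball (0::'a) (\<epsilon> / 2)) :: 'a \<Rightarrow> real)"
      using emeasure_lborel_cball_finite by (intro integrable_real_indicator) auto
    show "indicator (cball 0 (\<epsilon> / 2)) x \<le> ?c x" for x
      using cutoff_nonneg[of "\<epsilon> / 2" x] cutoff_eq_1[of x "\<epsilon> / 2"] by (simp add: indicator_def)
  qed (rule integrable_test_fun[OF c])
  finally have "I > 0" .
  have "mollifier \<epsilon> (\<lambda>x. inverse I * ?c x)"
    unfolding mollifier_def
    using \<open>I > 0\<close> assms cutoff_eq_0[of "\<epsilon> / 2"] test_fun_cmult[OF c]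
    by (auto simp: I_def[symmetric] intro!: mult_nonneg_nonneg cutoff_nonneg)
  then show ?thesis by blast
qed

text \<open>Expand the average of \<open>(norm (U - m))\<^sup>2\<close> about the mean \<open>m\<close>.\<close>
lemma norm_conv_square_le:
  fixes U :: "'a::euclidean_space \<Rightarrow> 'b::euclidean_space"
  assumes \<rho>: "mollifier \<epsilon> \<rho>"
    and U: "locally_integrable U" and U_square: "locally_integrable (\<lambda>x. (norm (U x))\<^sup>2)"
  shows "(norm (conv \<rho> U x))\<^sup>2 \<le> conv \<rho> (\<lambda>x. (norm (U x))\<^sup>2) x"
proof -
  define m where "m = conv \<rho> U x"
  note \<rho>_test = mollifierD(1)[OF \<rho>]
  have square: "integrable lborel (\<lambda>y. \<rho> (x - y) * (norm (U y))\<^sup>2)"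
    using integrable_conv_test_fun[OF \<rho>_test U_square, of x] by simp
  note mean = integrable_conv_test_fun[OF \<rho>_test U, of x]
  then have cross: "integrable lborel (\<lambda>y. 2 * ((\<rho> (x - y) *\<^sub>R U y) \<bullet> m))"
    by (intro integrable_mult_right integrable_inner_left)
  note mass = lborel_integral_reflect[OF integrable_test_fun[OF \<rho>_test], of x]
  have const: "integrable lborel (\<lambda>y. \<rho> (x - y) * (norm m)\<^sup>2)"
    using mass(1) by (rule integrable_mult_left)
  have "0 \<le> (\<integral>y. \<rho> (x - y) * (norm (U y - m))\<^sup>2 \<partial>lborel)"
    by (intro Bochner_Integration.integral_nonneg) (simp add: mollifierD(2)[OF \<rho>])
  also have "\<dots> = (\<integral>y. \<rho> (x - y) * (norm (U y))\<^sup>2 - 2 * ((\<rho> (x - y) *\<^sub>R U y) \<bullet> m)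
      + \<rho> (x - y) * (norm m)\<^sup>2 \<partial>lborel)"
    by (simp add: power2_norm_eq_inner inner_diff_left inner_diff_right inner_commute algebra_simps)
  also have "\<dots> = conv \<rho> (\<lambda>x. (norm (U x))\<^sup>2) x - 2 * (m \<bullet> m) + (\<integral>y. \<rho> (x - y) \<partial>lborel) * (norm m)\<^sup>2"
    using square cross const integral_inner_left[OF mean, of m] by (simp add: conv_def m_def)
  also have "\<dots> = conv \<rho> (\<lambda>x. (norm (U x))\<^sup>2) x - (norm m)\<^sup>2"
    using mass(2) mollifierD(4)[OF \<rho>] by (simp add: power2_norm_eq_inner)
  finally show ?thesis
    by (simp add: m_def)
qed

lemma conv_minus_eq:
  assumes \<rho>: "mollifier \<epsilon> \<rho>" and U: "locally_integrable U"
  shows "integrable lborel (\<lambda>z. \<rho> z *\<^sub>R (U (x - z) - U x))"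
    and "conv \<rho> U x - U x = (\<integral>z. \<rho> z *\<^sub>R (U (x - z) - U x) \<partial>lborel)"
proof -
  note \<rho>_test = mollifierD(1)[OF \<rho>]
  note reflected =
    lborel_integral_reflect[OF integrable_conv_test_fun[OF \<rho>_test U], of x x, simplified]
  have const: "integrable lborel (\<lambda>z. \<rho> z *\<^sub>R U x)" "(\<integral>z. \<rho> z *\<^sub>R U x \<partial>lborel) = U x"
    using integrable_test_fun[OF \<rho>_test] mollifierD(4)[OF \<rho>] by simp_all
  show "integrable lborel (\<lambda>z. \<rho> z *\<^sub>R (U (x - z) - U x))"
    unfolding scaleR_diff_right by (intro Bochner_Integration.integrable_diff reflected(1) const(1))
  show "conv \<rho> U x - U x = (\<integral>z. \<rho> z *\<^sub>R (U (x - z) - U x) \<partial>lborel)"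
    unfolding scaleR_diff_right Bochner_Integration.integral_diff[OF reflected(1) const(1)]
      reflected(2) const(2) conv_def ..
qed

lemma norm_conv_minus_le:
  assumes \<rho>: "mollifier \<epsilon> \<rho>" and U: "locally_integrable U"
  shows "ennreal (norm (conv \<rho> U x - U x))
    \<le> (\<integral>\<^sup>+z. ennreal (\<rho> z) * norm (U (x - z) - U x) \<partial>lborel)"
proof -
  have "ennreal (norm (conv \<rho> U x - U x)) \<le> (\<integral>\<^sup>+z. norm (\<rho> z *\<^sub>R (U (x - z) - U x)) \<partial>lborel)"
    unfolding conv_minus_eq(2)[OF assms]
    by (rule integral_norm_bound_ennreal[OF conv_minus_eq(1)[OF assms]])
  also have "\<dots> = (\<integral>\<^sup>+z. ennreal (\<rho> z) * norm (U (x - z) - U x) \<partial>lborel)"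
    using mollifierD(2)[OF \<rho>] by (intro nn_integral_cong) (simp add: ennreal_mult)
  finally show ?thesis .
qed

lemma nn_integral_norm_conv_minus_le:
  assumes \<rho>: "mollifier \<epsilon> \<rho>" and V: "integrable lborel V"
    and e: "\<And>z. norm z < \<epsilon> \<Longrightarrow> L1_modulus V z \<le> e"
  shows "(\<integral>\<^sup>+x. norm (conv \<rho> V x - V x) \<partial>lborel) \<le> ennreal e"
proof -
  note V_loc = integrable_imp_locally_integrable[OF V]
  note [measurable] = locally_integrable_measurable[OF V_loc]
    smooth_fun_measurable[OF test_funD(1)[OF mollifierD(1)[OF \<rho>]]]
  have "(\<integral>\<^sup>+x. norm (conv \<rho> V x - V x) \<partial>lborel)
      \<le> (\<integral>\<^sup>+x. (\<integral>\<^sup>+z. ennreal (\<rho> z) * norm (V (x - z) - V x) \<partial>lborel) \<partial>lborel)"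
    by (intro nn_integral_mono norm_conv_minus_le[OF \<rho> V_loc])
  also have "\<dots> = (\<integral>\<^sup>+z. (\<integral>\<^sup>+x. ennreal (\<rho> z) * norm (V (x - z) - V x) \<partial>lborel) \<partial>lborel)"
    by (rule lborel_pair.Fubini') measurable
  also have "\<dots> \<le> (\<integral>\<^sup>+z. ennreal (\<rho> z) * ennreal e \<partial>lborel)"
  proof (rule nn_integral_mono)
    fix z
    have "(\<integral>\<^sup>+x. ennreal (\<rho> z) * norm (V (x - z) - V x) \<partial>lborel)
        = ennreal (\<rho> z) * (\<integral>\<^sup>+x. norm (V (x - z) - V x) \<partial>lborel)"
      by (rule nn_integral_cmult) measurable
    also have "(\<integral>\<^sup>+x. norm (V (x - z) - V x) \<partial>lborel) = ennreal (L1_modulus V z)"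
      unfolding L1_modulus_def by (intro nn_integral_eq_integral integrable_L1_modulus V) auto
    also have "ennreal (\<rho> z) * \<dots> \<le> ennreal (\<rho> z) * ennreal e"
      using e[of z] mollifierD(3)[OF \<rho>, of z]
      by (cases "norm z < \<epsilon>") (auto intro: mult_left_mono ennreal_leI)
    finally show "(\<integral>\<^sup>+x. ennreal (\<rho> z) * norm (V (x - z) - V x) \<partial>lborel)
        \<le> ennreal (\<rho> z) * ennreal e" .
  qed
  also have "\<dots> = ennreal (\<integral>z. \<rho> z \<partial>lborel) * ennreal e"
    using nn_integral_eq_integral[OF integrable_test_fun[OF mollifierD(1)[OF \<rho>]]]
      mollifierD(2)[OF \<rho>]
    by (simp add: nn_integral_multc)
  finally show ?thesis
    using mollifierD(4)[OF \<rho>] by simp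
qed

lemma integrable_conv_minus:
  assumes \<rho>: "mollifier \<epsilon> \<rho>" and V: "integrable lborel V"
  shows "integrable lborel (\<lambda>x. conv \<rho> V x - V x)"
proof (rule integrableI_bounded)
  show "(\<lambda>x. conv \<rho> V x - V x) \<in> borel_measurable lborel"
    using conv_measurable[OF mollifierD(1)[OF \<rho>] integrable_imp_locally_integrable[OF V]]
      borel_measurable_integrable[OF V] by simp
  show "(\<integral>\<^sup>+x. norm (conv \<rho> V x - V x) \<partial>lborel) < \<infinity>"
    using nn_integral_norm_conv_minus_le[OF \<rho> V L1_modulus_le_norm[OF V]]
    by (auto simp: less_top[symmetric] top_unique)
qed

lemma conv_tendsto_L1:
  assumes \<rho>: "\<And>n. mollifier (1 / Suc n) (\<rho> n)" and V: "integrable lborel V"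
  shows "(\<lambda>n. \<integral>x. norm (conv (\<rho> n) V x - V x) \<partial>lborel) \<longlonglongrightarrow> 0"
proof (rule LIMSEQ_I)
  fix e :: real assume "e > 0"
  then obtain d where d: "d > 0" "\<And>z. dist z 0 < d \<Longrightarrow> L1_modulus V z < e / 2"
    using isCont_L1_modulus[OF V, unfolded continuous_at_eps_delta, rule_format, of "e / 2"]
      L1_modulus_nonneg[of V] by (auto simp: dist_real_def)
  obtain N where N: "1 / Suc N < d"
    using d(1) nat_approx_posE by blast
  have "(\<integral>x. norm (conv (\<rho> n) V x - V x) \<partial>lborel) < e" if "n \<ge> N" for n
  proof -
    have "1 / Suc n \<le> 1 / Suc N"
      using that by (simp add: field_simps)
    then have "(\<integral>\<^sup>+x. norm (conv (\<rho> n) V x - V x) \<partial>lborel) \<le> ennreal (e / 2)"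
      using N by (intro nn_integral_norm_conv_minus_le[OF \<rho> V] less_imp_le d(2)) simp
    moreover have "(\<integral>\<^sup>+x. norm (conv (\<rho> n) V x - V x) \<partial>lborel)
        = ennreal (\<integral>x. norm (conv (\<rho> n) V x - V x) \<partial>lborel)"
      by (intro nn_integral_eq_integral integrable_norm integrable_conv_minus[OF \<rho> V]) simp
    ultimately show ?thesis
      using \<open>e > 0\<close> by (simp add: ennreal_le_iff)
  qed
  then show "\<exists>N. \<forall>n\<ge>N. norm ((\<integral>x. norm (conv (\<rho> n) V x - V x) \<partial>lborel) - 0) < e"
    by (auto intro!: exI[of _ N])
qed

lemma conv_cong_near:
  assumes "mollifier \<epsilon> \<rho>" "\<And>y. dist x y < \<epsilon> \<Longrightarrow> U y = V y"
  shows "conv \<rho> U x = conv \<rho> V x"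
proof -
  have "\<rho> (x - y) *\<^sub>R U y = \<rho> (x - y) *\<^sub>R V y" for y
    using assms(2)[of y] mollifierD(3)[OF assms(1), of "x - y"]
    by (cases "dist x y < \<epsilon>") (auto simp: dist_norm)
  then show ?thesis by (simp only: conv_def)
qed

lemma set_integral_conv_tendsto:
  assumes \<rho>: "\<And>n. mollifier (1 / Suc n) (\<rho> n)" and V: "integrable lborel V" and A: "A \<in> sets lborel"
  shows "set_integrable lborel A (conv (\<rho> n) V)"
    and "(\<lambda>n. LINT x:A|lborel. conv (\<rho> n) V x) \<longlonglongrightarrow> (LINT x:A|lborel. V x)"
proof -
  note diff = integrable_conv_minus[OF \<rho> V]
  have V_int: "set_integrable lborel A V"
    using integrable_mult_indicator[OF A V] by (simp add: set_integrable_def)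
  have diff_int: "set_integrable lborel A (\<lambda>x. conv (\<rho> n) V x - V x)" for n
    using integrable_mult_indicator[OF A diff] by (simp add: set_integrable_def)
  show conv_int: "set_integrable lborel A (conv (\<rho> n) V)" for n
    using set_integral_add(1)[OF diff_int[of n] V_int] by simp
  have bound: "norm ((LINT x:A|lborel. conv (\<rho> n) V x) - (LINT x:A|lborel. V x))
      \<le> (\<integral>x. norm (conv (\<rho> n) V x - V x) \<partial>lborel)" for n
    unfolding set_integral_diff(2)[OF conv_int V_int, symmetric] unfolding set_lebesgue_integral_def
    using diff_int[of n]
    by (intro Bochner_Integration.integral_norm_bound_integral integrable_norm diff)
      (auto simp: set_integrable_def indicator_def)
  show "(\<lambda>n. LINT x:A|lborel. conv (\<rho> n) V x) \<longlonglongrightarrow> (LINT x:A|lborel. V x)"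
    by (rule LIM_zero_cancel, rule Lim_null_comparison[OF _ conv_tendsto_L1[OF \<rho> V]])
        (simp add: bound)
qed

lemma conv_restrict_cball:
  assumes "mollifier \<epsilon> \<rho>" "\<epsilon> \<le> 1" "x \<in> cball 0 R"
  shows "conv \<rho> (\<lambda>y. indicator (cball 0 (R + 1)) y *\<^sub>R U y) x = conv \<rho> U x"
proof (rule conv_cong_near[OF assms(1)])
  fix y assume "dist x y < \<epsilon>"
  then have "norm y \<le> R + 1"
    using assms(2,3) norm_triangle_ineq2[of y x] by (simp add: dist_norm norm_minus_commute)
  then show "indicator (cball 0 (R + 1)) y *\<^sub>R U y = U y" by simp
qed

lemma conv_local_convergence:
  fixes U :: "'a::euclidean_space \<Rightarrow> 'b::{banach, second_countable_topology}" and R :: real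
  assumes \<rho>: "\<And>n. mollifier (1 / Suc n) (\<rho> n)" and U: "locally_integrable U"
  obtains s where "strict_mono s"
    "AE x\<in>cball 0 R in lborel. (\<lambda>n. conv (\<rho> (s n)) U x) \<longlonglongrightarrow> U x"
    "\<And>n. set_integrable lborel (cball 0 R) (conv (\<rho> n) U)"
    "(\<lambda>n. LINT x:cball 0 R|lborel. conv (\<rho> (s n)) U x) \<longlonglongrightarrow> (LINT x:cball 0 R|lborel. U x)"
proof -
  let ?K = "cball 0 R :: 'a set"
  define V where "V x = indicator (cball 0 (R + 1)) x *\<^sub>R U x" for x
  have V: "integrable lborel V"
    using locally_integrableD[OF U compact_cball] unfolding set_integrable_def V_def .
  have V_eq: "U x = V x" and conv_eq: "conv (\<rho> n) U x = conv (\<rho> n) V x" if "x \<in> ?K" for n x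
    using that conv_restrict_cball[OF \<rho> _ that, of n U] by (simp_all add: V_def[abs_def])
  have set_integral_eq: "(LINT x:?K|lborel. conv (\<rho> n) U x) = (LINT x:?K|lborel. conv (\<rho> n) V x)"
    "(LINT x:?K|lborel. U x) = (LINT x:?K|lborel. V x)" for n
    by (rule set_lebesgue_integral_cong; simp add: V_eq conv_eq del: mem_cball)+
  obtain s where s: "strict_mono s" "AE x in lborel. (\<lambda>n. conv (\<rho> (s n)) V x - V x) \<longlonglongrightarrow> 0"
    using tendsto_L1_AE_subseq[OF integrable_conv_minus[OF \<rho> V] conv_tendsto_L1[OF \<rho> V]] by blast
  note conv_V = set_integral_conv_tendsto[OF \<rho> V, of ?K]
  show ?thesis
  proof
    show "AE x\<in>?K in lborel. (\<lambda>n. conv (\<rho> (s n)) U x) \<longlonglongrightarrow> U x"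
      using s(2)
    proof eventually_elim
      case (elim x)
      then show ?case by (simp add: V_eq conv_eq LIM_zero_iff del: mem_cball)
    qed
    show "set_integrable lborel ?K (conv (\<rho> n) U)" for n
      using conv_V(1)[of n]
        set_integrable_cong[of lborel lborel ?K ?K "conv (\<rho> n) U" "conv (\<rho> n) V"] conv_eq
      by simp
    show "(\<lambda>n. LINT x:?K|lborel. conv (\<rho> (s n)) U x) \<longlonglongrightarrow> (LINT x:?K|lborel. U x)"
      using LIMSEQ_subseq_LIMSEQ[OF conv_V(2) s(1)] by (simp add: o_def set_integral_eq)
  qed (rule s(1))
qed

lemma H1loc_gradD:
  assumes "H1loc_grad u g"
  shows "u \<in> borel_measurable borel" "g \<in> borel_measurable borel" "weak_grad u g"
    "locally_integrable (\<lambda>x. (norm (u x))\<^sup>2)" "locally_integrable (\<lambda>x. (norm (g x))\<^sup>2)"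
    "locally_integrable u" "locally_integrable g"
  using assms unfolding H1loc_grad_def loc_L2_def loc_integrable_iff
  by (auto intro: locally_integrable_if_norm_square)

lemma grad_conv_H1loc:
  assumes "H1loc_grad u g" "test_fun \<rho>"
  shows "grad (conv \<rho> u) x = conv \<rho> g x"
  by (rule grad_conv[OF assms(2) H1loc_gradD(6,7,3)[OF assms(1)]])

definition energy_density :: "('a \<Rightarrow> real) \<Rightarrow> ('a \<Rightarrow> 'b::real_normed_vector) \<Rightarrow> 'a \<Rightarrow> real" where
  "energy_density u g x = (u x)\<^sup>2 + (norm (g x))\<^sup>2"

lemma locally_integrable_energy_density:
  assumes "H1loc_grad u g"
  shows "locally_integrable (energy_density u g)"
  using locally_integrable_add[OF H1loc_gradD(4,5)[OF assms]]
  by (simp add: energy_density_def[abs_def])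

lemma energy_density_conv_le:
  assumes "H1loc_grad u g" and \<rho>: "mollifier \<epsilon> \<rho>"
  shows "energy_density (conv \<rho> u) (grad (conv \<rho> u)) x \<le> conv \<rho> (energy_density u g) x"
proof -
  note H1 = H1loc_gradD[OF assms(1)] and test = mollifierD(1)[OF \<rho>]
  have "conv \<rho> (\<lambda>x. (norm (u x))\<^sup>2 + (norm (g x))\<^sup>2) x
      = conv \<rho> (\<lambda>x. (norm (u x))\<^sup>2) x + conv \<rho> (\<lambda>x. (norm (g x))\<^sup>2) x"
    unfolding conv_def scaleR_add_right
    by (intro Bochner_Integration.integral_add integrable_conv_test_fun test H1(4,5))
  then show ?thesis
    unfolding energy_density_def grad_conv_H1loc[OF assms(1) test]
    using norm_conv_square_le[OF \<rho> H1(6,4), of x] norm_conv_square_le[OF \<rho> H1(7,5), of x] by simp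
qed

lemma set_integral_fst:
  assumes "set_integrable M A f"
  shows "set_integrable M A (\<lambda>x. fst (f x))" "(LINT x:A|M. fst (f x)) = fst (LINT x:A|M. f x)"
  using integrable_fst[OF assms[unfolded set_integrable_def]]
    integral_fst[OF assms[unfolded set_integrable_def]]
  by (simp_all add: set_integrable_def set_lebesgue_integral_def)

lemma mollifier_sequence:
  obtains \<rho> :: "nat \<Rightarrow> 'a::euclidean_space \<Rightarrow> real" where "\<And>n. mollifier (1 / Suc n) (\<rho> n)"
proof -
  have "\<exists>\<rho> :: 'a \<Rightarrow> real. mollifier (1 / Suc n) \<rho>" for n
    by (rule exists_mollifier) simp
  then show ?thesis using that by metis
qed

lemma conv_energy_triple:
  fixes u :: "'a::euclidean_space \<Rightarrow> real"
  assumes "H1loc_grad u g"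
  defines "U \<equiv> \<lambda>x. (energy_density u g x, u x, g x)"
  shows "locally_integrable U"
    and "test_fun \<rho> \<Longrightarrow> conv \<rho> U x = (conv \<rho> (energy_density u g) x, conv \<rho> u x, grad (conv \<rho> u) x)"
  using locally_integrable_energy_density[OF assms(1)] H1loc_gradD(6,7)[OF assms(1)]
  by (simp_all add: U_def conv_Pair locally_integrable_Pair grad_conv_H1loc[OF assms(1)])

text \<open>The integrals of the majorants \<open>w n\<close> converge, so they can dominate in Fatou's lemma.\<close>
lemma H1loc_smooth_approximation:
  fixes u :: "'a::euclidean_space \<Rightarrow> real" and R :: real
  assumes "H1loc_grad u g"
  obtains v w where
    "\<And>n::nat. smooth_fun (v n)"
    "\<And>n x. energy_density (v n) (grad (v n)) x \<le> w n x"
    "\<And>n. set_integrable lborel (cball 0 R) (w n)"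
    "(\<lambda>n. LINT x:cball 0 R|lborel. w n x) \<longlonglongrightarrow> (LINT x:cball 0 R|lborel. energy_density u g x)"
    "AE x\<in>cball 0 R in lborel. (\<lambda>n. v n x) \<longlonglongrightarrow> u x \<and> (\<lambda>n. grad (v n) x) \<longlonglongrightarrow> g x
       \<and> (\<lambda>n. w n x) \<longlonglongrightarrow> energy_density u g x"
proof -
  let ?K = "cball 0 R :: 'a set"
  define e where "e = energy_density u g"
  define U where "U x = (e x, u x, g x)" for x
  obtain \<rho> :: "nat \<Rightarrow> 'a \<Rightarrow> real" where \<rho>: "\<And>n. mollifier (1 / Suc n) (\<rho> n)"
    using mollifier_sequence by blast
  note test = mollifierD(1)[OF \<rho>]
  have U: "locally_integrable U"
    and conv_U: "conv (\<rho> n) U x = (conv (\<rho> n) e x, conv (\<rho> n) u x, grad (conv (\<rho> n) u) x)" for n x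
    using conv_energy_triple[OF assms] test by (simp_all add: U_def[abs_def] e_def)
  obtain s where s: "strict_mono s"
    "AE x\<in>?K in lborel. (\<lambda>n. conv (\<rho> (s n)) U x) \<longlonglongrightarrow> U x"
    "\<And>n. set_integrable lborel ?K (conv (\<rho> n) U)"
    "(\<lambda>n. LINT x:?K|lborel. conv (\<rho> (s n)) U x) \<longlonglongrightarrow> (LINT x:?K|lborel. U x)"
    by (rule conv_local_convergence[OF \<rho> U, of R]) (rule that; assumption)
  show ?thesis
  proof (rule that[of "\<lambda>n. conv (\<rho> (s n)) u" "\<lambda>n. conv (\<rho> (s n)) e", folded e_def])
    show "smooth_fun (conv (\<rho> (s n)) u)" for n
      by (rule smooth_fun_conv[OF test H1loc_gradD(6)[OF assms]])
    show "energy_density (conv (\<rho> (s n)) u) (grad (conv (\<rho> (s n)) u)) x \<le> conv (\<rho> (s n)) e x"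
      for n x
      unfolding e_def by (rule energy_density_conv_le[OF assms \<rho>])
    show "set_integrable lborel ?K (conv (\<rho> (s n)) e)" for n
      using set_integral_fst(1)[OF s(3)] by (simp add: conv_U)
    show "(\<lambda>n. LINT x:?K|lborel. conv (\<rho> (s n)) e x) \<longlonglongrightarrow> (LINT x:?K|lborel. e x)"
      using tendsto_fst[OF s(4)] set_integral_fst(2)[OF s(3)]
        set_integral_fst(2)[OF locally_integrableD[OF U compact_cball]]
      by (simp add: conv_U U_def)
    show "AE x\<in>?K in lborel. (\<lambda>n. conv (\<rho> (s n)) u x) \<longlonglongrightarrow> u x
        \<and> (\<lambda>n. grad (conv (\<rho> (s n)) u) x) \<longlonglongrightarrow> g x \<and> (\<lambda>n. conv (\<rho> (s n)) e x) \<longlonglongrightarrow> e x"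
      using s(2)
    proof eventually_elim
      case (elim x)
      then have lim: "(\<lambda>n. conv (\<rho> (s n)) U x) \<longlonglongrightarrow> U x" if "x \<in> ?K"
        using that by blast
      show ?case
        using tendsto_fst[OF lim] tendsto_fst[OF tendsto_snd[OF lim]]
          tendsto_snd[OF tendsto_snd[OF lim]]
        by (simp add: conv_U U_def)
    qed
  qed
qed

section \<open>Fatou's lemma for Bochner integrals\<close>

lemma integrable_fatou:
  fixes f :: "nat \<Rightarrow> 'a \<Rightarrow> real"
  assumes f: "\<And>n. integrable M (f n)" "\<And>n x. 0 \<le> f n x"
    and integral_le: "\<And>n. (\<integral>x. f n x \<partial>M) \<le> a n" and a: "a \<longlonglongrightarrow> A"
    and lim: "AE x in M. (\<lambda>n. f n x) \<longlonglongrightarrow> g x" and g: "g \<in> borel_measurable M"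
  shows "integrable M g" "(\<integral>x. g x \<partial>M) \<le> A"
proof -
  have g_nonneg: "AE x in M. 0 \<le> g x"
    using lim by eventually_elim (use f(2) in \<open>auto intro: LIMSEQ_le_const\<close>)
  have "0 \<le> a n" for n
    using order_trans[OF Bochner_Integration.integral_nonneg integral_le[of n]] f(2) by blast
  then have A_nonneg: "0 \<le> A"
    using a by (auto intro: LIMSEQ_le_const)
  have "(\<integral>\<^sup>+x. ennreal (g x) \<partial>M) = (\<integral>\<^sup>+x. liminf (\<lambda>n. ennreal (f n x)) \<partial>M)"
  proof (rule nn_integral_cong_AE)
    show "AE x in M. ennreal (g x) = liminf (\<lambda>n. ennreal (f n x))"
      using lim by eventually_elim (rule lim_imp_Liminf[symmetric], auto intro: tendsto_ennrealI)
  qed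
  also have "\<dots> \<le> liminf (\<lambda>n. \<integral>\<^sup>+x. ennreal (f n x) \<partial>M)"
    using borel_measurable_integrable[OF f(1)] by (intro nn_integral_liminf) measurable
  also have "\<dots> \<le> liminf (\<lambda>n. ennreal (a n))"
    using f integral_le
    by (intro Liminf_mono always_eventually allI) (simp add: nn_integral_eq_integral ennreal_leI)
  also have "\<dots> = ennreal A"
    by (intro lim_imp_Liminf tendsto_ennrealI a) simp
  finally have bound: "(\<integral>\<^sup>+x. ennreal (g x) \<partial>M) \<le> ennreal A" .
  then show int: "integrable M g"
    using g g_nonneg by (intro integrableI_nonneg) (auto simp: less_top[symmetric] top_unique)
  show "(\<integral>x. g x \<partial>M) \<le> A"
    using bound nn_integral_eq_integral[OF int g_nonneg] A_nonneg by simp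
qed

lemma integrable_reverse_fatou:
  fixes f w :: "nat \<Rightarrow> 'a \<Rightarrow> real"
  assumes f: "\<And>n. integrable M (f n)" "\<And>n. c \<le> (\<integral>x. f n x \<partial>M)"
    and w: "\<And>n. integrable M (w n)" "\<And>n x. f n x \<le> w n x"
    and h: "integrable M h" "(\<lambda>n. \<integral>x. w n x \<partial>M) \<longlonglongrightarrow> (\<integral>x. h x \<partial>M)"
    and lim: "AE x in M. (\<lambda>n. f n x) \<longlonglongrightarrow> g x \<and> (\<lambda>n. w n x) \<longlonglongrightarrow> h x"
    and g: "g \<in> borel_measurable M"
  shows "integrable M g" "c \<le> (\<integral>x. g x \<partial>M)"
proof -
  have gap_lim: "AE x in M. (\<lambda>n. w n x - f n x) \<longlonglongrightarrow> h x - g x"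
    using lim by eventually_elim (auto intro: tendsto_diff)
  have gap_integral_le: "(\<integral>x. w n x - f n x \<partial>M) \<le> (\<integral>x. w n x \<partial>M) - c" for n
    using f w(1) by simp
  have gap_measurable: "(\<lambda>x. h x - g x) \<in> borel_measurable M"
    using borel_measurable_integrable[OF h(1)] g by (rule borel_measurable_diff)
  have gap: "integrable M (\<lambda>x. w n x - f n x)" "0 \<le> w n x - f n x" for n x
    using f(1) w by auto
  note fatou =
    integrable_fatou[OF gap gap_integral_le tendsto_diff[OF h(2) tendsto_const] gap_lim gap_measurable]
  have "g = (\<lambda>x. h x - (h x - g x))"
    by simp
  then show "integrable M g"
    using Bochner_Integration.integrable_diff[OF h(1) fatou(1)] by metis
  then show "c \<le> (\<integral>x. g x \<partial>M)"
    using fatou(2) h(1) by simp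
qed

section \<open>The anisotropic norm\<close>

lemma unit_decomp:
  fixes \<xi> :: "'a::real_normed_vector"
  assumes "\<xi> \<noteq> 0"
  obtains t w where "t > 0" "\<xi> = t *\<^sub>R w" "norm w = 1"
  using assms that[of "norm \<xi>" "\<xi> /\<^sub>R norm \<xi>"] by simp

lemma borel_measurable_continuous_on_except_0:
  fixes f :: "'a::euclidean_space \<Rightarrow> 'b::real_normed_vector"
  assumes "continuous_on (UNIV - {0}) f" "f 0 = 0"
  shows "f \<in> borel_measurable borel"
proof (rule measurable_cong[THEN iffD1])
  show "(\<lambda>x. indicator (UNIV - {0}) x *\<^sub>R f x) \<in> borel_measurable borel"
    by (rule borel_measurable_continuous_on_indicator[OF _ assms(1)]) simp
qed (use assms(2) in \<open>auto simp: indicator_def\<close>)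

locale anisotropic_norm =
  fixes F :: "'a::euclidean_space \<Rightarrow> real"
  assumes admissible: "admissible_F F"
begin

lemma F_differentiable: "\<xi> \<noteq> 0 \<Longrightarrow> F differentiable (at \<xi>)"
  and Fgrad_differentiable: "\<xi> \<noteq> 0 \<Longrightarrow> j \<in> Basis \<Longrightarrow> (\<lambda>\<eta>. Fgrad F \<eta> \<bullet> j) differentiable (at \<xi>)"
  and Fhess_continuous: "i \<in> Basis \<Longrightarrow> j \<in> Basis \<Longrightarrow> continuous_on (UNIV - {0}) (\<lambda>\<xi>. Fhess F \<xi> i j)"
  and F_scale: "F (t *\<^sub>R \<xi>) = \<bar>t\<bar> * F \<xi>"
  and F_nonneg: "F \<xi> \<ge> 0"
  and F_bounds: "\<exists>a b. 0 < a \<and> a \<le> b \<and> (\<forall>\<xi>. a * norm \<xi> \<le> F \<xi> \<and> F \<xi> \<le> b * norm \<xi>)"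
  using admissible unfolding admissible_F_def by blast+

lemma F_0: "F 0 = 0"
  using F_scale[of 0 0] by simp

lemma F_has_derivative: "\<xi> \<noteq> 0 \<Longrightarrow> (F has_derivative (\<lambda>h. Fgrad F \<xi> \<bullet> h)) (at \<xi>)"
  using has_derivative_grad[OF F_differentiable] by (simp add: Fgrad_def)

definition hess :: "'a \<Rightarrow> 'a \<Rightarrow> 'a" where
  "hess \<xi> p = (\<Sum>j\<in>Basis. (\<Sum>i\<in>Basis. (p \<bullet> i) * Fhess F \<xi> i j) *\<^sub>R j)"

lemma hess_inner_Basis: "j \<in> Basis \<Longrightarrow> hess \<xi> p \<bullet> j = (\<Sum>i\<in>Basis. (p \<bullet> i) * Fhess F \<xi> i j)"
  by (simp add: hess_def inner_sum_left inner_Basis if_distrib cong: if_cong)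

lemma linear_hess: "linear (hess \<xi>)"
proof (rule linearI)
  show "hess \<xi> (p + q) = hess \<xi> p + hess \<xi> q" for p q
    by (rule euclidean_eqI) (simp add: hess_inner_Basis inner_add_left distrib_right sum.distrib)
  show "hess \<xi> (c *\<^sub>R p) = c *\<^sub>R hess \<xi> p" for c p
    by (rule euclidean_eqI) (simp add: hess_inner_Basis mult.assoc sum_distrib_left)
qed

lemma Fgrad_has_derivative:
  assumes "\<xi> \<noteq> 0"
  shows "(Fgrad F has_derivative hess \<xi>) (at \<xi>)"
proof (subst has_derivative_componentwise_within, rule ballI)
  fix j :: 'a assume j: "j \<in> Basis"
  note D = has_derivative_grad[OF Fgrad_differentiable[OF assms j]]
  have "grad (\<lambda>\<eta>. Fgrad F \<eta> \<bullet> j) \<xi> \<bullet> p = hess \<xi> p \<bullet> j" for p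
    using assms unfolding hess_inner_Basis[OF j] grad_def
    by (simp add: inner_sum_left Fhess_def inner_commute[of p] mult.commute)
  with D show "((\<lambda>\<eta>. Fgrad F \<eta> \<bullet> j) has_derivative (\<lambda>p. hess \<xi> p \<bullet> j)) (at \<xi>)"
    by simp
qed

lemma Fgrad_scale:
  assumes "t > 0"
  shows "Fgrad F (t *\<^sub>R \<xi>) = Fgrad F \<xi>"
proof (cases "\<xi> = 0")
  case False
  have scale: "((\<lambda>\<eta>. t *\<^sub>R \<eta>) has_derivative (\<lambda>h. t *\<^sub>R h)) (at \<xi>)"
    by (auto intro!: derivative_eq_intros)
  have "((\<lambda>\<eta>. F (t *\<^sub>R \<eta>)) has_derivative (\<lambda>h. Fgrad F (t *\<^sub>R \<xi>) \<bullet> (t *\<^sub>R h))) (at \<xi>)"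
    using has_derivative_compose[OF scale F_has_derivative] False assms by auto
  moreover have "((\<lambda>\<eta>. F (t *\<^sub>R \<eta>)) has_derivative (\<lambda>h. t * (Fgrad F \<xi> \<bullet> h))) (at \<xi>)"
    unfolding F_scale using assms F_has_derivative[OF False] by (auto intro!: derivative_eq_intros)
  ultimately have "(\<lambda>h. Fgrad F (t *\<^sub>R \<xi>) \<bullet> (t *\<^sub>R h)) = (\<lambda>h. t * (Fgrad F \<xi> \<bullet> h))"
    by (rule has_derivative_unique)
  then have "\<And>h. Fgrad F (t *\<^sub>R \<xi>) \<bullet> h = Fgrad F \<xi> \<bullet> h"
    using assms by (simp add: fun_eq_iff)
  then show ?thesis
    using vector_eq_rdot by blast
qed simp

lemma hess_scale:
  assumes "t > 0"
  shows "hess (t *\<^sub>R \<xi>) (t *\<^sub>R p) = hess \<xi> p"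
proof (cases "\<xi> = 0")
  case False
  have scale: "((\<lambda>\<eta>. t *\<^sub>R \<eta>) has_derivative (\<lambda>h. t *\<^sub>R h)) (at \<xi>)"
    by (auto intro!: derivative_eq_intros)
  have "((\<lambda>\<eta>. Fgrad F (t *\<^sub>R \<eta>)) has_derivative (\<lambda>p. hess (t *\<^sub>R \<xi>) (t *\<^sub>R p))) (at \<xi>)"
    using has_derivative_compose[OF scale Fgrad_has_derivative] False assms by auto
  then have "(\<lambda>p. hess (t *\<^sub>R \<xi>) (t *\<^sub>R p)) = hess \<xi>"
    unfolding Fgrad_scale[OF assms]
    by (rule has_derivative_unique[OF _ Fgrad_has_derivative[OF False]])
  then show ?thesis by (rule fun_cong)
qed (simp add: hess_def Fhess_def)

lemma has_derivative_along_ray: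
  assumes "(f has_derivative D) (at \<xi>)"
  shows "((\<lambda>t. f (t *\<^sub>R \<xi>)) has_derivative (\<lambda>h. D (h *\<^sub>R \<xi>))) (at (1::real))"
proof -
  have "((\<lambda>t::real. t *\<^sub>R \<xi>) has_derivative (\<lambda>h. h *\<^sub>R \<xi>)) (at 1)"
    by (auto intro!: derivative_eq_intros)
  then show ?thesis
    by (rule has_derivative_compose) (simp add: assms)
qed

lemma Fgrad_Euler: "Fgrad F \<xi> \<bullet> \<xi> = F \<xi>"
proof (cases "\<xi> = 0")
  case False
  have "((\<lambda>t. t * F \<xi>) has_derivative (\<lambda>h. Fgrad F \<xi> \<bullet> (h *\<^sub>R \<xi>))) (at 1)"
    by (rule has_derivative_transform_within_open[where s="{0<..}",
          OF has_derivative_along_ray[OF F_has_derivative[OF False]]]) (auto simp: F_scale)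
  moreover have "((\<lambda>t. t * F \<xi>) has_derivative (\<lambda>h. h * F \<xi>)) (at 1)"
    by (auto intro!: derivative_eq_intros)
  ultimately have "(\<lambda>h. Fgrad F \<xi> \<bullet> (h *\<^sub>R \<xi>)) = (\<lambda>h. h * F \<xi>)"
    by (rule has_derivative_unique)
  from fun_cong[OF this, of 1] show ?thesis by simp
qed (simp add: F_0)

lemma hess_Euler: "hess \<xi> \<xi> = 0"
proof (cases "\<xi> = 0")
  case False
  have "((\<lambda>t. Fgrad F \<xi>) has_derivative (\<lambda>h. hess \<xi> (h *\<^sub>R \<xi>))) (at (1::real))"
    by (rule has_derivative_transform_within_open[where s="{0<..}",
          OF has_derivative_along_ray[OF Fgrad_has_derivative[OF False]]]) (auto simp: Fgrad_scale)
  then have "(\<lambda>h. hess \<xi> (h *\<^sub>R \<xi>)) = (\<lambda>h::real. 0)"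
    by (rule has_derivative_unique[OF _ has_derivative_const])
  from fun_cong[OF this, of 1] show ?thesis by simp
qed (simp add: hess_def)

lemma hess_inner_self: "hess \<xi> p \<bullet> \<xi> = 0"
proof (cases "\<xi> = 0")
  case False
  have "((\<lambda>\<eta>. Fgrad F \<eta> \<bullet> \<eta>) has_derivative (\<lambda>p. Fgrad F \<xi> \<bullet> p + hess \<xi> p \<bullet> \<xi>)) (at \<xi>)"
    by (rule has_derivative_inner[OF Fgrad_has_derivative[OF False] has_derivative_ident])
  then have "(\<lambda>p. Fgrad F \<xi> \<bullet> p + hess \<xi> p \<bullet> \<xi>) = (\<lambda>p. Fgrad F \<xi> \<bullet> p)"
    unfolding Fgrad_Euler by (rule has_derivative_unique[OF _ F_has_derivative[OF False]])
  from fun_cong[OF this, of p] show ?thesis by simp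
qed simp

definition stability_form :: "'a \<Rightarrow> 'a \<Rightarrow> real" where
  "stability_form \<xi> p = (Fgrad F \<xi> \<bullet> p)\<^sup>2 + F \<xi> * (hess \<xi> p \<bullet> p)"

definition flux :: "'a \<Rightarrow> 'a" where
  "flux \<xi> = F \<xi> *\<^sub>R Fgrad F \<xi>"

lemma stability_form_eq_sum:
  "stability_form \<xi> p = (\<Sum>i\<in>Basis. \<Sum>j\<in>Basis.
      (Fgrad F \<xi> \<bullet> i) * (Fgrad F \<xi> \<bullet> j) * (p \<bullet> i) * (p \<bullet> j)
      + F \<xi> * Fhess F \<xi> i j * (p \<bullet> i) * (p \<bullet> j))"
proof -
  have "(Fgrad F \<xi> \<bullet> p)\<^sup>2
      = (\<Sum>i\<in>Basis. (Fgrad F \<xi> \<bullet> i) * (p \<bullet> i)) * (\<Sum>j\<in>Basis. (Fgrad F \<xi> \<bullet> j) * (p \<bullet> j))"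
    unfolding power2_eq_square by (simp add: euclidean_inner[of "Fgrad F \<xi>" p])
  also have "\<dots> = (\<Sum>i\<in>Basis. \<Sum>j\<in>Basis. (Fgrad F \<xi> \<bullet> i) * (Fgrad F \<xi> \<bullet> j) * (p \<bullet> i) * (p \<bullet> j))"
    unfolding sum_product by (intro sum.cong refl) (simp add: mult_ac)
  finally have square: "(Fgrad F \<xi> \<bullet> p)\<^sup>2 = \<dots>" .
  have "F \<xi> * (hess \<xi> p \<bullet> p) = (\<Sum>j\<in>Basis. \<Sum>i\<in>Basis. F \<xi> * Fhess F \<xi> i j * (p \<bullet> i) * (p \<bullet> j))"
    unfolding euclidean_inner[of "hess \<xi> p" p]
    by (simp add: hess_inner_Basis sum_distrib_left sum_distrib_right mult_ac)
  also have "\<dots> = (\<Sum>i\<in>Basis. \<Sum>j\<in>Basis. F \<xi> * Fhess F \<xi> i j * (p \<bullet> i) * (p \<bullet> j))"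
    by (rule sum.swap)
  finally show ?thesis
    unfolding stability_form_def square by (simp add: sum.distrib)
qed

lemma stability_form_add_scale_self:
  "stability_form \<xi> (a *\<^sub>R \<xi> + b *\<^sub>R q)
    = a\<^sup>2 * (F \<xi>)\<^sup>2 + 2 * a * b * F \<xi> * (Fgrad F \<xi> \<bullet> q) + b\<^sup>2 * stability_form \<xi> q"
proof -
  have "hess \<xi> (a *\<^sub>R \<xi> + b *\<^sub>R q) = b *\<^sub>R hess \<xi> q"
    using hess_Euler by (simp add: linear_add[OF linear_hess] linear_cmul[OF linear_hess])
  then show ?thesis
    unfolding stability_form_def
    by (simp add: inner_add_right Fgrad_Euler hess_inner_self power2_eq_square algebra_simps)
qed

lemma stability_form_scaleR: "stability_form \<xi> (b *\<^sub>R q) = b\<^sup>2 * stability_form \<xi> q"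
  using stability_form_add_scale_self[of \<xi> 0 b q] by simp

lemma stability_form_0 [simp]: "stability_form 0 p = 0" "stability_form \<xi> 0 = 0"
  using stability_form_scaleR[of \<xi> 0 0] by (simp_all add: stability_form_def Fgrad_def F_0)

lemma stability_form_scale:
  assumes "t > 0"
  shows "stability_form (t *\<^sub>R \<xi>) p = stability_form \<xi> p"
proof -
  have "t *\<^sub>R hess (t *\<^sub>R \<xi>) p = hess \<xi> p"
    using hess_scale[OF assms, of \<xi> p] by (simp add: linear_cmul[OF linear_hess])
  then have "t * (hess (t *\<^sub>R \<xi>) p \<bullet> p) = hess \<xi> p \<bullet> p"
    by (metis inner_scaleR_left)
  then show ?thesis
    using assms
    by (simp add: stability_form_def Fgrad_scale F_scale mult.assoc[of _ "F \<xi>"] mult.left_commute)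
qed

lemma F_continuous: "continuous_on (UNIV - {0}) F"
  by (auto
      intro!: continuous_at_imp_continuous_on differentiable_imp_continuous_within F_differentiable)

lemma Fgrad_continuous: "continuous_on (UNIV - {0}) (Fgrad F)"
  by (auto intro!: continuous_at_imp_continuous_on has_derivative_continuous Fgrad_has_derivative)

lemma stability_form_continuous:
  "continuous_on ((UNIV - {0}) \<times> UNIV) (\<lambda>(\<xi>, p). stability_form \<xi> p)"
proof -
  have first: "continuous_on ((UNIV - {0}) \<times> UNIV) (\<lambda>z. f (fst z))"
    if "continuous_on (UNIV - {0}) f" for f :: "'a \<Rightarrow> 'b::topological_space"
    by (rule continuous_on_compose2[OF that]) (auto intro!: continuous_intros)
  show ?thesis
    unfolding stability_form_eq_sum case_prod_beta
    by (intro continuous_intros first[OF F_continuous]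
        first[OF Fgrad_continuous] first[OF Fhess_continuous])
qed

lemma stability_form_tendsto:
  "(p \<longlongrightarrow> q) A \<Longrightarrow> ((\<lambda>n. stability_form \<xi> (p n)) \<longlongrightarrow> stability_form \<xi> q) A"
  unfolding stability_form_eq_sum by (intro tendsto_intros)

lemma F_measurable: "F \<in> borel_measurable borel"
  by (rule borel_measurable_continuous_on_except_0[OF F_continuous F_0])

lemma flux_measurable: "flux \<in> borel_measurable borel"
  unfolding flux_def[abs_def]
  by (intro borel_measurable_continuous_on_except_0
      continuous_on_scaleR F_continuous Fgrad_continuous)
    (simp add: F_0)

lemma stability_form_measurable:
  assumes [measurable]: "g \<in> borel_measurable borel" "p \<in> borel_measurable borel"
  shows "(\<lambda>x. stability_form (g x) (p x)) \<in> borel_measurable borel"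
proof -
  have [measurable]: "Fgrad F \<in> borel_measurable borel"
    by (rule borel_measurable_continuous_on_except_0[OF Fgrad_continuous]) (simp add: Fgrad_def)
  have [measurable]: "(\<lambda>\<xi>. Fhess F \<xi> i j) \<in> borel_measurable borel"
    if "i \<in> Basis" "j \<in> Basis" for i j
    using that
    by (intro borel_measurable_continuous_on_except_0 Fhess_continuous) (simp_all add: Fhess_def)
  note [measurable] = F_measurable
  show ?thesis
    unfolding stability_form_eq_sum by (intro borel_measurable_sum) measurable
qed

lemma Fgrad_bounded: obtains M where "M > 0" "\<And>\<xi>. norm (Fgrad F \<xi>) \<le> M"
proof -
  have "bounded (Fgrad F ` sphere 0 1)"
    by (intro compact_imp_bounded compact_continuous_image
        continuous_on_subset[OF Fgrad_continuous]) auto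
  then obtain M where M: "M > 0" "\<And>\<xi>. norm \<xi> = 1 \<Longrightarrow> norm (Fgrad F \<xi>) \<le> M"
    unfolding bounded_pos by auto
  have "norm (Fgrad F \<xi>) \<le> M" for \<xi>
  proof (cases "\<xi> = 0")
    case False
    then obtain t w where "t > 0" "\<xi> = t *\<^sub>R w" "norm w = 1" by (rule unit_decomp)
    then show ?thesis using M Fgrad_scale by simp
  qed (use M in \<open>simp add: Fgrad_def\<close>)
  then show ?thesis using that M by blast
qed

lemma stability_form_bounded:
  obtains C where "C > 0" "\<And>\<xi> p. \<bar>stability_form \<xi> p\<bar> \<le> C * (norm p)\<^sup>2"
proof -
  let ?f = "\<lambda>(\<xi>, p). stability_form \<xi> p" and ?S = "sphere (0::'a) 1"
  have "bounded (?f ` (?S \<times> ?S))"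
    by (intro compact_imp_bounded compact_continuous_image
        continuous_on_subset[OF stability_form_continuous]
        compact_Times) auto
  then obtain C where C: "C > 0" "\<forall>y\<in>?f ` (?S \<times> ?S). norm y \<le> C"
    unfolding bounded_pos by blast
  have "\<bar>stability_form \<xi> p\<bar> \<le> C * (norm p)\<^sup>2" for \<xi> p
  proof (cases "\<xi> = 0 \<or> p = 0")
    case False
    obtain t w where w: "t > 0" "\<xi> = t *\<^sub>R w" "norm w = 1"
      using False unit_decomp by metis
    obtain s v where v: "s > 0" "p = s *\<^sub>R v" "norm v = 1"
      using False unit_decomp by metis
    have "\<bar>stability_form w v\<bar> \<le> C"
      using C(2) w(3) v(3) by auto
    then show ?thesis
      using w v mult_left_mono[of "\<bar>stability_form w v\<bar>" C "s\<^sup>2"]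
      by (simp add: stability_form_scale stability_form_scaleR abs_mult mult.commute)
  qed (use C(1) in auto)
  then show ?thesis using that C(1) by blast
qed

lemma norm_flux_le:
  obtains M where "M > 0" "\<And>\<xi>. norm (flux \<xi>) \<le> M * norm \<xi>"
proof -
  obtain M where M: "M > 0" "\<And>\<xi>. norm (Fgrad F \<xi>) \<le> M"
    using Fgrad_bounded by blast
  obtain b where b: "b > 0" "\<And>\<xi>. F \<xi> \<le> b * norm \<xi>"
    using F_bounds by (meson less_le_trans)
  have "norm (flux \<xi>) \<le> (b * norm \<xi>) * M" for \<xi>
    unfolding flux_def norm_scaleR using b M F_nonneg[of \<xi>] by (intro mult_mono) auto
  then show ?thesis
    using that[of "b * M"] b M by (simp add: mult_ac)
qed

lemma Fdual_bounds:
  obtains c d where "c > 0" "d > 0" "\<And>x. c * norm x \<le> Fdual F x" "\<And>x. Fdual F x \<le> d * norm x"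
proof -
  obtain a b where ab: "0 < a" "a \<le> b" "\<And>\<xi>. a * norm \<xi> \<le> F \<xi>" "\<And>\<xi>. F \<xi> \<le> b * norm \<xi>"
    using F_bounds by blast
  have upper: "x \<bullet> \<xi> \<le> 1 / a * norm x" if "F \<xi> < 1" for x \<xi>
  proof -
    have "norm \<xi> \<le> 1 / a" using ab(3)[of \<xi>] that ab(1) by (simp add: field_simps)
    then have "norm x * norm \<xi> \<le> norm x * (1 / a)" by (intro mult_left_mono) auto
    then show ?thesis using norm_cauchy_schwarz[of x \<xi>] by simp
  qed
  have bdd: "bdd_above ((\<lambda>\<xi>. x \<bullet> \<xi>) ` {\<xi>. F \<xi> < 1})" for x
    using upper by (intro bdd_aboveI[of _ "1 / a * norm x"]) auto
  have "Fdual F x \<le> 1 / a * norm x" for x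
    unfolding Fdual_def using upper by (intro cSup_least) (auto intro: exI[of _ 0] simp: F_0)
  moreover have "1 / (2 * b) * norm x \<le> Fdual F x" for x
  proof (cases "x = 0")
    case True
    have "x \<bullet> 0 \<le> Fdual F x"
      unfolding Fdual_def
      by (rule cSup_upper[OF _ bdd]) (auto simp: F_0 intro!: image_eqI[of _ _ 0])
    then show ?thesis using True by simp
  next
    case False
    let ?\<xi> = "(1 / (2 * b * norm x)) *\<^sub>R x"
    have "norm ?\<xi> = 1 / (2 * b)" using False ab by simp
    then have "F ?\<xi> < 1" using ab(4)[of ?\<xi>] ab by simp
    then have "x \<bullet> ?\<xi> \<le> Fdual F x"
      unfolding Fdual_def by (intro cSup_upper[OF _ bdd] imageI) simp
    moreover have "x \<bullet> ?\<xi> = 1 / (2 * b) * norm x"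
      using False ab by (simp add: power2_norm_eq_inner[symmetric] power2_eq_square)
    ultimately show ?thesis by simp
  qed
  ultimately show ?thesis
    using that[of "1 / (2 * b)" "1 / a"] ab by auto
qed

lemma Fdual_pos: "x \<noteq> 0 \<Longrightarrow> 0 < Fdual F x"
  by (rule Fdual_bounds) (smt (verit) mult_pos_pos zero_less_norm_iff)

end

section \<open>The energy estimate\<close>

lemma square_add3_le: "(x + y + z)\<^sup>2 \<le> 3 * (x\<^sup>2 + y\<^sup>2 + (z::real)\<^sup>2)"
proof -
  have "0 \<le> (x - y)\<^sup>2 + (y - z)\<^sup>2 + (x - z)\<^sup>2" by simp
  then show ?thesis by (simp add: power2_eq_square algebra_simps)
qed

lemma weighted_arith_geo_mean:
  fixes x y \<delta> :: real
  assumes "\<delta> > 0"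
  shows "2 * x * y \<le> \<delta> * x\<^sup>2 + y\<^sup>2 / \<delta>"
proof -
  have "0 \<le> (\<delta> * x - y)\<^sup>2 / \<delta>" using assms by simp
  also have "\<dots> = \<delta> * x\<^sup>2 + y\<^sup>2 / \<delta> - 2 * x * y"
    using assms by (simp add: power2_diff diff_divide_distrib add_divide_distrib)
      (simp add: power2_eq_square)
  finally show ?thesis by simp
qed

lemma softexp_le_affine:
  assumes "t > 0"
  shows "softexp t s \<le> (1 + t) * (1 + \<bar>s\<bar>)"
  using softexp_le_linear[of t s] assms by (simp add: abs_mult algebra_simps)

lemma norm_combination_le:
  fixes p q :: "'a::real_normed_vector"
  assumes "\<bar>a\<bar> \<le> K" "\<bar>b\<bar> * norm q \<le> K * (1 + \<bar>s\<bar>)"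
  shows "norm (a *\<^sub>R p + b *\<^sub>R q) \<le> K * (1 + \<bar>s\<bar> + norm p)"
proof -
  have "norm (a *\<^sub>R p + b *\<^sub>R q) \<le> \<bar>a\<bar> * norm p + \<bar>b\<bar> * norm q"
    using norm_triangle_ineq[of "a *\<^sub>R p" "b *\<^sub>R q"] by simp
  also have "\<dots> \<le> K * norm p + K * (1 + \<bar>s\<bar>)"
    using assms by (intro add_mono mult_right_mono) auto
  finally show ?thesis by (simp add: algebra_simps)
qed

lemma norm_softexp_combination_le:
  fixes p q :: "'a::real_normed_vector"
  assumes "t > 0" "\<bar>e\<bar> \<le> E" "norm q \<le> E"
  shows "norm ((softexp_slope t s * e) *\<^sub>R p + softexp t s *\<^sub>R q) \<le> (1 + t) * E * (1 + \<bar>s\<bar> + norm p)"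
proof (rule norm_combination_le)
  show "\<bar>softexp_slope t s * e\<bar> \<le> (1 + t) * E"
    unfolding abs_mult using softexp_slope_bounds[OF assms(1), of s] assms by (intro mult_mono) auto
  show "\<bar>softexp t s\<bar> * norm q \<le> (1 + t) * E * (1 + \<bar>s\<bar>)"
    using mult_mono[OF softexp_le_affine[OF assms(1), of s] assms(3)] softexp_pos[of t s] assms(1)
    by (simp add: mult_ac)
qed

lemma norm_softexp_energy_combination_le:
  fixes p q :: "'a::real_normed_vector"
  assumes t: "t > 0" and e: "\<bar>e\<bar> \<le> E" and q: "norm q \<le> E"
  shows "norm (((softexp_slope t s)\<^sup>2 * e\<^sup>2) *\<^sub>R p + (softexp_energy t s * (2 * e)) *\<^sub>R q)
    \<le> 2 * t * (1 + t) * E\<^sup>2 * (1 + \<bar>s\<bar> + norm p)"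
proof (rule norm_combination_le)
  have "(softexp_slope t s)\<^sup>2 * e\<^sup>2 \<le> t\<^sup>2 * E\<^sup>2"
    using softexp_slope_bounds[OF t, of s] e
    by (intro mult_mono power_mono abs_le_square_iff[THEN iffD1]) auto
  also have "\<dots> \<le> 2 * t * (1 + t) * E\<^sup>2"
    using t by (intro mult_right_mono) (auto simp: power2_eq_square algebra_simps)
  finally show "\<bar>(softexp_slope t s)\<^sup>2 * e\<^sup>2\<bar> \<le> 2 * t * (1 + t) * E\<^sup>2" by simp
  have "softexp_energy t s \<le> t * ((1 + t) * (1 + \<bar>s\<bar>))"
    using order_trans[OF softexp_energy_le[OF t] mult_left_mono[OF softexp_le_affine[OF t]]] t
    by simp
  then have "softexp_energy t s * (2 * \<bar>e\<bar>) * norm q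
      \<le> t * ((1 + t) * (1 + \<bar>s\<bar>)) * (2 * E) * E"
    using e q t softexp_energy_nonneg[OF t, of s] by (intro mult_mono) auto
  also have "\<dots> = 2 * t * (1 + t) * E\<^sup>2 * (1 + \<bar>s\<bar>)"
    by (simp only: power2_eq_square mult_ac)
  finally show "\<bar>softexp_energy t s * (2 * e)\<bar> * norm q \<le> 2 * t * (1 + t) * E\<^sup>2 * (1 + \<bar>s\<bar>)"
    using softexp_energy_nonneg[OF t, of s] by (simp add: abs_mult)
qed

context anisotropic_norm
begin

text \<open>For \<open>\<xi> = Du\<close>, \<open>p = \<nabla>v\<close> and \<open>q = \<nabla>e\<close>: the gradient terms of the stability inequality tested with
  \<open>softexp t v \<cdot> e\<close>, minus \<open>\<kappa>\<close> times those of the equation tested with \<open>softexp_energy t v \<cdot> e\<^sup>2\<close>.\<close>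
definition gradient_part :: "real \<Rightarrow> real \<Rightarrow> 'a \<Rightarrow> real \<Rightarrow> 'a \<Rightarrow> real \<Rightarrow> 'a \<Rightarrow> real" where
  "gradient_part t \<kappa> \<xi> s p e q =
     stability_form \<xi> ((softexp_slope t s * e) *\<^sub>R p + softexp t s *\<^sub>R q)
     - \<kappa> * (flux \<xi> \<bullet> (((softexp_slope t s)\<^sup>2 * e\<^sup>2) *\<^sub>R p + (softexp_energy t s * (2 * e)) *\<^sub>R q))"

lemma gradient_part_0: "gradient_part t \<kappa> \<xi> s p 0 0 = 0"
  by (simp add: gradient_part_def)

lemma gradient_part_measurable:
  assumes [measurable]: "g \<in> borel_measurable borel"
    "v \<in> borel_measurable borel" "p \<in> borel_measurable borel"
    "\<eta> \<in> borel_measurable borel" "q \<in> borel_measurable borel"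
  shows "(\<lambda>x. gradient_part t \<kappa> (g x) (v x) (p x) (\<eta> x) (q x)) \<in> borel_measurable borel"
proof -
  note [measurable] = flux_measurable
  have "(\<lambda>x. stability_form (g x) ((softexp_slope t (v x) * \<eta> x) *\<^sub>R p x + softexp t (v x) *\<^sub>R q x))
      \<in> borel_measurable borel"
    by (rule stability_form_measurable) measurable
  then show ?thesis
    unfolding gradient_part_def by measurable
qed

lemma gradient_part_tendsto:
  assumes "(s \<longlongrightarrow> s0) A" "(p \<longlongrightarrow> p0) A"
  shows "((\<lambda>n. gradient_part t \<kappa> \<xi> (s n) (p n) e q) \<longlongrightarrow> gradient_part t \<kappa> \<xi> s0 p0 e q) A"
  unfolding gradient_part_def
  by (intro tendsto_intros stability_form_tendsto softexp_slope_tendsto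
      softexp_tendsto softexp_energy_tendsto assms)

lemma stability_form_minus_flux_growth:
  assumes "L \<ge> 0"
  obtains C where "C \<ge> 0" "\<And>\<xi> x y X. X \<ge> 0 \<Longrightarrow> norm x \<le> K * X \<Longrightarrow> norm y \<le> L * X \<Longrightarrow>
    \<bar>stability_form \<xi> x - \<kappa> * (flux \<xi> \<bullet> y)\<bar> \<le> C * (X\<^sup>2 + (norm \<xi>)\<^sup>2)"
proof -
  obtain A where A: "A > 0" "\<And>\<xi> p. \<bar>stability_form \<xi> p\<bar> \<le> A * (norm p)\<^sup>2"
    using stability_form_bounded by blast
  obtain M where M: "M > 0" "\<And>\<xi>. norm (flux \<xi>) \<le> M * norm \<xi>"
    using norm_flux_le by blast
  have "\<bar>stability_form \<xi> x - \<kappa> * (flux \<xi> \<bullet> y)\<bar> \<le> (A * K\<^sup>2 + \<bar>\<kappa>\<bar> * (M * L)) * (X\<^sup>2 + (norm \<xi>)\<^sup>2)"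
    if X: "X \<ge> 0" "norm x \<le> K * X" "norm y \<le> L * X" for \<xi> x y X
  proof -
    define S where "S = X\<^sup>2 + (norm \<xi>)\<^sup>2"
    have "\<bar>stability_form \<xi> x\<bar> \<le> A * (K * X)\<^sup>2"
      using A(1) X(2) by (intro order_trans[OF A(2)] mult_left_mono power_mono) auto
    also have "\<dots> = A * K\<^sup>2 * X\<^sup>2"
      by (simp add: power_mult_distrib)
    also have "\<dots> \<le> A * K\<^sup>2 * S"
      using A(1) by (intro mult_left_mono) (auto simp: S_def)
    finally have form_le: "\<bar>stability_form \<xi> x\<bar> \<le> A * K\<^sup>2 * S" .
    have "0 \<le> X * norm \<xi>"
      using X(1) by simp
    then have product: "X * norm \<xi> \<le> S"
      using sum_squares_bound[of X "norm \<xi>"] unfolding S_def mult.assoc by linarith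
    have "\<bar>flux \<xi> \<bullet> y\<bar> \<le> (M * norm \<xi>) * (L * X)"
      using M X(3) by (intro order_trans[OF Cauchy_Schwarz_ineq2] mult_mono) auto
    also have "\<dots> = M * L * (X * norm \<xi>)"
      by simp
    also have "\<dots> \<le> M * L * S"
      using product M(1) assms by (intro mult_left_mono) auto
    finally have "\<bar>\<kappa> * (flux \<xi> \<bullet> y)\<bar> \<le> \<bar>\<kappa>\<bar> * (M * L) * S"
      unfolding abs_mult[of \<kappa>] by (simp add: mult.assoc mult_left_mono)
    with form_le show ?thesis
      unfolding S_def[symmetric] distrib_right by linarith
  qed
  moreover have "A * K\<^sup>2 + \<bar>\<kappa>\<bar> * (M * L) \<ge> 0"
    using A(1) M(1) assms by simp
  ultimately show ?thesis
    using that by blast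
qed

lemma gradient_part_growth:
  assumes t: "t > 0"
  obtains C where "C \<ge> 0" "\<And>\<xi> s p e q. \<bar>e\<bar> \<le> E \<Longrightarrow> norm q \<le> E \<Longrightarrow>
    \<bar>gradient_part t \<kappa> \<xi> s p e q\<bar> \<le> C * (1 + (s\<^sup>2 + (norm p)\<^sup>2) + (norm \<xi>)\<^sup>2)"
proof -
  have "2 * t * (1 + t) * E\<^sup>2 \<ge> 0" using t by simp
  then obtain C where C: "C \<ge> 0" "\<And>\<xi> x y X. X \<ge> 0 \<Longrightarrow> norm x \<le> (1 + t) * E * X \<Longrightarrow>
      norm y \<le> 2 * t * (1 + t) * E\<^sup>2 * X \<Longrightarrow>
      \<bar>stability_form \<xi> x - \<kappa> * (flux \<xi> \<bullet> y)\<bar> \<le> C * (X\<^sup>2 + (norm \<xi>)\<^sup>2)"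
    using stability_form_minus_flux_growth[of _ "(1 + t) * E" \<kappa>] by metis
  have "\<bar>gradient_part t \<kappa> \<xi> s p e q\<bar> \<le> 3 * C * (1 + (s\<^sup>2 + (norm p)\<^sup>2) + (norm \<xi>)\<^sup>2)"
    if "\<bar>e\<bar> \<le> E" "norm q \<le> E" for \<xi> s p e q
  proof -
    let ?X = "1 + \<bar>s\<bar> + norm p"
    have "\<bar>gradient_part t \<kappa> \<xi> s p e q\<bar> \<le> C * (?X\<^sup>2 + (norm \<xi>)\<^sup>2)"
      unfolding gradient_part_def
      by (intro C(2) norm_softexp_combination_le norm_softexp_energy_combination_le t that) simp
    also have "\<dots> \<le> C * (3 * (1\<^sup>2 + \<bar>s\<bar>\<^sup>2 + (norm p)\<^sup>2) + 3 * (norm \<xi>)\<^sup>2)"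
      using C(1) by (intro mult_left_mono add_mono square_add3_le) auto
    finally show ?thesis by (simp add: algebra_simps)
  qed
  moreover have "3 * C \<ge> 0" using C(1) by simp
  ultimately show ?thesis using that by blast
qed

lemma gradient_part_self_eq:
  "gradient_part t \<kappa> \<xi> s \<xi> e q = - (\<kappa> - 1) * (softexp_slope t s * e * F \<xi>)\<^sup>2
     + 2 * (softexp_slope t s * softexp t s - \<kappa> * softexp_energy t s) * (e * F \<xi> * (Fgrad F \<xi> \<bullet> q))
     + (softexp t s)\<^sup>2 * stability_form \<xi> q"
  unfolding gradient_part_def stability_form_add_scale_self flux_def
  by (simp add: inner_add_right Fgrad_Euler power2_eq_square algebra_simps)

lemma mixed_term_le:
  assumes t: "0 < t" and \<kappa>: "\<kappa> > 1" and M: "norm (Fgrad F \<xi>) \<le> M"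
  shows
    "2 * (softexp_slope t s * softexp t s - \<kappa> * softexp_energy t s) * (e * F \<xi> * (Fgrad F \<xi> \<bullet> q))
    \<le> (\<kappa> - 1) * (softexp_slope t s * e * F \<xi>)\<^sup>2 + (\<kappa> * M)\<^sup>2 / (\<kappa> - 1) * ((softexp t s)\<^sup>2 * (norm q)\<^sup>2)"
proof -
  let ?\<beta> = "softexp t s" and ?\<beta>' = "softexp_slope t s" and ?\<gamma> = "softexp_energy t s"
  let ?x = "?\<beta>' * \<bar>e\<bar> * F \<xi>" and ?y = "\<kappa> * M * (?\<beta> * norm q)"
  have pos: "0 \<le> ?\<beta>' * ?\<beta>" "0 \<le> ?\<gamma>"
    using softexp_pos[of t s] softexp_slope_bounds(1)[OF t, of s] softexp_energy_nonneg[OF t, of s]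
    by auto
  have coeff: "\<bar>?\<beta>' * ?\<beta> - \<kappa> * ?\<gamma>\<bar> \<le> \<kappa> * (?\<beta>' * ?\<beta>)"
  proof -
    have "0 \<le> \<kappa> * ?\<gamma>" "\<kappa> * ?\<gamma> \<le> \<kappa> * (?\<beta>' * ?\<beta>)"
      using \<kappa> pos(2) softexp_energy_le_slope[OF t, of s] by (simp_all add: mult.commute)
    moreover have "1 * (?\<beta>' * ?\<beta>) \<le> \<kappa> * (?\<beta>' * ?\<beta>)"
      using \<kappa> pos(1) by (intro mult_right_mono) auto
    ultimately show ?thesis using pos(1) by linarith
  qed
  have "\<bar>Fgrad F \<xi> \<bullet> q\<bar> \<le> M * norm q"
    by (meson Cauchy_Schwarz_ineq2 M mult_right_mono norm_ge_zero order_trans)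
  then have inner: "\<bar>e * F \<xi> * (Fgrad F \<xi> \<bullet> q)\<bar> \<le> \<bar>e\<bar> * F \<xi> * (M * norm q)"
    using F_nonneg[of \<xi>] by (simp add: abs_mult mult_left_mono)
  have "(?\<beta>' * ?\<beta> - \<kappa> * ?\<gamma>) * (e * F \<xi> * (Fgrad F \<xi> \<bullet> q))
      \<le> (\<kappa> * (?\<beta>' * ?\<beta>)) * (\<bar>e\<bar> * F \<xi> * (M * norm q))"
    using mult_mono[OF coeff inner] \<kappa> pos(1) by (simp add: abs_mult[symmetric])
  also have "\<dots> = ?x * ?y"
    by (simp add: mult_ac)
  finally have "2 * ((?\<beta>' * ?\<beta> - \<kappa> * ?\<gamma>) * (e * F \<xi> * (Fgrad F \<xi> \<bullet> q))) \<le> 2 * (?x * ?y)"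
    by (rule mult_left_mono) simp
  then have "2 * (?\<beta>' * ?\<beta> - \<kappa> * ?\<gamma>) * (e * F \<xi> * (Fgrad F \<xi> \<bullet> q)) \<le> 2 * ?x * ?y"
    by (simp only: mult.assoc)
  also have "\<dots> \<le> (\<kappa> - 1) * ?x\<^sup>2 + ?y\<^sup>2 / (\<kappa> - 1)"
    using \<kappa> by (intro weighted_arith_geo_mean) simp
  also have "\<dots> = (\<kappa> - 1) * (?\<beta>' * e * F \<xi>)\<^sup>2 + (\<kappa> * M)\<^sup>2 / (\<kappa> - 1) * (?\<beta>\<^sup>2 * (norm q)\<^sup>2)"
    by (simp add: power_mult_distrib)
  finally show ?thesis .
qed

lemma gradient_part_self_le:
  assumes t: "0 < t" and \<kappa>: "\<kappa> > 1"
  obtains C where "C > 0"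
    "\<And>\<xi> s e q. gradient_part t \<kappa> \<xi> s \<xi> e q \<le> C * ((softexp t s)\<^sup>2 * (norm q)\<^sup>2)"
proof -
  obtain A where A: "A > 0" "\<And>\<xi> p. \<bar>stability_form \<xi> p\<bar> \<le> A * (norm p)\<^sup>2"
    using stability_form_bounded by blast
  obtain M where M: "M > 0" "\<And>\<xi>. norm (Fgrad F \<xi>) \<le> M"
    using Fgrad_bounded by blast
  have "gradient_part t \<kappa> \<xi> s \<xi> e q \<le> (A + (\<kappa> * M)\<^sup>2 / (\<kappa> - 1)) * ((softexp t s)\<^sup>2 * (norm q)\<^sup>2)"
    for \<xi> s e q
  proof -
    have "(softexp t s)\<^sup>2 * stability_form \<xi> q \<le> (softexp t s)\<^sup>2 * (A * (norm q)\<^sup>2)"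
      by (intro mult_left_mono order_trans[OF abs_ge_self A(2)]) simp
    then have "(softexp t s)\<^sup>2 * stability_form \<xi> q \<le> A * ((softexp t s)\<^sup>2 * (norm q)\<^sup>2)"
      by (simp only: mult.left_commute)
    then show ?thesis
      using mixed_term_le[OF t \<kappa> M(2), of s e \<xi> q]
      unfolding gradient_part_self_eq distrib_right[of A] by linarith
  qed
  moreover have "A + (\<kappa> * M)\<^sup>2 / (\<kappa> - 1) > 0"
    using A(1) \<kappa> by (intro add_pos_nonneg) auto
  ultimately show ?thesis using that by blast
qed

end

locale stable_solution = anisotropic_norm F
  for F :: "'a::euclidean_space \<Rightarrow> real" +
  fixes \<alpha> :: real and u :: "'a \<Rightarrow> real" and Du :: "'a \<Rightarrow> 'a"
  assumes weak_solution: "weak_solution F \<alpha> u Du"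
    and stable: "stable F \<alpha> u Du"
begin

definition source :: "'a \<Rightarrow> real" where
  "source x = Fdual F x powr \<alpha> * exp (u x)"

lemma source_nonneg: "0 \<le> source x"
  by (simp add: source_def)

lemma H1loc: "H1loc_grad u Du"
  using weak_solution by (simp add: weak_solution_def)

lemmas u_measurable = H1loc_gradD(1)[OF H1loc]
  and Du_measurable = H1loc_gradD(2)[OF H1loc]
  and locally_integrable_u_square = H1loc_gradD(4)[OF H1loc]
  and locally_integrable_Du_square = H1loc_gradD(5)[OF H1loc]
  and locally_integrable_Du = H1loc_gradD(7)[OF H1loc]
  and locally_integrable_energy = locally_integrable_energy_density[OF H1loc]

lemma locally_integrable_source: "locally_integrable source"
  using weak_solution unfolding weak_solution_def loc_integrable_iff source_def[abs_def] by blast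

lemmas source_measurable = locally_integrable_measurable[OF locally_integrable_source]

lemma weak_equation:
  "test_fun \<psi> \<Longrightarrow> (\<integral>x. flux (Du x) \<bullet> grad \<psi> x \<partial>lborel) = (\<integral>x. source x * \<psi> x \<partial>lborel)"
  using weak_solution unfolding weak_solution_def source_def flux_def by simp

lemma stability_inequality:
  "test_fun \<phi> \<Longrightarrow> 0 \<le> (\<integral>x. stability_form (Du x) (grad \<phi> x) - source x * (\<phi> x)\<^sup>2 \<partial>lborel)"
  using stable unfolding stable_def source_def stability_form_eq_sum by blast

lemma integrable_source_mult: "test_fun \<phi> \<Longrightarrow> integrable lborel (\<lambda>x. source x * \<phi> x)"
  using integrable_test_fun_scaleR[OF _ locally_integrable_source] by (simp add: mult.commute)

lemma integrable_flux_grad: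
  assumes "test_fun \<psi>"
  shows "integrable lborel (\<lambda>x. flux (Du x) \<bullet> grad \<psi> x)"
proof (intro integrable_inner_continuous continuous_on_grad bounded_support_grad test_funD assms)
  obtain M where M: "M > 0" "\<And>\<xi>. norm (flux \<xi>) \<le> M * norm \<xi>"
    using norm_flux_le by blast
  show "locally_integrable (\<lambda>x. flux (Du x))"
  proof (rule locally_integrable_bound)
    show "locally_integrable (\<lambda>x. M * norm (Du x))"
      using Du_measurable
      by (intro locally_integrable_cmult locally_integrable_bound[OF locally_integrable_Du])
          simp_all
    show "(\<lambda>x. flux (Du x)) \<in> borel_measurable borel"
      using measurable_compose[OF Du_measurable flux_measurable] .
    show "norm (flux (Du x)) \<le> norm (M * norm (Du x))" for x
      using M by simp
  qed
qed

lemma integrable_stability_form: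
  assumes "test_fun \<phi>"
  shows "integrable lborel (\<lambda>x. stability_form (Du x) (grad \<phi> x))"
proof (rule integrable_bounded_support)
  obtain C where C: "C > 0" "\<And>\<xi> p. \<bar>stability_form \<xi> p\<bar> \<le> C * (norm p)\<^sup>2"
    using stability_form_bounded by blast
  obtain E where E: "\<And>x. norm (grad \<phi> x) \<le> E"
    using test_fun_bounds[OF assms] by metis
  show "locally_integrable (\<lambda>x. stability_form (Du x) (grad \<phi> x))"
  proof (rule locally_integrable_bound[OF locally_integrable_const[of "C * E\<^sup>2"]])
    show "(\<lambda>x. stability_form (Du x) (grad \<phi> x)) \<in> borel_measurable borel"
      by (intro stability_form_measurable Du_measurable grad_measurable test_funD assms)
    have "\<bar>stability_form (Du x) (grad \<phi> x)\<bar> \<le> C * E\<^sup>2" for x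
      using C(1) E[of x] by (intro order_trans[OF C(2)] mult_left_mono power_mono) auto
    then show "norm (stability_form (Du x) (grad \<phi> x)) \<le> norm (C * E\<^sup>2)" for x
      unfolding real_norm_def by (rule order_trans[OF _ abs_ge_self])
  qed
  show "bounded {x. stability_form (Du x) (grad \<phi> x) \<noteq> 0}"
    by (rule bounded_subset[OF bounded_support_grad[OF assms]]) auto
qed

definition tested_difference ::
  "real \<Rightarrow> real \<Rightarrow> ('a \<Rightarrow> real) \<Rightarrow> ('a \<Rightarrow> real) \<Rightarrow> ('a \<Rightarrow> 'a) \<Rightarrow> 'a \<Rightarrow> real" where
  "tested_difference t \<kappa> \<eta> v p x = gradient_part t \<kappa> (Du x) (v x) (p x) (\<eta> x) (grad \<eta> x)
     - source x * (((softexp t (v x))\<^sup>2 - \<kappa> * softexp_energy t (v x)) * (\<eta> x)\<^sup>2)"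

lemma grad_softexp_mult:
  assumes v: "smooth_fun v" and \<eta>: "smooth_fun \<eta>"
  shows "grad (\<lambda>x. softexp t (v x) * \<eta> x) x
    = (softexp_slope t (v x) * \<eta> x) *\<^sub>R grad v x + softexp t (v x) *\<^sub>R grad \<eta> x"
  unfolding grad_mult[OF smooth_fun_differentiable[OF smooth_fun_compose[OF smooth_fun_softexp v]]
      smooth_fun_differentiable[OF \<eta>]]
    grad_compose[OF has_real_derivative_softexp smooth_fun_differentiable[OF v]]
  by (simp add: mult.commute)

lemma grad_softexp_energy_mult:
  assumes v: "smooth_fun v" and \<eta>: "smooth_fun \<eta>"
  shows "grad (\<lambda>x. softexp_energy t (v x) * (\<eta> x)\<^sup>2) x
    = ((softexp_slope t (v x))\<^sup>2 * (\<eta> x)\<^sup>2) *\<^sub>R grad v x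
      + (softexp_energy t (v x) * (2 * \<eta> x)) *\<^sub>R grad \<eta> x"
  unfolding
    grad_mult[OF smooth_fun_differentiable[OF smooth_fun_compose[OF smooth_fun_softexp_energy v]]
      smooth_fun_differentiable[OF smooth_fun_power[OF \<eta>]]]
    grad_compose[OF has_real_derivative_softexp_energy smooth_fun_differentiable[OF v]]
    grad_power[OF smooth_fun_differentiable[OF \<eta>]]
  by (simp add: mult.commute)

lemma tested_difference_smooth:
  assumes v: "smooth_fun v" and \<eta>: "test_fun \<eta>"
  shows "integrable lborel (tested_difference t \<kappa> \<eta> v (grad v))"
    and "0 \<le> (\<integral>x. tested_difference t \<kappa> \<eta> v (grad v) x \<partial>lborel)"
proof -
  let ?\<phi> = "\<lambda>x. softexp t (v x) * \<eta> x" and ?\<psi> = "\<lambda>x. softexp_energy t (v x) * (\<eta> x)\<^sup>2"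
  have \<eta>2: "test_fun (\<lambda>x. (\<eta> x)\<^sup>2)"
    by (rule test_fun_power[OF \<eta>]) simp
  have \<phi>: "test_fun ?\<phi>" and \<psi>: "test_fun ?\<psi>"
    by (intro test_fun_mult smooth_fun_compose[OF smooth_fun_softexp v]
        smooth_fun_compose[OF smooth_fun_softexp_energy v] \<eta> \<eta>2)+
  have "(\<lambda>x. ?\<phi> x * ?\<phi> x) = (\<lambda>x. (?\<phi> x)\<^sup>2)"
    by (simp add: power2_eq_square)
  note \<phi>2 = test_fun_mult[OF test_funD(1)[OF \<phi>] \<phi>, unfolded this]
  have stability_int:
    "integrable lborel (\<lambda>x. stability_form (Du x) (grad ?\<phi> x) - source x * (?\<phi> x)\<^sup>2)"
    by (intro Bochner_Integration.integrable_diff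
        integrable_stability_form integrable_source_mult \<phi> \<phi>2)
  have equation_int: "integrable lborel (\<lambda>x. \<kappa> * (flux (Du x) \<bullet> grad ?\<psi> x - source x * ?\<psi> x))"
    by (intro integrable_mult_right Bochner_Integration.integrable_diff integrable_flux_grad
        integrable_source_mult \<psi>)
  have tested_eq: "tested_difference t \<kappa> \<eta> v (grad v) x
      = (stability_form (Du x) (grad ?\<phi> x) - source x * (?\<phi> x)\<^sup>2)
      - \<kappa> * (flux (Du x) \<bullet> grad ?\<psi> x - source x * ?\<psi> x)" for x
    unfolding tested_difference_def gradient_part_def grad_softexp_mult[OF v test_funD(1)[OF \<eta>]]
      grad_softexp_energy_mult[OF v test_funD(1)[OF \<eta>]]
    by (simp add: algebra_simps)
  show "integrable lborel (tested_difference t \<kappa> \<eta> v (grad v))"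
    unfolding tested_eq[abs_def]
    by (rule Bochner_Integration.integrable_diff[OF stability_int equation_int])
  have "(\<integral>x. flux (Du x) \<bullet> grad ?\<psi> x - source x * ?\<psi> x \<partial>lborel) = 0"
    using weak_equation[OF \<psi>]
    by (simp add: Bochner_Integration.integral_diff[OF
        integrable_flux_grad[OF \<psi>] integrable_source_mult[OF \<psi>]])
  then show "0 \<le> (\<integral>x. tested_difference t \<kappa> \<eta> v (grad v) x \<partial>lborel)"
    unfolding tested_eq Bochner_Integration.integral_diff[OF stability_int equation_int]
    using stability_inequality[OF \<phi>] by simp
qed

lemma tested_difference_eq_0:
  "\<eta> x = 0 \<Longrightarrow> grad \<eta> x = 0 \<Longrightarrow> tested_difference t \<kappa> \<eta> v p x = 0"
  by (simp add: tested_difference_def gradient_part_0)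

lemma tested_difference_measurable:
  assumes "test_fun \<eta>" and [measurable]: "v \<in> borel_measurable borel" "p \<in> borel_measurable borel"
  shows "tested_difference t \<kappa> \<eta> v p \<in> borel_measurable borel"
proof -
  note [measurable] = source_measurable Du_measurable
    smooth_fun_measurable[OF test_funD(1)[OF assms(1)]]
    grad_measurable[OF test_funD(1)[OF assms(1)]]
  have "(\<lambda>x. gradient_part t \<kappa> (Du x) (v x) (p x) (\<eta> x) (grad \<eta> x)) \<in> borel_measurable borel"
    by (rule gradient_part_measurable) measurable
  then show ?thesis
    unfolding tested_difference_def[abs_def] by measurable
qed

lemma tested_difference_tendsto:
  assumes "(\<lambda>n. v n x) \<longlonglongrightarrow> v0 x" "(\<lambda>n. p n x) \<longlonglongrightarrow> p0 x"
  shows "(\<lambda>n. tested_difference t \<kappa> \<eta> (v n) (p n) x) \<longlonglongrightarrow> tested_difference t \<kappa> \<eta> v0 p0 x"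
  unfolding tested_difference_def
  by (intro tendsto_intros gradient_part_tendsto softexp_tendsto softexp_energy_tendsto assms)

lemma tested_difference_le_gradient_part:
  assumes "t > 0" "\<kappa> \<ge> 0" "\<kappa> * t \<le> 2"
  shows "tested_difference t \<kappa> \<eta> v p x \<le> gradient_part t \<kappa> (Du x) (v x) (p x) (\<eta> x) (grad \<eta> x)"
proof -
  have "0 \<le> (1 - \<kappa> * t / 2) * (softexp t (v x))\<^sup>2"
    using assms(3) by simp
  then have "0 \<le> (softexp t (v x))\<^sup>2 - \<kappa> * softexp_energy t (v x)"
    using softexp_square_minus_energy_ge[OF assms(1,2)] by (rule order_trans)
  then have "0 \<le> source x * (((softexp t (v x))\<^sup>2 - \<kappa> * softexp_energy t (v x)) * (\<eta> x)\<^sup>2)"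
    by (intro mult_nonneg_nonneg source_nonneg) auto
  then show ?thesis
    unfolding tested_difference_def by linarith
qed

definition majorant :: "real \<Rightarrow> 'a set \<Rightarrow> ('a \<Rightarrow> real) \<Rightarrow> 'a \<Rightarrow> real" where
  "majorant C K f x = indicator K x * (C * (1 + f x + (norm (Du x))\<^sup>2))"

lemma integrable_majorant:
  assumes K: "compact K" and f: "set_integrable lborel K f"
  shows "integrable lborel (majorant C K f)"
    and "(\<integral>x. majorant C K f x \<partial>lborel)
      = C * ((LINT x:K|lborel. 1) + (LINT x:K|lborel. f x) + (LINT x:K|lborel. (norm (Du x))\<^sup>2))"
proof -
  note one = locally_integrableD[OF locally_integrable_const[of "1::real"] K]
    and Du = locally_integrableD[OF locally_integrable_Du_square K]
  note sum = set_integral_add[OF set_integral_add(1)[OF one f] Du]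
  have "set_integrable lborel K (\<lambda>x. C * (1 + f x + (norm (Du x))\<^sup>2))"
    using sum(1) by (rule set_integrable_mult_right)
  then show "integrable lborel (majorant C K f)"
    by (simp add: majorant_def[abs_def] set_integrable_def)
  have "(\<integral>x. majorant C K f x \<partial>lborel) = (LINT x:K|lborel. C * (1 + f x + (norm (Du x))\<^sup>2))"
    unfolding majorant_def set_lebesgue_integral_def real_scaleR_def ..
  also have "\<dots> = C * (LINT x:K|lborel. 1 + f x + (norm (Du x))\<^sup>2)"
    by (rule set_integral_mult_right)
  finally show "(\<integral>x. majorant C K f x \<partial>lborel)
      = C * ((LINT x:K|lborel. 1) + (LINT x:K|lborel. f x) + (LINT x:K|lborel. (norm (Du x))\<^sup>2))"
    unfolding sum(2) set_integral_add(2)[OF one f] .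
qed

lemma gradient_part_le_majorant:
  assumes t: "t > 0" and \<eta>: "test_fun \<eta>"
  obtains C R where "C \<ge> 0" "\<And>x. x \<notin> cball 0 R \<Longrightarrow> \<eta> x = 0 \<and> grad \<eta> x = 0"
    "\<And>v p x. \<bar>gradient_part t \<kappa> (Du x) (v x) (p x) (\<eta> x) (grad \<eta> x)\<bar>
      \<le> majorant C (cball 0 R) (energy_density v p) x"
proof -
  obtain R E where support: "\<And>x. x \<notin> cball 0 R \<Longrightarrow> \<eta> x = 0 \<and> grad \<eta> x = 0"
    and E: "\<And>x. \<bar>\<eta> x\<bar> \<le> E" "\<And>x. norm (grad \<eta> x) \<le> E"
    using test_fun_bounds[OF \<eta>] by metis
  obtain C where C: "C \<ge> 0" "\<And>\<xi> s p e q. \<bar>e\<bar> \<le> E \<Longrightarrow> norm q \<le> E \<Longrightarrow>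
      \<bar>gradient_part t \<kappa> \<xi> s p e q\<bar> \<le> C * (1 + (s\<^sup>2 + (norm p)\<^sup>2) + (norm \<xi>)\<^sup>2)"
    using gradient_part_growth[OF t, of E \<kappa>] by blast
  have "\<bar>gradient_part t \<kappa> (Du x) (v x) (p x) (\<eta> x) (grad \<eta> x)\<bar>
      \<le> majorant C (cball 0 R) (energy_density v p) x" for v p x
  proof (cases "x \<in> cball 0 R")
    case True
    then show ?thesis
      using C(2)[OF E, where \<xi>="Du x" and s="v x" and p="p x"]
      by (simp add: majorant_def energy_density_def)
  next
    case False
    then show ?thesis
      using support[of x] by (simp add: gradient_part_0 majorant_def)
  qed
  with C(1) support show ?thesis
    using that by blast
qed

lemma integrable_gradient_part:
  assumes t: "t > 0" and \<eta>: "test_fun \<eta>"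
  shows "integrable lborel (\<lambda>x. gradient_part t \<kappa> (Du x) (u x) (Du x) (\<eta> x) (grad \<eta> x))"
proof -
  let ?f = "\<lambda>x. gradient_part t \<kappa> (Du x) (u x) (Du x) (\<eta> x) (grad \<eta> x)"
  obtain C R where bound: "\<And>v p x. \<bar>gradient_part t \<kappa> (Du x) (v x) (p x) (\<eta> x) (grad \<eta> x)\<bar>
      \<le> majorant C (cball 0 R) (energy_density v p) x"
    by (rule gradient_part_le_majorant[OF assms, of \<kappa>]) (rule that; assumption)
  have measurable: "?f \<in> borel_measurable lborel"
    using gradient_part_measurable[OF Du_measurable u_measurable Du_measurable
        smooth_fun_measurable[OF test_funD(1)[OF \<eta>]] grad_measurable[OF test_funD(1)[OF \<eta>]]] by simp
  have "integrable lborel (majorant C (cball 0 R) (energy_density u Du))"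
    by (intro integrable_majorant(1) compact_cball
        locally_integrableD[OF locally_integrable_energy])
  moreover have "AE x in lborel. norm (?f x)
      \<le> norm (majorant C (cball 0 R) (energy_density u Du) x)"
    using order_trans[OF bound abs_ge_self] by (intro AE_I2) simp
  ultimately show ?thesis
    by (rule Bochner_Integration.integrable_bound[OF _ measurable])
qed

lemma tested_difference_le_majorant:
  assumes t\<kappa>: "t > 0" "\<kappa> \<ge> 0" "\<kappa> * t \<le> 2" and \<eta>: "test_fun \<eta>"
  obtains C R where "\<And>x. x \<notin> cball 0 R \<Longrightarrow> \<eta> x = 0 \<and> grad \<eta> x = 0"
    "\<And>v p w x. energy_density v p x \<le> w x \<Longrightarrow>
      tested_difference t \<kappa> \<eta> v p x \<le> majorant C (cball 0 R) w x"
proof -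
  obtain C R where C: "C \<ge> 0" and support: "\<And>x. x \<notin> cball 0 R \<Longrightarrow> \<eta> x = 0 \<and> grad \<eta> x = 0"
    and bound: "\<And>v p x. \<bar>gradient_part t \<kappa> (Du x) (v x) (p x) (\<eta> x) (grad \<eta> x)\<bar>
      \<le> majorant C (cball 0 R) (energy_density v p) x"
    by (rule gradient_part_le_majorant[OF t\<kappa>(1) \<eta>, of \<kappa>]) (rule that; assumption)
  have "tested_difference t \<kappa> \<eta> v p x \<le> majorant C (cball 0 R) w x"
    if w: "energy_density v p x \<le> w x" for v p w x
  proof -
    have "tested_difference t \<kappa> \<eta> v p x \<le> majorant C (cball 0 R) (energy_density v p) x"
      using tested_difference_le_gradient_part[OF t\<kappa>] order_trans[OF abs_ge_self bound]
      by (rule order_trans)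
    also have "\<dots> \<le> majorant C (cball 0 R) w x"
      unfolding majorant_def using C w by (intro mult_left_mono) auto
    finally show ?thesis .
  qed
  with support show ?thesis by (rule that)
qed

text \<open>Mollify \<open>u\<close> and pass to the limit; the terms without a dominating sequence enter with a
  favourable sign.\<close>
lemma tested_difference_solution:
  assumes t\<kappa>: "t > 0" "\<kappa> \<ge> 0" "\<kappa> * t \<le> 2" and \<eta>: "test_fun \<eta>"
  shows "integrable lborel (tested_difference t \<kappa> \<eta> u Du)"
    and "0 \<le> (\<integral>x. tested_difference t \<kappa> \<eta> u Du x \<partial>lborel)"
proof -
  obtain C R where support: "\<And>x. x \<notin> cball 0 R \<Longrightarrow> \<eta> x = 0 \<and> grad \<eta> x = 0"
    and bound: "\<And>v p w x. energy_density v p x \<le> w x \<Longrightarrow>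
      tested_difference t \<kappa> \<eta> v p x \<le> majorant C (cball 0 R) w x"
    by (rule tested_difference_le_majorant[OF t\<kappa> \<eta>]) (rule that; assumption)
  let ?K = "cball 0 R :: 'a set"
  obtain v w where v: "\<And>n::nat. smooth_fun (v n)"
    and w: "\<And>n x. energy_density (v n) (grad (v n)) x \<le> w n x" "\<And>n. set_integrable lborel ?K (w n)"
    and w_lim: "(\<lambda>n. LINT x:?K|lborel. w n x) \<longlonglongrightarrow> (LINT x:?K|lborel. energy_density u Du x)"
    and lim: "AE x\<in>?K in lborel. (\<lambda>n. v n x) \<longlonglongrightarrow> u x \<and> (\<lambda>n. grad (v n) x) \<longlonglongrightarrow> Du x
       \<and> (\<lambda>n. w n x) \<longlonglongrightarrow> energy_density u Du x"
    by (rule H1loc_smooth_approximation[OF H1loc, of R]) (rule that; assumption)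
  note maj = integrable_majorant[OF compact_cball w(2)]
    and maj_limit = integrable_majorant[OF compact_cball
      locally_integrableD[OF locally_integrable_energy compact_cball]]
  have limit: "AE x in lborel.
      (\<lambda>n. tested_difference t \<kappa> \<eta> (v n) (grad (v n)) x) \<longlonglongrightarrow> tested_difference t \<kappa> \<eta> u Du x
      \<and> (\<lambda>n. majorant C ?K (w n) x) \<longlonglongrightarrow> majorant C ?K (energy_density u Du) x"
    using lim
  proof eventually_elim
    case (elim x)
    show ?case
    proof (cases "x \<in> ?K")
      case True
      with elim have "(\<lambda>n. v n x) \<longlonglongrightarrow> u x" "(\<lambda>n. grad (v n) x) \<longlonglongrightarrow> Du x"
        "(\<lambda>n. w n x) \<longlonglongrightarrow> energy_density u Du x"
        by blast+
      then show ?thesis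
        unfolding majorant_def by (intro conjI tested_difference_tendsto tendsto_intros)
    qed (simp add: majorant_def support tested_difference_eq_0)
  qed
  have maj_lim: "(\<lambda>n. \<integral>x. majorant C ?K (w n) x \<partial>lborel)
      \<longlonglongrightarrow> (\<integral>x. majorant C ?K (energy_density u Du) x \<partial>lborel)"
    unfolding maj(2) maj_limit(2) by (intro tendsto_intros w_lim)
  have meas: "tested_difference t \<kappa> \<eta> u Du \<in> borel_measurable lborel"
    using tested_difference_measurable[OF \<eta> u_measurable Du_measurable] by simp
  have dominated: "tested_difference t \<kappa> \<eta> (v n) (grad (v n)) x \<le> majorant C ?K (w n) x" for n x
    by (rule bound, rule w(1))
  note fatou = integrable_reverse_fatou[OF tested_difference_smooth[OF v \<eta>] maj(1) dominated
      maj_limit(1) maj_lim limit meas]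
  show "integrable lborel (tested_difference t \<kappa> \<eta> u Du)" by (rule fatou(1))
  show "0 \<le> (\<integral>x. tested_difference t \<kappa> \<eta> u Du x \<partial>lborel)" by (rule fatou(2))
qed

lemma integrable_softexp_square_mult:
  assumes t: "t > 0" and k: "continuous_on UNIV k" "bounded {x. k x \<noteq> 0}"
  shows "integrable lborel (\<lambda>x. (softexp t (u x))\<^sup>2 * k x)"
proof -
  have "locally_integrable (\<lambda>x. (softexp t (u x))\<^sup>2)"
  proof (rule locally_integrable_bound)
    show "locally_integrable (\<lambda>x. 2 * (1 + t\<^sup>2 * (norm (u x))\<^sup>2))"
      by (intro locally_integrable_cmult locally_integrable_add locally_integrable_const
          locally_integrable_u_square)
    show "(\<lambda>x. (softexp t (u x))\<^sup>2) \<in> borel_measurable borel"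
      using measurable_compose[OF u_measurable smooth_fun_measurable[OF smooth_fun_softexp]]
      by (rule borel_measurable_power)
    show "norm ((softexp t (u x))\<^sup>2) \<le> norm (2 * (1 + t\<^sup>2 * (norm (u x))\<^sup>2))" for x
    proof -
      have "(softexp t (u x))\<^sup>2 \<le> (1 + \<bar>t * u x\<bar>)\<^sup>2"
        using softexp_pos[of t "u x"] softexp_le_linear by (intro power_mono) auto
      also have "\<dots> \<le> 2 * (1 + (t * u x)\<^sup>2)"
        using sum_squares_bound[of 1 "\<bar>t * u x\<bar>"] by (simp add: power2_sum)
      finally show ?thesis
        by (simp add: power_mult_distrib)
    qed
  qed
  from integrable_continuous_scaleR[OF k this] show ?thesis
    by (simp add: mult.commute)
qed

definition weighted_source :: "real \<Rightarrow> 'a \<Rightarrow> real" where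
  "weighted_source t x = source x * (softexp t (u x))\<^sup>2"

lemma weighted_source_nonneg: "0 \<le> weighted_source t x"
  by (simp add: weighted_source_def source_nonneg)

lemma weighted_source_measurable: "weighted_source t \<in> borel_measurable borel"
proof -
  note [measurable] = source_measurable u_measurable
  show ?thesis unfolding weighted_source_def[abs_def] by measurable
qed

lemma source_term_le_gradient_part:
  assumes t\<kappa>: "t > 0" "\<kappa> \<ge> 0" "\<kappa> * t < 2" and \<eta>: "test_fun \<eta>"
  shows "integrable lborel (\<lambda>x. weighted_source t x * (\<eta> x)\<^sup>2)"
    and "(1 - \<kappa> * t / 2) * (\<integral>x. weighted_source t x * (\<eta> x)\<^sup>2 \<partial>lborel)
      \<le> (\<integral>x. gradient_part t \<kappa> (Du x) (u x) (Du x) (\<eta> x) (grad \<eta> x) \<partial>lborel)"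
proof -
  let ?c = "1 - \<kappa> * t / 2" and ?S = "\<lambda>x. weighted_source t x * (\<eta> x)\<^sup>2"
  define G where "G x = gradient_part t \<kappa> (Du x) (u x) (Du x) (\<eta> x) (grad \<eta> x)" for x
  define D where "D x = G x - tested_difference t \<kappa> \<eta> u Du x" for x
  have c: "?c > 0" using t\<kappa>(3) by simp
  note tested = tested_difference_solution[OF t\<kappa>(1,2) less_imp_le[OF t\<kappa>(3)] \<eta>]
  have G: "integrable lborel G"
    unfolding G_def[abs_def] by (rule integrable_gradient_part[OF t\<kappa>(1) \<eta>])
  have D: "integrable lborel D"
    unfolding D_def[abs_def] by (rule Bochner_Integration.integrable_diff[OF G tested(1)])
  have source_le: "?c * ?S x \<le> D x" for x
    using mult_left_mono[OF mult_right_mono[OF softexp_square_minus_energy_ge[OF t\<kappa>(1,2), of "u x"], of "(\<eta> x)\<^sup>2"]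
        source_nonneg, of x]
    by (simp add: D_def G_def tested_difference_def weighted_source_def mult_ac)
  have source_int: "integrable lborel (\<lambda>x. ?c * ?S x)"
  proof (rule Bochner_Integration.integrable_bound[OF D])
    note [measurable] = weighted_source_measurable smooth_fun_measurable[OF test_funD(1)[OF \<eta>]]
    show "(\<lambda>x. ?c * ?S x) \<in> borel_measurable lborel" by measurable
    have "0 \<le> ?c * ?S x" for x
      using c weighted_source_nonneg by simp
    then have "norm (?c * ?S x) \<le> norm (D x)" for x
      using source_le[of x] unfolding real_norm_def by (metis abs_of_nonneg order_trans)
    then show "AE x in lborel. norm (?c * ?S x) \<le> norm (D x)"
      by (intro AE_I2)
  qed
  then show "integrable lborel ?S"
    using c by simp
  have "?c * (\<integral>x. ?S x \<partial>lborel) \<le> (\<integral>x. D x \<partial>lborel)"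
    unfolding integral_mult_right_zero[symmetric] by (intro integral_mono source_int D source_le)
  also have "\<dots> \<le> (\<integral>x. G x \<partial>lborel)"
    unfolding D_def Bochner_Integration.integral_diff[OF G tested(1)] using tested(2) by simp
  finally show "?c * (\<integral>x. ?S x \<partial>lborel)
      \<le> (\<integral>x. gradient_part t \<kappa> (Du x) (u x) (Du x) (\<eta> x) (grad \<eta> x) \<partial>lborel)"
    unfolding G_def .
qed

lemma energy_estimate:
  assumes t: "0 < t" "t < 2"
  obtains C where "C > 0"
    "\<And>\<eta>. test_fun \<eta> \<Longrightarrow> integrable lborel (\<lambda>x. (softexp t (u x))\<^sup>2 * (norm (grad \<eta> x))\<^sup>2)"
    "\<And>\<eta>. test_fun \<eta> \<Longrightarrow> integrable lborel (\<lambda>x. weighted_source t x * (\<eta> x)\<^sup>2)"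
    "\<And>\<eta>. test_fun \<eta> \<Longrightarrow> (\<integral>x. weighted_source t x * (\<eta> x)\<^sup>2 \<partial>lborel)
       \<le> C * (\<integral>x. (softexp t (u x))\<^sup>2 * (norm (grad \<eta> x))\<^sup>2 \<partial>lborel)"
proof -
  define \<kappa> where "\<kappa> = (2 + t) / (2 * t)"
  define c where "c = 1 - \<kappa> * t / 2"
  have \<kappa>: "\<kappa> > 1" "\<kappa> \<ge> 0" "\<kappa> * t < 2" and c: "c > 0"
    using t by (auto simp: \<kappa>_def c_def field_simps)
  obtain C where C: "C > 0"
    "\<And>\<xi> s e q. gradient_part t \<kappa> \<xi> s \<xi> e q \<le> C * ((softexp t s)\<^sup>2 * (norm q)\<^sup>2)"
    using gradient_part_self_le[OF t(1) \<kappa>(1)] by blast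
  have int: "integrable lborel (\<lambda>x. (softexp t (u x))\<^sup>2 * (norm (grad \<eta> x))\<^sup>2)" if "test_fun \<eta>" for \<eta>
    using bounded_support_grad[OF that]
    by (intro integrable_softexp_square_mult t(1) continuous_intros
        continuous_on_grad test_funD(1) that) simp
  have "c * (\<integral>x. weighted_source t x * (\<eta> x)\<^sup>2 \<partial>lborel)
      \<le> C * (\<integral>x. (softexp t (u x))\<^sup>2 * (norm (grad \<eta> x))\<^sup>2 \<partial>lborel)" if \<eta>: "test_fun \<eta>" for \<eta>
  proof -
    have "(\<integral>x. gradient_part t \<kappa> (Du x) (u x) (Du x) (\<eta> x) (grad \<eta> x) \<partial>lborel)
        \<le> (\<integral>x. C * ((softexp t (u x))\<^sup>2 * (norm (grad \<eta> x))\<^sup>2) \<partial>lborel)"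
      by (intro integral_mono integrable_gradient_part integrable_mult_right int t(1) \<eta> C(2))
    then show ?thesis
      using source_term_le_gradient_part(2)[OF t(1) \<kappa>(2,3) \<eta>] by (simp add: c_def)
  qed
  then have "(\<integral>x. weighted_source t x * (\<eta> x)\<^sup>2 \<partial>lborel)
      \<le> C / c * (\<integral>x. (softexp t (u x))\<^sup>2 * (norm (grad \<eta> x))\<^sup>2 \<partial>lborel)" if "test_fun \<eta>" for \<eta>
    using that c by (simp add: pos_le_divide_eq mult.commute)
  moreover have "C / c > 0"
    using C(1) c by simp
  ultimately show ?thesis
    using that int source_term_le_gradient_part(1)[OF t(1) \<kappa>(2,3)] by blast
qed

end

section \<open>The cutoff argument\<close>

lemma square_mult_power_le_powr:
  fixes b s t z :: real
  assumes z: "0 \<le> z" "z \<le> 1" and t: "0 < t" "2 * t \<le> real n" and b: "0 < b" "b \<le> exp (t * s)"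
  shows "b\<^sup>2 * z ^ (2 * n) \<le> (exp s * z\<^sup>2) powr (2 * t)"
proof (cases "z = 0")
  case False
  then have z_pos: "z > 0" using z by simp
  have "z powr real (2 * n) \<le> z powr (4 * t)"
    using z_pos z t by (intro powr_mono') auto
  then have "z ^ (2 * n) \<le> z powr (4 * t)"
    using z_pos by (simp add: powr_realpow[symmetric])
  moreover have "b\<^sup>2 \<le> (exp (t * s))\<^sup>2"
    using b by (intro power_mono) auto
  ultimately have "b\<^sup>2 * z ^ (2 * n) \<le> (exp (t * s))\<^sup>2 * z powr (4 * t)"
    using z by (intro mult_mono) auto
  also have "\<dots> = exp s powr (2 * t) * (z powr 2) powr (2 * t)"
    by (simp add: powr_def powr_powr exp_double[symmetric] mult_ac)
  also have "\<dots> = (exp s * z\<^sup>2) powr (2 * t)"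
    using z_pos by (simp add: powr_mult)
  finally show ?thesis .
qed (use t in \<open>auto simp: power_0_left\<close>)

text \<open>A substitute for Young's inequality: either \<open>L\<close> is absorbed by the exponential nonlinearity, or
  \<open>exp s\<close> is itself controlled by \<open>L / f\<close>.\<close>
lemma absorb_or_control:
  fixes b f s t z L :: real
  assumes L: "0 \<le> L" and f: "f > 0" and z: "0 \<le> z" "z \<le> 1" and t: "0 < t" "2 * t \<le> real n"
    and b: "0 < b" "b \<le> exp (t * s)"
  shows "L * (b\<^sup>2 * z ^ (2 * n))
    \<le> 1 / 2 * (f * exp s * b\<^sup>2 * z ^ (2 * Suc n)) + L * (2 * L / f) powr (2 * t)"
proof (cases "2 * L \<le> f * exp s * z\<^sup>2")
  case True
  have "L * (b\<^sup>2 * z ^ (2 * n)) = 1 / 2 * (b\<^sup>2 * z ^ (2 * n) * (2 * L))" by simp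
  also have "\<dots> \<le> 1 / 2 * (b\<^sup>2 * z ^ (2 * n) * (f * exp s * z\<^sup>2))"
    using True z by (intro mult_left_mono) auto
  also have "\<dots> = 1 / 2 * (f * exp s * b\<^sup>2 * z ^ (2 * Suc n))"
    by (simp add: power2_eq_square mult_ac)
  finally show ?thesis
    using f L by (intro order_trans[OF _ le_add_same_cancel1[THEN iffD2]]) auto
next
  case False
  then have "exp s * z\<^sup>2 \<le> 2 * L / f"
    using f by (simp add: field_simps)
  then have "(exp s * z\<^sup>2) powr (2 * t) \<le> (2 * L / f) powr (2 * t)"
    using t by (intro powr_mono2) auto
  with square_mult_power_le_powr[OF z t b] have "b\<^sup>2 * z ^ (2 * n) \<le> (2 * L / f) powr (2 * t)"
    by (rule order_trans)
  then have "L * (b\<^sup>2 * z ^ (2 * n)) \<le> L * (2 * L / f) powr (2 * t)"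
    using L by (rule mult_left_mono)
  moreover have "0 \<le> 1 / 2 * (f * exp s * b\<^sup>2 * z ^ (2 * Suc n))"
    using f z by simp
  ultimately show ?thesis by linarith
qed

lemma powr_le_add_powr_endpoints:
  fixes a b x p :: real
  assumes "0 < a" "a \<le> x" "x \<le> b"
  shows "x powr p \<le> a powr p + b powr p"
proof (cases "p \<ge> 0")
  case True
  then have "x powr p \<le> b powr p"
    using assms by (intro powr_mono2) auto
  then show ?thesis by (rule add_increasing[OF powr_ge_zero])
next
  case False
  then have "x powr p \<le> a powr p"
    using assms by (intro powr_mono2') auto
  then show ?thesis by (rule add_increasing2[OF powr_ge_zero])
qed

lemma set_integral_pos:
  fixes f :: "'a \<Rightarrow> real"
  assumes f: "set_integrable M A f" and A: "A \<in> sets M" "A \<notin> null_sets M"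
    and pos: "AE x in M. 0 < f x" and nonneg: "\<And>x. 0 \<le> f x"
  shows "0 < (LINT x:A|M. f x)"
proof -
  have "(LINT x:A|M. f x) \<noteq> 0"
  proof
    assume "(LINT x:A|M. f x) = 0"
    then have "AE x in M. indicator A x *\<^sub>R f x = 0"
      using integral_nonneg_eq_0_iff_AE[OF f[unfolded set_integrable_def]] nonneg
      unfolding set_lebesgue_integral_def by simp
    then have "AE x in M. x \<notin> A"
      using pos by eventually_elim (auto simp: indicator_def split: if_splits)
    then show False
      using A AE_iff_null_sets[OF A(1)] by simp
  qed
  moreover have "0 \<le> (LINT x:A|M. f x)"
    unfolding set_lebesgue_integral_def using nonneg
    by (intro Bochner_Integration.integral_nonneg) simp
  ultimately show ?thesis by simp
qed

lemma (in anisotropic_norm) Fdual_powr_annulus_le: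
  obtains k where "k > 0"
    "\<And>R x. R > 0 \<Longrightarrow> R \<le> norm x \<Longrightarrow> norm x \<le> 2 * R \<Longrightarrow> Fdual F x powr p \<le> k * R powr p"
proof -
  obtain c d where cd: "c > 0" "d > 0" "\<And>x. c * norm x \<le> Fdual F x" "\<And>x. Fdual F x \<le> d * norm x"
    using Fdual_bounds by metis
  have "Fdual F x powr p \<le> (c powr p + (2 * d) powr p) * R powr p"
    if "R > 0" "R \<le> norm x" "norm x \<le> 2 * R" for R x
  proof -
    have "Fdual F x powr p \<le> (c * R) powr p + (2 * d * R) powr p"
    proof (rule powr_le_add_powr_endpoints)
      show "c * R \<le> Fdual F x"
        using order_trans[OF mult_left_mono[OF that(2) less_imp_le[OF cd(1)]] cd(3)] .
      show "Fdual F x \<le> 2 * d * R"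
        using order_trans[OF cd(4)[of x] mult_left_mono[OF that(3), of d]] cd(2) by simp
    qed (use cd(1) that(1) in simp)
    also have "\<dots> = (c powr p + (2 * d) powr p) * R powr p"
      using cd that(1) by (simp add: powr_mult distrib_right)
    finally show ?thesis .
  qed
  moreover have "c powr p + (2 * d) powr p > 0"
    using cd by (intro add_pos_pos) auto
  ultimately show ?thesis using that by blast
qed

lemma (in anisotropic_norm) annulus_tail_le:
  assumes D: "D > 0" and t: "t > 0"
  obtains Q where "Q \<ge> 0" "\<And>R x. R > 0 \<Longrightarrow> R \<le> norm x \<Longrightarrow> norm x \<le> 2 * R \<Longrightarrow>
    D / R\<^sup>2 * (2 * (D / R\<^sup>2) / Fdual F x powr \<alpha>) powr (2 * t) \<le> Q * R powr (- 2 - 2 * t * (2 + \<alpha>))"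
proof -
  obtain k where k: "k > 0"
    "\<And>R x. R > 0 \<Longrightarrow> R \<le> norm x \<Longrightarrow> norm x \<le> 2 * R \<Longrightarrow> Fdual F x powr (- \<alpha>) \<le> k * R powr (- \<alpha>)"
    using Fdual_powr_annulus_le by blast
  define Q where "Q = D * (2 * D * k) powr (2 * t)"
  have "D / R\<^sup>2 * (2 * (D / R\<^sup>2) / Fdual F x powr \<alpha>) powr (2 * t)
      \<le> Q * R powr (- 2 - 2 * t * (2 + \<alpha>))"
    if R: "R > 0" "R \<le> norm x" "norm x \<le> 2 * R" for R x
  proof -
    have scale: "D / R\<^sup>2 = D * R powr (- 2)"
      using R(1) by (simp add: powr_minus_divide)
    have "2 * (D / R\<^sup>2) / Fdual F x powr \<alpha> = 2 * (D / R\<^sup>2) * Fdual F x powr (- \<alpha>)"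
      by (simp add: powr_minus_divide)
    also have "\<dots> \<le> 2 * (D / R\<^sup>2) * (k * R powr (- \<alpha>))"
      using k(2)[OF R] D by (intro mult_left_mono) auto
    also have "\<dots> = 2 * D * k * R powr (- (2 + \<alpha>))"
      unfolding scale by (simp add: powr_add[symmetric])
    finally have "(2 * (D / R\<^sup>2) / Fdual F x powr \<alpha>) powr (2 * t)
        \<le> (2 * D * k * R powr (- (2 + \<alpha>))) powr (2 * t)"
      using t D by (intro powr_mono2) auto
    also have "\<dots> = (2 * D * k) powr (2 * t) * R powr (- (2 + \<alpha>) * (2 * t))"
      using D k(1) by (simp add: powr_mult powr_powr)
    finally have "D / R\<^sup>2 * (2 * (D / R\<^sup>2) / Fdual F x powr \<alpha>) powr (2 * t)
        \<le> D / R\<^sup>2 * ((2 * D * k) powr (2 * t) * R powr (- (2 + \<alpha>) * (2 * t)))"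
      using D by (intro mult_left_mono) auto
    also have "\<dots> = Q * (R powr (- 2) * R powr (- (2 + \<alpha>) * (2 * t)))"
      unfolding scale by (simp add: Q_def)
    also have "R powr (- 2) * R powr (- (2 + \<alpha>) * (2 * t)) = R powr (- 2 - 2 * t * (2 + \<alpha>))"
      unfolding powr_add[symmetric] by (simp add: algebra_simps)
    finally show ?thesis .
  qed
  moreover have "Q \<ge> 0"
    using D by (simp add: Q_def)
  ultimately show ?thesis using that by blast
qed

lemma
  fixes x :: "'a::euclidean_space"
  assumes R: "R > 0"
  shows norm_grad_cutoff_power_le: "(norm (grad (\<lambda>x. cutoff R x ^ Suc n) x))\<^sup>2
      \<le> (real (Suc n) * (32 * exp 1))\<^sup>2 / R\<^sup>2 * cutoff R x ^ (2 * n)"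
    and grad_cutoff_power_eq_0:
      "norm x < R \<or> 2 * R < norm x \<Longrightarrow> grad (\<lambda>x. cutoff R x ^ Suc n) x = 0"
proof -
  have power: "grad (\<lambda>x. cutoff R x ^ Suc n) x = (real (Suc n) * cutoff R x ^ n) *\<^sub>R grad (cutoff R) x"
    using grad_power[OF smooth_fun_differentiable[OF test_funD(1)[OF test_fun_cutoff[OF R]]],
      where n="Suc n"] by simp
  then show "norm x < R \<or> 2 * R < norm x \<Longrightarrow> grad (\<lambda>x. cutoff R x ^ Suc n) x = 0"
    using grad_cutoff_eq_0[OF R, of x] by simp
  have "(norm (grad (\<lambda>x. cutoff R x ^ Suc n) x))\<^sup>2
      = (real (Suc n))\<^sup>2 * cutoff R x ^ (2 * n) * (norm (grad (cutoff R) x))\<^sup>2"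
    unfolding power by (simp add: power_mult_distrib power_mult[symmetric] mult.commute)
  also have "\<dots> \<le> (real (Suc n))\<^sup>2 * cutoff R x ^ (2 * n) * (32 * exp 1 / R)\<^sup>2"
    using cutoff_nonneg[of R x] by (intro mult_left_mono power_mono norm_grad_cutoff_le R) auto
  also have "\<dots> = (real (Suc n) * (32 * exp 1))\<^sup>2 / R\<^sup>2 * cutoff R x ^ (2 * n)"
    by (simp only: power_divide power_mult_distrib times_divide_eq_right times_divide_eq_left mult_ac)
  finally show "(norm (grad (\<lambda>x. cutoff R x ^ Suc n) x))\<^sup>2
      \<le> (real (Suc n) * (32 * exp 1))\<^sup>2 / R\<^sup>2 * cutoff R x ^ (2 * n)" .
qed

context stable_solution
begin

lemma cutoff_gradient_absorption:
  assumes t: "0 < t" "2 * t \<le> real n" and C: "C > 0"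
  obtains Q where "\<And>R x. R > 0 \<Longrightarrow>
    C * ((softexp t (u x))\<^sup>2 * (norm (grad (\<lambda>x. cutoff R x ^ Suc n) x))\<^sup>2)
      \<le> 1 / 2 * (weighted_source t x * cutoff R x ^ (2 * Suc n))
        + Q * R powr (- 2 - 2 * t * (2 + \<alpha>)) * indicator (cball 0 (2 * R)) x"
proof -
  define D where "D = C * (real (Suc n) * (32 * exp 1))\<^sup>2"
  have D: "D > 0" using C by (simp add: D_def)
  obtain Q where Q: "Q \<ge> 0" "\<And>R x. R > 0 \<Longrightarrow> R \<le> norm x \<Longrightarrow> norm x \<le> 2 * R \<Longrightarrow>
      D / R\<^sup>2 * (2 * (D / R\<^sup>2) / Fdual F x powr \<alpha>) powr (2 * t) \<le> Q * R powr (- 2 - 2 * t * (2 + \<alpha>))"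
    using annulus_tail_le[OF D t(1)] by blast
  have "C * ((softexp t (u x))\<^sup>2 * (norm (grad (\<lambda>x. cutoff R x ^ Suc n) x))\<^sup>2)
      \<le> 1 / 2 * (weighted_source t x * cutoff R x ^ (2 * Suc n))
        + Q * R powr (- 2 - 2 * t * (2 + \<alpha>)) * indicator (cball 0 (2 * R)) x" if R: "R > 0" for R x
  proof (cases "R \<le> norm x \<and> norm x \<le> 2 * R")
    case False
    then have "grad (\<lambda>x. cutoff R x ^ Suc n) x = 0"
      by (intro grad_cutoff_power_eq_0 R) auto
    then show ?thesis
      using weighted_source_nonneg[of t x] cutoff_nonneg[of R x] Q(1) by (simp del: power_Suc)
  next
    case True
    let ?\<zeta> = "cutoff R x" and ?\<beta> = "softexp t (u x)"
    have "x \<noteq> 0" using True R by auto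
    have "C * (?\<beta>\<^sup>2 * (norm (grad (\<lambda>x. cutoff R x ^ Suc n) x))\<^sup>2)
        \<le> C * (?\<beta>\<^sup>2 * ((real (Suc n) * (32 * exp 1))\<^sup>2 / R\<^sup>2 * ?\<zeta> ^ (2 * n)))"
      using C by (intro mult_left_mono norm_grad_cutoff_power_le R) auto
    also have "\<dots> = D / R\<^sup>2 * (?\<beta>\<^sup>2 * ?\<zeta> ^ (2 * n))"
      by (simp add: D_def)
    also have "\<dots> \<le> 1 / 2 * (weighted_source t x * ?\<zeta> ^ (2 * Suc n))
        + D / R\<^sup>2 * (2 * (D / R\<^sup>2) / Fdual F x powr \<alpha>) powr (2 * t)"
      unfolding weighted_source_def source_def using D R t Fdual_pos[OF \<open>x \<noteq> 0\<close>]
      by (intro absorb_or_control cutoff_nonneg cutoff_le_1 softexp_pos softexp_le_exp) auto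
    also have "\<dots> \<le> 1 / 2 * (weighted_source t x * ?\<zeta> ^ (2 * Suc n)) + Q * R powr (- 2 - 2 * t * (2 + \<alpha>))"
      using Q(2)[OF R] True by (intro add_left_mono) auto
    finally show ?thesis using True by simp
  qed
  then show ?thesis by (rule that)
qed

lemma cutoff_energy_le_volume:
  assumes t: "0 < t" "t < 2"
  obtains Q where
    "\<And>R. R > 0 \<Longrightarrow> integrable lborel (\<lambda>x. weighted_source t x * cutoff R x ^ 10)"
    "\<And>R. R > 0 \<Longrightarrow> (\<integral>x. weighted_source t x * cutoff R x ^ 10 \<partial>lborel)
      \<le> Q * R powr (- 2 - 2 * t * (2 + \<alpha>)) * measure lborel (cball (0::'a) (2 * R))"
proof -
  let ?e = "- 2 - 2 * t * (2 + \<alpha>)"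
  obtain C where C: "C > 0"
    "\<And>\<eta>. test_fun \<eta> \<Longrightarrow> integrable lborel (\<lambda>x. (softexp t (u x))\<^sup>2 * (norm (grad \<eta> x))\<^sup>2)"
    "\<And>\<eta>. test_fun \<eta> \<Longrightarrow> integrable lborel (\<lambda>x. weighted_source t x * (\<eta> x)\<^sup>2)"
    "\<And>\<eta>. test_fun \<eta> \<Longrightarrow> (\<integral>x. weighted_source t x * (\<eta> x)\<^sup>2 \<partial>lborel)
       \<le> C * (\<integral>x. (softexp t (u x))\<^sup>2 * (norm (grad \<eta> x))\<^sup>2 \<partial>lborel)"
    by (rule energy_estimate[OF t]) (rule that; assumption)
  obtain Q where Q: "\<And>R x. R > 0 \<Longrightarrow>
      C * ((softexp t (u x))\<^sup>2 * (norm (grad (\<lambda>x. cutoff R x ^ 5) x))\<^sup>2)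
        \<le> 1 / 2 * (weighted_source t x * cutoff R x ^ 10)
          + Q * R powr ?e * indicator (cball 0 (2 * R)) x"
    using cutoff_gradient_absorption[OF t(1) _ C(1), of 4] t(2) by auto
  have \<eta>: "test_fun (\<lambda>x::'a. cutoff R x ^ 5)" if "R > 0" for R
    using that by (intro test_fun_power test_fun_cutoff) simp_all
  have square: "(cutoff R x ^ 5)\<^sup>2 = cutoff R x ^ 10" for R and x :: 'a
    by (simp add: power_mult[symmetric])
  have int: "integrable lborel (\<lambda>x. weighted_source t x * cutoff R x ^ 10)" if "R > 0" for R
    using C(3)[OF \<eta>[OF that]] unfolding square .
  have "(\<integral>x. weighted_source t x * cutoff R x ^ 10 \<partial>lborel)
      \<le> 2 * Q * R powr ?e * measure lborel (cball (0::'a) (2 * R))"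
    if R: "R > 0" for R
  proof -
    have ball: "integrable lborel (\<lambda>x::'a. Q * R powr ?e * indicator (cball 0 (2 * R)) x)"
      by (intro integrable_mult_right integrable_real_indicator emeasure_lborel_cball_finite) simp
    have "(\<integral>x. weighted_source t x * cutoff R x ^ 10 \<partial>lborel)
        \<le> (\<integral>x. C * ((softexp t (u x))\<^sup>2 * (norm (grad (\<lambda>x. cutoff R x ^ 5) x))\<^sup>2) \<partial>lborel)"
      using C(4)[OF \<eta>[OF R]] unfolding square by simp
    also have "\<dots> \<le> (\<integral>x. 1 / 2 * (weighted_source t x * cutoff R x ^ 10)
        + Q * R powr ?e * indicator (cball 0 (2 * R)) x \<partial>lborel)"
      by (intro integral_mono Bochner_Integration.integrable_add
          integrable_mult_right C(2) \<eta> int ball Q R)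
    also have "\<dots> = 1 / 2 * (\<integral>x. weighted_source t x * cutoff R x ^ 10 \<partial>lborel)
        + Q * R powr ?e * measure lborel (cball (0::'a) (2 * R))"
      by (subst Bochner_Integration.integral_add[OF integrable_mult_right[OF int[OF R]] ball]) simp
    finally show ?thesis by simp
  qed
  with int show ?thesis by (rule that)
qed

lemma cutoff_estimate:
  assumes t: "0 < t" "t < 2"
  obtains Q where
    "\<And>R. R > 0 \<Longrightarrow> integrable lborel (\<lambda>x. weighted_source t x * cutoff R x ^ 10)"
    "\<And>R. R > 0 \<Longrightarrow> (\<integral>x. weighted_source t x * cutoff R x ^ 10 \<partial>lborel)
      \<le> Q * R powr (real DIM('a) - 2 - 2 * t * (2 + \<alpha>))"
proof -
  let ?N = "DIM('a)" and ?e = "- 2 - 2 * t * (2 + \<alpha>)"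
  let ?I = "\<lambda>R. \<integral>x. weighted_source t x * cutoff R x ^ 10 \<partial>lborel"
  obtain Q where int: "\<And>R. R > 0 \<Longrightarrow> integrable lborel (\<lambda>x. weighted_source t x * cutoff R x ^ 10)"
    and Q: "\<And>R. R > 0 \<Longrightarrow> ?I R \<le> Q * R powr ?e * measure lborel (cball (0::'a) (2 * R))"
    by (rule cutoff_energy_le_volume[OF t]) (rule that; assumption)
  define V where "V = Q * (unit_ball_vol (real ?N) * 2 ^ ?N)"
  have "?I R \<le> V * R powr (real ?N - 2 - 2 * t * (2 + \<alpha>))" if R: "R > 0" for R
  proof -
    have "?I R \<le> V * (R powr ?e * R powr real ?N)"
      using Q[OF R] R by (simp add: content_cball V_def powr_realpow power_mult_distrib mult_ac)
    also have "R powr ?e * R powr real ?N = R powr (real ?N - 2 - 2 * t * (2 + \<alpha>))"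
      unfolding powr_add[symmetric] by (simp add: algebra_simps)
    finally show ?thesis .
  qed
  with int show ?thesis by (rule that)
qed

lemma weighted_source_pos: "AE x in lborel. 0 < weighted_source t x"
  using AE_lborel_singleton[of "0::'a"]
proof eventually_elim
  case (elim x)
  then show ?case
    using Fdual_pos[of x] softexp_pos[of t "u x"] by (simp add: weighted_source_def source_def)
qed

lemma indicator_weighted_source_le:
  assumes "r \<le> R"
  shows "indicator (cball 0 r) x *\<^sub>R weighted_source t x \<le> weighted_source t x * cutoff R x ^ n"
  using assms weighted_source_nonneg[of t x] cutoff_eq_1[of x R] cutoff_nonneg[of R x]
  by (simp add: indicator_def)

lemma set_integrable_weighted_source:
  assumes "integrable lborel (\<lambda>x. weighted_source t x * cutoff R x ^ n)" "r \<le> R"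
  shows "set_integrable lborel (cball 0 r) (weighted_source t)"
  unfolding set_integrable_def
proof (rule Bochner_Integration.integrable_bound[OF assms(1)])
  show "(\<lambda>x. indicator (cball 0 r) x *\<^sub>R weighted_source t x) \<in> borel_measurable lborel"
    using weighted_source_measurable
    by (intro borel_measurable_scaleR borel_measurable_indicator) simp_all
  show "AE x in lborel. norm (indicator (cball 0 r) x *\<^sub>R weighted_source t x)
      \<le> norm (weighted_source t x * cutoff R x ^ n)"
    using order_trans[OF indicator_weighted_source_le[OF assms(2)] abs_ge_self]
      weighted_source_nonneg
    by (intro AE_I2) (simp add: abs_mult)
qed

lemma source_decay:
  assumes t: "0 < t" "t < 2"
  obtains I Q where "I > 0" "\<And>R. R \<ge> 1 \<Longrightarrow> I \<le> Q * R powr (real DIM('a) - 2 - 2 * t * (2 + \<alpha>))"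
proof -
  let ?K = "cball (0::'a) 1"
  obtain Q where int: "\<And>R. R > 0 \<Longrightarrow> integrable lborel (\<lambda>x. weighted_source t x * cutoff R x ^ 10)"
    and Q: "\<And>R. R > 0 \<Longrightarrow> (\<integral>x. weighted_source t x * cutoff R x ^ 10 \<partial>lborel)
      \<le> Q * R powr (real DIM('a) - 2 - 2 * t * (2 + \<alpha>))"
    by (rule cutoff_estimate[OF t]) (rule that; assumption)
  have K_int: "set_integrable lborel ?K (weighted_source t)"
    using int[of 1] by (intro set_integrable_weighted_source) auto
  show ?thesis
  proof (rule that)
    have "measure lborel ?K \<noteq> 0"
      by simp
    then have "?K \<notin> null_sets lborel"
      by (auto simp: null_sets_def measure_def)
    then show "0 < (LINT x:?K|lborel. weighted_source t x)"
      by (intro set_integral_pos K_int weighted_source_pos) (simp_all add: weighted_source_nonneg)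
    show "(LINT x:?K|lborel. weighted_source t x) \<le> Q * R powr (real DIM('a) - 2 - 2 * t * (2 + \<alpha>))"
      if "R \<ge> 1" for R
    proof -
      have "(LINT x:?K|lborel. weighted_source t x)
          \<le> (\<integral>x. weighted_source t x * cutoff R x ^ 10 \<partial>lborel)"
        unfolding set_lebesgue_integral_def
        using that
        by (intro integral_mono K_int[unfolded set_integrable_def] int indicator_weighted_source_le)
          auto
      also have "\<dots> \<le> Q * R powr (real DIM('a) - 2 - 2 * t * (2 + \<alpha>))"
        using that by (intro Q) simp
      finally show ?thesis .
    qed
  qed
qed

lemma decay_exponent_nonneg:
  assumes t: "0 < t" "t < 2"
  shows "0 \<le> real DIM('a) - 2 - 2 * t * (2 + \<alpha>)" (is "0 \<le> ?p")
proof (rule ccontr)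
  assume "\<not> 0 \<le> ?p"
  then have p: "?p < 0" by simp
  obtain I Q where I: "I > 0" and Q: "\<And>R. R \<ge> 1 \<Longrightarrow> I \<le> Q * R powr ?p"
    by (rule source_decay[OF t]) (rule that; assumption)
  have "((\<lambda>R. Q * R powr ?p) \<longlongrightarrow> Q * 0) at_top"
    by (intro tendsto_mult tendsto_const tendsto_neg_powr p filterlim_ident)
  moreover have "\<forall>\<^sub>F R in at_top. I \<le> Q * R powr ?p"
    using eventually_ge_at_top[of 1] by eventually_elim (rule Q)
  ultimately have "I \<le> Q * 0"
    by (rule tendsto_lowerbound) simp
  with I show False by simp
qed

end

theorem theorem1p5:
  fixes F :: "'a::euclidean_space \<Rightarrow> real" and \<alpha> :: real
  assumes "admissible_F F"
    and "\<alpha> > -2"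
    and "2 \<le> DIM('a)"
    and "real DIM('a) < 10 + 4 * \<alpha>"
  shows "\<not> (\<exists>u Du. weak_solution F \<alpha> u Du \<and> stable F \<alpha> u Du)"
proof
  assume "\<exists>u Du. weak_solution F \<alpha> u Du \<and> stable F \<alpha> u Du"
  then obtain u Du where "weak_solution F \<alpha> u Du" "stable F \<alpha> u Du" by blast
  then interpret stable_solution F \<alpha> u Du
    using assms(1) by unfold_locales
  let ?T = "(real DIM('a) - 2) / (2 * (2 + \<alpha>))"
  have "0 \<le> ?T" "?T < 2"
    using assms(2-4) by (auto simp: field_simps)
  then obtain t where t: "?T < t" "t < 2" "0 < t"
    using dense[of ?T 2] by auto
  then have "real DIM('a) - 2 < 2 * t * (2 + \<alpha>)"
    using assms(2) by (simp add: pos_divide_less_eq mult_ac)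
  with decay_exponent_nonneg[OF t(3,2)] show False by simp
qed

end
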